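(* Let $H$ be a Hopf algebra with invertible antipode, $B$ a $\sigma$-twisted left $H$-module algebra, $(\Omega^1(H),\mathrm{d}_H)$ a bicovariant FODC on $H$ and $(\Omega^1(B),\mathrm{d}_B)$ a $\sigma$-twisted $H$-module FODC on $B$. Set $$\Omega^1(B\#_\sigma H):=(\Omega^1(B)\otimes H)\oplus(B\otimes\Omega^1(H)),\qquad \mathrm{d}_{\#_\sigma}:B\#_\sigma H\to\Omega^1(B\#_\sigma H),\quad b\otimes h\mapsto \mathrm{d}_Bb\otimes h+b\otimes\mathrm{d}_Hh,$$ where $\Omega^1(B\#_\sigma H)$ is endowed, for $b,b'\in B$, $h,h'\in H$, $\beta\in\Omega^1(B)$, $\gamma\in\Omega^1(H)$, with the left and right $B\#_\sigma H$-actions $$(b'\otimes h')\cdot(\beta\otimes h+b\otimes\gamma)=b'(h'_1\cdot\beta)\sigma(h'_2\otimes h_1)\otimes h'_3h_2+b'(h'_1\cdot b)\sigma(h'_2\otimes\gamma_{-1})\otimes h'_3\gamma_0,$$ $$(\beta\otimes h+b\otimes\gamma)\cdot(b'\otimes h')=\beta(h_1\cdot b')\sigma(h_2\otimes h'_1)\otimes h_3h'_2+b(\gamma_{-2}\cdot b')\sigma(\gamma_{-1}\otimes h'_1)\otimes\gamma_0h'_2,$$ and the right $H$-coaction $\beta\otimes h+b\otimes\gamma\mapsto\beta\otimes h_1\otimes h_2+b\otimes\gamma_0\otimes\gamma_1$. Then $(\Omega^1(B\#_\sigma H),\mathrm{d}_{\#_\sigma})$ is a right $H$-covariant FODC on $B\#_\sigma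 H$. Moreover, the right $H$-coaction $\rho=\mathrm{Id}_B\otimes\Delta:B\#_\sigma H\to(B\#_\sigma H)\otimes H$ is differentiable with respect to this calculus on $B\#_\sigma H$ and the tensor product calculus on $(B\#_\sigma H)\otimes H$.
   Context: Everything is over a field $\Bbbk$; algebras are associative and unital. Sweedler notation: $\Delta(h)=h_1\otimes h_2$; right coactions $m\mapsto m_0\otimes m_1$; left coactions $m\mapsto m_{-1}\otimes m_0$, with $m_{-2}\otimes m_{-1}\otimes m_0$ the iterated left coaction. $B$ is a $\sigma$-twisted left $H$-module algebra: there are a linear map $\cdot:H\otimes B\to B$ (a measure) with $h\cdot 1_B=\varepsilon(h)1_B$, $h\cdot(bb')=(h_1\cdot b)(h_2\cdot b')$, and a convolution invertible linear map $\sigma:H\otimes H\to B$ with convolution inverse $\sigma^{-1}$, such that $1_H\cdot b=b$, $h\cdot(h'\cdot b)=\sigma(h_1\otimes h'_1)(h_2h'_2\cdot b)\sigma^{-1}(h_3\otimes h'_3)$, $\sigma(h\otimes1_H)=\varepsilon(h)1_B=\sigma(1_H\otimes h)$ and $(h_1\cdot\sigma(h'_1\otimes h''_1))\sigma(h_2\otimes h'_2h''_2)=\sigma(h_1\otimes h'_1)\sigma(h_2h'_2\otimes h'')$. The crossed product algebra $B\#_\sigma H$ is $B\otimes H$ with unit $1_B\otimes1_H$ and product $(b\otimes h)(b'\otimes h')=b(h_1\cdot b')\sigma(h_2\otimes h'_1)\otimes h_3h'_2$; it is a right $H$-comodule algebra via $\mathrm{Id}_B\otimes\Delta$. A first order differential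 calculus (FODC) on an algebra $A$ is a pair $(\Omega^1(A),\mathrm{d}_A)$ with $\Omega^1(A)$ an $A$-bimodule, $\mathrm{d}_A:A\to\Omega^1(A)$ linear, $\mathrm{d}_A(ab)=(\mathrm{d}_Aa)b+a\,\mathrm{d}_Ab$, and $\Omega^1(A)=\mathrm{span}_\Bbbk\{a\,\mathrm{d}_Ab\}$. If $A$ is a right $H$-comodule algebra, a FODC is right $H$-covariant if $\Omega^1(A)$ is a right $H$-comodule with coaction compatible with both $A$-actions, $(a\omega a')_0\otimes(a\omega a')_1=a_0\omega_0a'_0\otimes a_1\omega_1a'_1$, and $\mathrm{d}_A$ is right $H$-colinear. A bicovariant FODC on $H$ is one for which $\Omega^1(H)$ is an $H$-bicomodule with left and right coactions compatible (in the analogous sense) with the $H$-bimodule structure and $\mathrm{d}_H$ is left and right $H$-colinear ($H$ coacting on itself by $\Delta$). A FODC $(\Omega^1(B),\mathrm{d}_B)$ is a $\sigma$-twisted $H$-module FODC if there is a linear map $\cdot:H\otimes\Omega^1(B)\to\Omega^1(B)$ with $h\cdot(b\,\mathrm{d}_Bb')=(h_1\cdot b)(h_2\cdot\mathrm{d}_Bb')$, $\mathrm{d}_B(h\cdot b)=h\cdot\mathrm{d}_Bb$ and $\mathrm{d}_B\circ\sigma=0$. Given FODCi on $A$ and $A'$, an algebra map $f:A\to A'$ is differentiable if there is an $A$-bimodule map $\widehat f:\Omega^1(A)\to\Omega^1(A')$ (with $A$ acting on $\Omega^1(A')$ via $f$) such that $\widehat f\circ\mathrm{d}_A=\mathrm{d}_{A'}\circ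 f$. The tensor product calculus on $A\otimes A'$ is $\Omega^1(A\otimes A')=(\Omega^1(A)\otimes A')\oplus(A\otimes\Omega^1(A'))$ with componentwise actions and $\mathrm{d}_\otimes(a\otimes a')=\mathrm{d}_Aa\otimes a'+a\otimes\mathrm{d}_{A'}a'$. *)

theory Defs
  imports "HOL.Vector_Spaces" "HOL-Library.Function_Algebras" "HOL-Library.Product_Plus"
begin

section \<open>Vector spaces and tensor products\<close>

text \<open>The ground field is a type of class \<^class>\<open>field\<close>.  A vector space is a subspace
  (the carrier) of an ambient type with a scalar multiplication; addition is that of the ambient
  type.  Taking the whole type as carrier gives every vector space over \<open>'k\<close>; carriers are needed
  because tensor products are only subspaces of their ambient types.\<close>

record ('k, 'v) space =
  carr :: "'v set"
  scl :: "'k \<Rightarrow> 'v \<Rightarrow> 'v"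

definition vspace :: "('k::field, 'v::ab_group_add, 'z) space_scheme \<Rightarrow> bool" where
  "vspace V \<longleftrightarrow> vector_space (scl V) \<and> module.subspace (scl V) (carr V)"

definition ground :: "('k::field, 'k) space" where
  "ground = \<lparr>carr = UNIV, scl = (*)\<rparr>"

definition lin ::
  "('k::field, 'v::ab_group_add, 'y) space_scheme \<Rightarrow> ('k, 'w::ab_group_add, 'z) space_scheme \<Rightarrow>
   ('v \<Rightarrow> 'w) \<Rightarrow> bool" where
  "lin V W f \<longleftrightarrow>
     (\<forall>x\<in>carr V. f x \<in> carr W) \<and>
     (\<forall>x\<in>carr V. \<forall>y\<in>carr V. f (x + y) = f x + f y) \<and>
     (\<forall>c. \<forall>x\<in>carr V. f (scl V c x) = scl W c (f x))"

text \<open>Linear maps out of a tensor product \<open>V \<otimes> W\<close> given as data (measures, cocycles, actions,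
  products) are represented by the corresponding curried bilinear maps.\<close>

definition bilin ::
  "('k::field, 'v::ab_group_add, 'x) space_scheme \<Rightarrow> ('k, 'w::ab_group_add, 'y) space_scheme \<Rightarrow>
   ('k, 'u::ab_group_add, 'z) space_scheme \<Rightarrow> ('v \<Rightarrow> 'w \<Rightarrow> 'u) \<Rightarrow> bool" where
  "bilin V W U f \<longleftrightarrow>
     (\<forall>v\<in>carr V. lin W U (f v)) \<and> (\<forall>w\<in>carr W. lin V U (\<lambda>v. f v w))"

text \<open>The tensor product over a field is realised inside the functionals on the bilinear forms:
  \<open>v \<otimes> w\<close> is evaluation at \<open>(v, w)\<close>, and \<open>V \<otimes> W\<close> consists of the finite sums of such elements.
  The universal property is \<open>bilin_tens\<close>, \<open>tlift_tens\<close> and \<open>lin_tlift\<close> below.\<close>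

type_synonym ('k, 'v, 'w) tensor = "('v \<Rightarrow> 'w \<Rightarrow> 'k) \<Rightarrow> 'k"

definition tens ::
  "('k::field, 'v::ab_group_add, 'y) space_scheme \<Rightarrow> ('k, 'w::ab_group_add, 'z) space_scheme \<Rightarrow>
   'v \<Rightarrow> 'w \<Rightarrow> ('k, 'v, 'w) tensor" where
  "tens V W v w = (\<lambda>\<phi>. if bilin V W ground \<phi> then \<phi> v w else 0)"

definition tensor_space ::
  "('k::field, 'v::ab_group_add, 'y) space_scheme \<Rightarrow> ('k, 'w::ab_group_add, 'z) space_scheme \<Rightarrow>
   ('k, ('k, 'v, 'w) tensor) space" where
  "tensor_space V W =
     \<lparr>carr = {\<Sum>(v, w)\<leftarrow>xs. tens V W v w | xs. set xs \<subseteq> carr V \<times> carr W},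
      scl = (\<lambda>c X \<phi>. c * X \<phi>)\<rparr>"

text \<open>\<open>tlift V W f X\<close> is \<open>\<Sum>i. f (v i) (w i)\<close> for \<open>X = \<Sum>i. v i \<otimes> w i\<close>: the linear map on
  \<open>V \<otimes> W\<close> induced by a bilinear \<open>f\<close>.\<close>

definition tlift ::
  "('k::field, 'v::ab_group_add, 'y) space_scheme \<Rightarrow> ('k, 'w::ab_group_add, 'z) space_scheme \<Rightarrow>
   ('v \<Rightarrow> 'w \<Rightarrow> 'u::ab_group_add) \<Rightarrow> ('k, 'v, 'w) tensor \<Rightarrow> 'u" where
  "tlift V W f X =
     (let xs = (SOME xs. set xs \<subseteq> carr V \<times> carr W \<and> X = (\<Sum>(v, w)\<leftarrow>xs. tens V W v w))
      in \<Sum>(v, w)\<leftarrow>xs. f v w)"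

definition direct_sum ::
  "('k::field, 'v::ab_group_add, 'y) space_scheme \<Rightarrow> ('k, 'w::ab_group_add, 'z) space_scheme \<Rightarrow>
   ('k, 'v \<times> 'w) space" where
  "direct_sum V W =
     \<lparr>carr = carr V \<times> carr W, scl = (\<lambda>c (v, w). (scl V c v, scl W c w))\<rparr>"

lemma sum_list_fun_apply: "sum_list (map f xs) a = (\<Sum>x\<leftarrow>xs. f x a)"
  by (induction xs) (auto simp: zero_fun_def plus_fun_def)

lemma vspace_mem:
  assumes "vspace V"
  shows "0 \<in> carr V"
    and "x \<in> carr V \<Longrightarrow> y \<in> carr V \<Longrightarrow> x + y \<in> carr V"
    and "x \<in> carr V \<Longrightarrow> scl V c x \<in> carr V"
    and "x \<in> carr V \<Longrightarrow> y \<in> carr V \<Longrightarrow> x - y \<in> carr V"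
proof -
  interpret vector_space "scl V" using assms by (simp add: vspace_def)
  have s: "subspace (carr V)" using assms by (simp add: vspace_def)
  show "0 \<in> carr V" using s by (rule subspace_0)
  show "x \<in> carr V \<Longrightarrow> y \<in> carr V \<Longrightarrow> x + y \<in> carr V" using s by (rule subspace_add)
  show "x \<in> carr V \<Longrightarrow> scl V c x \<in> carr V" using s by (rule subspace_scale)
  show "x \<in> carr V \<Longrightarrow> y \<in> carr V \<Longrightarrow> x - y \<in> carr V" using s by (rule subspace_diff)
qed

lemma separating_functional:
  assumes V: "vspace V" and u: "u \<noteq> 0"
  obtains g where "lin V ground g" "g u \<noteq> 0"
proof -
  have vs: "vector_space (scl V)" using V by (simp add: vspace_def)
  have vk: "vector_space ((*) :: 'a \<Rightarrow> 'a \<Rightarrow> 'a)"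
    by unfold_locales (auto simp: algebra_simps)
  interpret vector_space_pair "scl V" "(*) :: 'a \<Rightarrow> 'a \<Rightarrow> 'a"
    using vs vk by (simp add: vector_space_pair_def)
  have "vs1.independent {u}" using u by simp
  from linear_independent_extend[OF this, of "\<lambda>_. 1"]
  obtain g where g: "Vector_Spaces.linear (scl V) (*) g" "g u = 1" by auto
  interpret g: Vector_Spaces.linear "scl V" "(*)" g by (rule g(1))
  have "lin V ground g" by (simp add: lin_def ground_def g.add g.scale)
  with g(2) that show thesis by simp
qed

lemma tens_mem: "v \<in> carr V \<Longrightarrow> w \<in> carr W \<Longrightarrow> tens V W v w \<in> carr (tensor_space V W)"
  unfolding tensor_space_def by (auto intro!: exI[of _ "[(v, w)]"])

lemma bilin_tens:
  shows "bilin V W (tensor_space V W) (tens V W)"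
  unfolding bilin_def
proof (intro conjI ballI)
  fix v assume "v \<in> carr V"
  then show "lin W (tensor_space V W) (tens V W v)"
    unfolding lin_def
    by (auto simp: tens_mem)
      (auto simp: tensor_space_def tens_def fun_eq_iff bilin_def lin_def ground_def)
next
  fix w assume "w \<in> carr W"
  then show "lin V (tensor_space V W) (\<lambda>v. tens V W v w)"
    unfolding lin_def
    by (auto simp: tens_mem)
      (auto simp: tensor_space_def tens_def fun_eq_iff bilin_def lin_def ground_def)
qed

lemma tensor_relation:
  assumes U: "vspace U" and f: "bilin V W U f"
    and xs: "set xs \<subseteq> carr V \<times> carr W" and ys: "set ys \<subseteq> carr V \<times> carr W"
    and eq: "(\<Sum>(v, w)\<leftarrow>xs. tens V W v w) = (\<Sum>(v, w)\<leftarrow>ys. tens V W v w)"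
  shows "(\<Sum>(v, w)\<leftarrow>xs. f v w) = (\<Sum>(v, w)\<leftarrow>ys. f v w)"
proof (rule ccontr)
  assume "\<not> ?thesis"
  then obtain g where g: "lin U ground g"
    and ne: "g ((\<Sum>(v, w)\<leftarrow>xs. f v w) - (\<Sum>(v, w)\<leftarrow>ys. f v w)) \<noteq> 0"
    using separating_functional[OF U, of "(\<Sum>(v, w)\<leftarrow>xs. f v w) - (\<Sum>(v, w)\<leftarrow>ys. f v w)"]
    by (metis right_minus_eq)
  have b: "bilin V W ground (\<lambda>v w. g (f v w))"
    using f g by (auto simp: bilin_def lin_def)
  have fU: "f v w \<in> carr U" if "v \<in> carr V" "w \<in> carr W" for v w
    using f that by (auto simp: bilin_def lin_def)
  have g0: "g 0 = 0"
    using g vspace_mem(1)[OF U] by (auto simp: lin_def) (metis add.right_neutral add_cancel_right_right)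
  have gs: "(\<Sum>(v, w)\<leftarrow>zs. f v w) \<in> carr U \<and>
      g (\<Sum>(v, w)\<leftarrow>zs. f v w) = (\<Sum>(v, w)\<leftarrow>zs. tens V W v w) (\<lambda>v w. g (f v w))"
    if "set zs \<subseteq> carr V \<times> carr W" for zs
    using that
  proof (induction zs)
    case Nil
    then show ?case by (simp add: g0 vspace_mem(1)[OF U] zero_fun_def)
  next
    case (Cons z zs)
    then show ?case using g fU b
      by (auto simp: vspace_mem(2)[OF U] lin_def tens_def plus_fun_def)
  qed
  let ?x = "\<Sum>(v, w)\<leftarrow>xs. f v w" and ?y = "\<Sum>(v, w)\<leftarrow>ys. f v w"
  have "?x - ?y \<in> carr U"
    using gs[OF xs] gs[OF ys] by (simp add: vspace_mem(4)[OF U])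
  then have "g ((?x - ?y) + ?y) = g (?x - ?y) + g ?y"
    using g gs[OF ys] unfolding lin_def by blast
  with gs[OF xs] gs[OF ys] eq ne show False by simp
qed

lemma tlift_sum:
  assumes "vspace U" "bilin V W U f" "set xs \<subseteq> carr V \<times> carr W"
  shows "tlift V W f (\<Sum>(v, w)\<leftarrow>xs. tens V W v w) = (\<Sum>(v, w)\<leftarrow>xs. f v w)"
proof -
  define P where "P ys \<longleftrightarrow> set ys \<subseteq> carr V \<times> carr W \<and>
    (\<Sum>(v, w)\<leftarrow>xs. tens V W v w) = (\<Sum>(v, w)\<leftarrow>ys. tens V W v w)" for ys
  have "P (SOME ys. P ys)" by (rule someI[of P xs]) (simp add: P_def assms(3))
  then show ?thesis
    unfolding tlift_def Let_def P_def[symmetric]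
    using tensor_relation[OF assms(1,2)] assms(3) by (metis P_def)
qed

lemma tlift_tens:
  assumes "vspace U" "bilin V W U f" "v \<in> carr V" "w \<in> carr W"
  shows "tlift V W f (tens V W v w) = f v w"
  using tlift_sum[OF assms(1,2), of "[(v, w)]"] assms(3,4) by simp

lemma lin_tlift:
  assumes V: "vspace V" and U: "vspace U" and f: "bilin V W U f"
  shows "lin (tensor_space V W) U (tlift V W f)"
proof -
  have mem: "(\<Sum>(v, w)\<leftarrow>xs. f v w) \<in> carr U" if "set xs \<subseteq> carr V \<times> carr W" for xs
    using that f
    by (induction xs) (auto simp: vspace_mem[OF U] bilin_def lin_def)
  have scale: "scl (tensor_space V W) c (\<Sum>(v, w)\<leftarrow>xs. tens V W v w)
        = (\<Sum>(v, w)\<leftarrow>map (\<lambda>(v, w). (scl V c v, w)) xs. tens V W v w)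
      \<and> scl U c (\<Sum>(v, w)\<leftarrow>xs. f v w)
        = (\<Sum>(v, w)\<leftarrow>map (\<lambda>(v, w). (scl V c v, w)) xs. f v w)"
    if "set xs \<subseteq> carr V \<times> carr W" for xs c
    using that
  proof (induction xs)
    case Nil
    interpret vector_space "scl U" using U by (simp add: vspace_def)
    show ?case by (simp add: tensor_space_def fun_eq_iff)
  next
    case (Cons x xs)
    interpret vector_space "scl U" using U by (simp add: vspace_def)
    obtain v w where x: "x = (v, w)" by (cases x)
    have vw: "v \<in> carr V" "w \<in> carr W" using Cons.prems x by auto
    have "scl (tensor_space V W) c (tens V W v w) = tens V W (scl V c v) w"
      using vw by (auto simp: tensor_space_def tens_def fun_eq_iff bilin_def lin_def ground_def)
    moreover have "scl U c (f v w) = f (scl V c v) w"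
      using f vw by (auto simp: bilin_def lin_def)
    moreover have "scl (tensor_space V W) c (X + Y)
        = scl (tensor_space V W) c X + scl (tensor_space V W) c Y" for X Y
      by (simp add: tensor_space_def fun_eq_iff distrib_left)
    ultimately show ?case using Cons
      by (simp only: x list.map sum_list.Cons prod.case scale_right_distrib list.set insert_subset simp_thms)
  qed
  note ts = tlift_sum[OF U f]
  show ?thesis unfolding lin_def
  proof (intro conjI ballI allI)
    fix X assume "X \<in> carr (tensor_space V W)"
    then obtain xs where xs: "set xs \<subseteq> carr V \<times> carr W" and X: "X = (\<Sum>(v, w)\<leftarrow>xs. tens V W v w)"
      by (auto simp: tensor_space_def)
    show "tlift V W f X \<in> carr U" using ts[OF xs] mem[OF xs] X by simp
    fix c
    have sub: "set (map (\<lambda>(v, w). (scl V c v, w)) xs) \<subseteq> carr V \<times> carr W"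
      using xs by (auto simp: vspace_mem[OF V])
    show "tlift V W f (scl (tensor_space V W) c X) = scl U c (tlift V W f X)"
      unfolding X using scale[OF xs, of c] ts[OF xs] ts[OF sub] by metis
  next
    fix X Y assume "X \<in> carr (tensor_space V W)" "Y \<in> carr (tensor_space V W)"
    then obtain xs ys where xs: "set xs \<subseteq> carr V \<times> carr W" and X: "X = (\<Sum>(v, w)\<leftarrow>xs. tens V W v w)"
      and ys: "set ys \<subseteq> carr V \<times> carr W" and Y: "Y = (\<Sum>(v, w)\<leftarrow>ys. tens V W v w)"
      by (auto simp: tensor_space_def)
    have XY: "X + Y = (\<Sum>(v, w)\<leftarrow>xs @ ys. tens V W v w)" by (simp add: X Y)
    have sub: "set (xs @ ys) \<subseteq> carr V \<times> carr W" using xs ys by simp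
    show "tlift V W f (X + Y) = tlift V W f X + tlift V W f Y"
      unfolding XY ts[OF sub] unfolding X Y ts[OF xs] ts[OF ys] by simp
  qed
qed


section \<open>Algebras and Hopf algebras\<close>

record ('k, 'a) alg = "('k, 'a) space" +
  mul :: "'a \<Rightarrow> 'a \<Rightarrow> 'a"  (infixl \<open>\<cdot>\<index>\<close> 70)
  unt :: 'a  (\<open>\<one>\<index>\<close>)

locale k_algebra =
  fixes A :: "('k::field, 'a::ab_group_add, 'z) alg_scheme"
  assumes vspace_alg: "vspace A"
    and bilin_mul: "bilin A A A (mul A)"
    and unt_mem: "\<one>\<^bsub>A\<^esub> \<in> carr A"
    and mul_assoc: "\<lbrakk>a \<in> carr A; b \<in> carr A; c \<in> carr A\<rbrakk> \<Longrightarrow>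
      (a \<cdot>\<^bsub>A\<^esub> b) \<cdot>\<^bsub>A\<^esub> c = a \<cdot>\<^bsub>A\<^esub> (b \<cdot>\<^bsub>A\<^esub> c)"
    and mul_unt_left: "a \<in> carr A \<Longrightarrow> \<one>\<^bsub>A\<^esub> \<cdot>\<^bsub>A\<^esub> a = a"
    and mul_unt_right: "a \<in> carr A \<Longrightarrow> a \<cdot>\<^bsub>A\<^esub> \<one>\<^bsub>A\<^esub> = a"

definition alg_hom ::
  "('k::field, 'a::ab_group_add, 'y) alg_scheme \<Rightarrow> ('k, 'c::ab_group_add, 'z) alg_scheme \<Rightarrow>
   ('a \<Rightarrow> 'c) \<Rightarrow> bool" where
  "alg_hom A C f \<longleftrightarrow> lin A C f \<and> f \<one>\<^bsub>A\<^esub> = \<one>\<^bsub>C\<^esub> \<and>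
     (\<forall>a\<in>carr A. \<forall>b\<in>carr A. f (a \<cdot>\<^bsub>A\<^esub> b) = f a \<cdot>\<^bsub>C\<^esub> f b)"

definition tensor_alg ::
  "('k::field, 'a::ab_group_add, 'y) alg_scheme \<Rightarrow> ('k, 'c::ab_group_add, 'z) alg_scheme \<Rightarrow>
   ('k, ('k, 'a, 'c) tensor) alg" where
  "tensor_alg A C =
     \<lparr>carr = carr (tensor_space A C), scl = scl (tensor_space A C),
      mul = (\<lambda>X Y. tlift A C (\<lambda>a c. tlift A C (\<lambda>a' c'.
               tens A C (a \<cdot>\<^bsub>A\<^esub> a') (c \<cdot>\<^bsub>C\<^esub> c')) Y) X),
      unt = tens A C \<one>\<^bsub>A\<^esub> \<one>\<^bsub>C\<^esub>\<rparr>"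

record ('k, 'h) hopf = "('k, 'h) alg" +
  comul :: "'h \<Rightarrow> ('k, 'h, 'h) tensor"
  counit :: "'h \<Rightarrow> 'k"
  antipode :: "'h \<Rightarrow> 'h"

text \<open>\<open>sw2 H f h\<close> is \<open>f(h\<^sub>1, h\<^sub>2)\<close> and \<open>sw3 H f h\<close> is \<open>f(h\<^sub>1, h\<^sub>2, h\<^sub>3)\<close> in Sweedler notation.\<close>

definition sw2 ::
  "('k::field, 'h::ab_group_add) hopf \<Rightarrow> ('h \<Rightarrow> 'h \<Rightarrow> 'u::ab_group_add) \<Rightarrow> 'h \<Rightarrow> 'u" where
  "sw2 H f h = tlift H H f (comul H h)"

definition sw3 ::
  "('k::field, 'h::ab_group_add) hopf \<Rightarrow> ('h \<Rightarrow> 'h \<Rightarrow> 'h \<Rightarrow> 'u::ab_group_add) \<Rightarrow> 'h \<Rightarrow> 'u" where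
  "sw3 H f h = sw2 H (\<lambda>h1 k. sw2 H (\<lambda>h2 h3. f h1 h2 h3) k) h"

text \<open>Threefold tensor products are bracketed to the right; \<open>(U \<otimes> V) \<otimes> W\<close> is identified with
  \<open>U \<otimes> (V \<otimes> W)\<close> wherever coassociativity has to be stated.\<close>

definition tens3 ::
  "('k::field, 'u::ab_group_add, 'x) space_scheme \<Rightarrow> ('k, 'v::ab_group_add, 'y) space_scheme \<Rightarrow>
   ('k, 'w::ab_group_add, 'z) space_scheme \<Rightarrow>
   'u \<Rightarrow> 'v \<Rightarrow> 'w \<Rightarrow> ('k, 'u, ('k, 'v, 'w) tensor) tensor" where
  "tens3 U V W u v w = tens U (tensor_space V W) u (tens V W v w)"

locale hopf_algebra = k_algebra H
  for H :: "('k::field, 'h::ab_group_add) hopf" +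
  assumes comul_hom: "alg_hom H (tensor_alg H H) (comul H)"
    and lin_counit: "lin H ground (counit H)"
    and counit_unt: "counit H \<one>\<^bsub>H\<^esub> = 1"
    and counit_mul: "\<lbrakk>h \<in> carr H; h' \<in> carr H\<rbrakk> \<Longrightarrow>
      counit H (h \<cdot>\<^bsub>H\<^esub> h') = counit H h * counit H h'"
    and coassoc: "h \<in> carr H \<Longrightarrow>
      sw2 H (\<lambda>k h3. sw2 H (\<lambda>h1 h2. tens3 H H H h1 h2 h3) k) h =
      sw2 H (\<lambda>h1 k. sw2 H (\<lambda>h2 h3. tens3 H H H h1 h2 h3) k) h"
    and counit_left: "h \<in> carr H \<Longrightarrow> sw2 H (\<lambda>h1 h2. scl H (counit H h1) h2) h = h"
    and counit_right: "h \<in> carr H \<Longrightarrow> sw2 H (\<lambda>h1 h2. scl H (counit H h2) h1) h = h"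
    and lin_antipode: "lin H H (antipode H)"
    and antipode_left: "h \<in> carr H \<Longrightarrow>
      sw2 H (\<lambda>h1 h2. antipode H h1 \<cdot>\<^bsub>H\<^esub> h2) h = scl H (counit H h) \<one>\<^bsub>H\<^esub>"
    and antipode_right: "h \<in> carr H \<Longrightarrow>
      sw2 H (\<lambda>h1 h2. h1 \<cdot>\<^bsub>H\<^esub> antipode H h2) h = scl H (counit H h) \<one>\<^bsub>H\<^esub>"


section \<open>Comodules\<close>

locale right_comodule =
  fixes H :: "('k::field, 'h::ab_group_add) hopf"
    and M :: "('k, 'm::ab_group_add, 'z) space_scheme"
    and \<rho> :: "'m \<Rightarrow> ('k, 'm, 'h) tensor"
  assumes vspace_comod: "vspace M"
    and lin_coaction: "lin M (tensor_space M H) \<rho>"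
    and coaction_coassoc: "m \<in> carr M \<Longrightarrow>
      tlift M H (\<lambda>n h2. tlift M H (\<lambda>m0 h1. tens3 M H H m0 h1 h2) (\<rho> n)) (\<rho> m) =
      tlift M H (\<lambda>m0 h. sw2 H (\<lambda>h1 h2. tens3 M H H m0 h1 h2) h) (\<rho> m)"
    and coaction_counit: "m \<in> carr M \<Longrightarrow>
      tlift M H (\<lambda>m0 h. scl M (counit H h) m0) (\<rho> m) = m"

locale left_comodule =
  fixes H :: "('k::field, 'h::ab_group_add) hopf"
    and M :: "('k, 'm::ab_group_add, 'z) space_scheme"
    and \<delta> :: "'m \<Rightarrow> ('k, 'h, 'm) tensor"
  assumes vspace_comod: "vspace M"
    and lin_coaction: "lin M (tensor_space H M) \<delta>"
    and coaction_coassoc: "m \<in> carr M \<Longrightarrow>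
      tlift H M (\<lambda>h m0. sw2 H (\<lambda>h1 h2. tens3 H H M h1 h2 m0) h) (\<delta> m) =
      tlift H M (\<lambda>h1 n. tlift H M (\<lambda>h2 m0. tens3 H H M h1 h2 m0) (\<delta> n)) (\<delta> m)"
    and coaction_counit: "m \<in> carr M \<Longrightarrow>
      tlift H M (\<lambda>h m0. scl M (counit H h) m0) (\<delta> m) = m"

locale bicomodule =
  L: left_comodule H M \<delta> + R: right_comodule H M \<rho>
  for H :: "('k::field, 'h::ab_group_add) hopf"
    and M :: "('k, 'm::ab_group_add, 'z) space_scheme"
    and \<delta> \<rho> +
  assumes coactions_commute: "m \<in> carr M \<Longrightarrow>
      tlift M H (\<lambda>n h. tlift H M (\<lambda>k m0. tens3 H M H k m0 h) (\<delta> n)) (\<rho> m) =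
      tlift H M (\<lambda>k n. tlift M H (\<lambda>m0 h. tens3 H M H k m0 h) (\<rho> n)) (\<delta> m)"

locale right_comodule_algebra =
  k_algebra A + right_comodule H A \<rho>
  for H :: "('k::field, 'h::ab_group_add) hopf"
    and A :: "('k, 'a::ab_group_add, 'z) alg_scheme"
    and \<rho> :: "'a \<Rightarrow> ('k, 'a, 'h) tensor" +
  assumes coaction_hom: "alg_hom A (tensor_alg A H) \<rho>"


section \<open>First order differential calculi\<close>

record ('k, 'a, 'm) bimod = "('k, 'm) space" +
  lact :: "'a \<Rightarrow> 'm \<Rightarrow> 'm"  (infixr \<open>\<rhd>\<index>\<close> 68)
  ract :: "'m \<Rightarrow> 'a \<Rightarrow> 'm"  (infixl \<open>\<lhd>\<index>\<close> 69)

locale bimodule = k_algebra A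
  for A :: "('k::field, 'a::ab_group_add, 'z) alg_scheme"
    and M :: "('k, 'a, 'm::ab_group_add) bimod" +
  assumes vspace_bimod: "vspace M"
    and bilin_lact: "bilin A M M (lact M)"
    and bilin_ract: "bilin M A M (ract M)"
    and lact_unt: "m \<in> carr M \<Longrightarrow> \<one>\<^bsub>A\<^esub> \<rhd>\<^bsub>M\<^esub> m = m"
    and ract_unt: "m \<in> carr M \<Longrightarrow> m \<lhd>\<^bsub>M\<^esub> \<one>\<^bsub>A\<^esub> = m"
    and lact_mul: "\<lbrakk>a \<in> carr A; b \<in> carr A; m \<in> carr M\<rbrakk> \<Longrightarrow>
      (a \<cdot>\<^bsub>A\<^esub> b) \<rhd>\<^bsub>M\<^esub> m = a \<rhd>\<^bsub>M\<^esub> (b \<rhd>\<^bsub>M\<^esub> m)"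
    and ract_mul: "\<lbrakk>a \<in> carr A; b \<in> carr A; m \<in> carr M\<rbrakk> \<Longrightarrow>
      m \<lhd>\<^bsub>M\<^esub> (a \<cdot>\<^bsub>A\<^esub> b) = (m \<lhd>\<^bsub>M\<^esub> a) \<lhd>\<^bsub>M\<^esub> b"
    and lact_ract: "\<lbrakk>a \<in> carr A; b \<in> carr A; m \<in> carr M\<rbrakk> \<Longrightarrow>
      (a \<rhd>\<^bsub>M\<^esub> m) \<lhd>\<^bsub>M\<^esub> b = a \<rhd>\<^bsub>M\<^esub> (m \<lhd>\<^bsub>M\<^esub> b)"

locale fodc = bimodule A \<Omega>
  for A :: "('k::field, 'a::ab_group_add, 'z) alg_scheme"
    and \<Omega> :: "('k, 'a, 'm::ab_group_add) bimod" +
  fixes d :: "'a \<Rightarrow> 'm"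
  assumes lin_d: "lin A \<Omega> d"
    and leibniz: "\<lbrakk>a \<in> carr A; b \<in> carr A\<rbrakk> \<Longrightarrow>
      d (a \<cdot>\<^bsub>A\<^esub> b) = (d a \<lhd>\<^bsub>\<Omega>\<^esub> b) + (a \<rhd>\<^bsub>\<Omega>\<^esub> d b)"
    and spanned: "carr \<Omega> =
      module.span (scl \<Omega>) {a \<rhd>\<^bsub>\<Omega>\<^esub> d b | a b. a \<in> carr A \<and> b \<in> carr A}"

locale right_covariant_fodc =
  right_comodule_algebra H A \<rho> + fodc A \<Omega> d + \<Omega>: right_comodule H \<Omega> \<rho>\<Omega>
  for H :: "('k::field, 'h::ab_group_add) hopf"
    and A :: "('k, 'a::ab_group_add, 'z) alg_scheme"
    and \<rho> :: "'a \<Rightarrow> ('k, 'a, 'h) tensor"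
    and \<Omega> :: "('k, 'a, 'm::ab_group_add) bimod"
    and d :: "'a \<Rightarrow> 'm"
    and \<rho>\<Omega> :: "'m \<Rightarrow> ('k, 'm, 'h) tensor" +
  assumes coaction_compatible: "\<lbrakk>a \<in> carr A; \<omega> \<in> carr \<Omega>; a' \<in> carr A\<rbrakk> \<Longrightarrow>
      \<rho>\<Omega> ((a \<rhd>\<^bsub>\<Omega>\<^esub> \<omega>) \<lhd>\<^bsub>\<Omega>\<^esub> a') =
      tlift A H (\<lambda>a0 a1. tlift \<Omega> H (\<lambda>\<omega>0 \<omega>1. tlift A H (\<lambda>a0' a1'.
        tens \<Omega> H ((a0 \<rhd>\<^bsub>\<Omega>\<^esub> \<omega>0) \<lhd>\<^bsub>\<Omega>\<^esub> a0') ((a1 \<cdot>\<^bsub>H\<^esub> \<omega>1) \<cdot>\<^bsub>H\<^esub> a1'))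
        (\<rho> a')) (\<rho>\<Omega> \<omega>)) (\<rho> a)"
    and d_colinear: "a \<in> carr A \<Longrightarrow>
      \<rho>\<Omega> (d a) = tlift A H (\<lambda>a0 a1. tens \<Omega> H (d a0) a1) (\<rho> a)"

locale bicovariant_fodc =
  hopf_algebra H + right_covariant_fodc H H "comul H" \<Omega> d \<rho> + \<Omega>: bicomodule H \<Omega> \<delta> \<rho>
  for H :: "('k::field, 'h::ab_group_add) hopf"
    and \<Omega> :: "('k, 'h, 'm::ab_group_add) bimod"
    and d :: "'h \<Rightarrow> 'm"
    and \<delta> :: "'m \<Rightarrow> ('k, 'h, 'm) tensor"
    and \<rho> :: "'m \<Rightarrow> ('k, 'm, 'h) tensor" +
  assumes left_coaction_compatible: "\<lbrakk>h \<in> carr H; \<omega> \<in> carr \<Omega>; h' \<in> carr H\<rbrakk> \<Longrightarrow>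
      \<delta> ((h \<rhd>\<^bsub>\<Omega>\<^esub> \<omega>) \<lhd>\<^bsub>\<Omega>\<^esub> h') =
      sw2 H (\<lambda>h1 h2. tlift H \<Omega> (\<lambda>\<omega>1 \<omega>0. sw2 H (\<lambda>h1' h2'.
        tens H \<Omega> ((h1 \<cdot>\<^bsub>H\<^esub> \<omega>1) \<cdot>\<^bsub>H\<^esub> h1') ((h2 \<rhd>\<^bsub>\<Omega>\<^esub> \<omega>0) \<lhd>\<^bsub>\<Omega>\<^esub> h2'))
        h') (\<delta> \<omega>)) h"
    and d_left_colinear: "h \<in> carr H \<Longrightarrow>
      \<delta> (d h) = sw2 H (\<lambda>h1 h2. tens H \<Omega> h1 (d h2)) h"

text \<open>Differentiability of an algebra map; the bimodule map is required for the actions of \<open>A\<close> on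
  \<open>\<Omega>'\<close> through \<open>f\<close>.\<close>

definition differentiable ::
  "('k::field, 'a::ab_group_add, 'y) alg_scheme \<Rightarrow> ('k, 'a, 'm::ab_group_add) bimod \<Rightarrow>
   ('a \<Rightarrow> 'm) \<Rightarrow>
   ('k, 'c::ab_group_add, 'z) alg_scheme \<Rightarrow> ('k, 'c, 'n::ab_group_add) bimod \<Rightarrow> ('c \<Rightarrow> 'n) \<Rightarrow>
   ('a \<Rightarrow> 'c) \<Rightarrow> bool" where
  "differentiable A \<Omega> d A' \<Omega>' d' f \<longleftrightarrow> alg_hom A A' f \<and>
     (\<exists>F. lin \<Omega> \<Omega>' F \<and>
        (\<forall>a\<in>carr A. \<forall>\<omega>\<in>carr \<Omega>. F (a \<rhd>\<^bsub>\<Omega>\<^esub> \<omega>) = f a \<rhd>\<^bsub>\<Omega>'\<^esub> F \<omega>) \<and>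
        (\<forall>a\<in>carr A. \<forall>\<omega>\<in>carr \<Omega>. F (\<omega> \<lhd>\<^bsub>\<Omega>\<^esub> a) = F \<omega> \<lhd>\<^bsub>\<Omega>'\<^esub> f a) \<and>
        (\<forall>a\<in>carr A. F (d a) = d' (f a)))"

definition tensor_forms ::
  "('k::field, 'a::ab_group_add, 'y) alg_scheme \<Rightarrow> ('k, 'a, 'm::ab_group_add) bimod \<Rightarrow>
   ('k, 'c::ab_group_add, 'z) alg_scheme \<Rightarrow> ('k, 'c, 'n::ab_group_add) bimod \<Rightarrow>
   ('k, ('k, 'a, 'c) tensor, ('k, 'm, 'c) tensor \<times> ('k, 'a, 'n) tensor) bimod" where
  "tensor_forms A \<Omega> A' \<Omega>' =
     \<lparr>carr = carr (direct_sum (tensor_space \<Omega> A') (tensor_space A \<Omega>')),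
      scl = scl (direct_sum (tensor_space \<Omega> A') (tensor_space A \<Omega>')),
      lact = (\<lambda>X (P, Q).
        (tlift A A' (\<lambda>a a'. tlift \<Omega> A' (\<lambda>\<omega> c'.
           tens \<Omega> A' (a \<rhd>\<^bsub>\<Omega>\<^esub> \<omega>) (a' \<cdot>\<^bsub>A'\<^esub> c')) P) X,
         tlift A A' (\<lambda>a a'. tlift A \<Omega>' (\<lambda>c \<omega>'.
           tens A \<Omega>' (a \<cdot>\<^bsub>A\<^esub> c) (a' \<rhd>\<^bsub>\<Omega>'\<^esub> \<omega>')) Q) X)),
      ract = (\<lambda>(P, Q) X.
        (tlift \<Omega> A' (\<lambda>\<omega> c'. tlift A A' (\<lambda>a a'.
           tens \<Omega> A' (\<omega> \<lhd>\<^bsub>\<Omega>\<^esub> a) (c' \<cdot>\<^bsub>A'\<^esub> a')) X) P,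
         tlift A \<Omega>' (\<lambda>c \<omega>'. tlift A A' (\<lambda>a a'.
           tens A \<Omega>' (c \<cdot>\<^bsub>A\<^esub> a) (\<omega>' \<lhd>\<^bsub>\<Omega>'\<^esub> a')) X) Q))\<rparr>"

definition tensor_d ::
  "('k::field, 'a::ab_group_add, 'y) alg_scheme \<Rightarrow> ('k, 'a, 'm::ab_group_add) bimod \<Rightarrow>
   ('a \<Rightarrow> 'm) \<Rightarrow>
   ('k, 'c::ab_group_add, 'z) alg_scheme \<Rightarrow> ('k, 'c, 'n::ab_group_add) bimod \<Rightarrow> ('c \<Rightarrow> 'n) \<Rightarrow>
   ('k, 'a, 'c) tensor \<Rightarrow> ('k, 'm, 'c) tensor \<times> ('k, 'a, 'n) tensor" where
  "tensor_d A \<Omega> d A' \<Omega>' d' X =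
     (tlift A A' (\<lambda>a a'. tens \<Omega> A' (d a) a') X,
      tlift A A' (\<lambda>a a'. tens A \<Omega>' a (d' a')) X)"


section \<open>Twisted module algebras and crossed products\<close>

locale twisted_module_algebra =
  H: hopf_algebra H + B: k_algebra B
  for H :: "('k::field, 'h::ab_group_add) hopf"
    and B :: "('k, 'b::ab_group_add) alg" +
  fixes act :: "'h \<Rightarrow> 'b \<Rightarrow> 'b"
    and \<sigma> :: "'h \<Rightarrow> 'h \<Rightarrow> 'b"
    and \<sigma>inv :: "'h \<Rightarrow> 'h \<Rightarrow> 'b"
  assumes bilin_act: "bilin H B B act"
    and act_unt: "h \<in> carr H \<Longrightarrow> act h \<one>\<^bsub>B\<^esub> = scl B (counit H h) \<one>\<^bsub>B\<^esub>"
    and act_mul: "\<lbrakk>h \<in> carr H; b \<in> carr B; b' \<in> carr B\<rbrakk> \<Longrightarrow>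
      act h (b \<cdot>\<^bsub>B\<^esub> b') = sw2 H (\<lambda>h1 h2. act h1 b \<cdot>\<^bsub>B\<^esub> act h2 b') h"
    and bilin_\<sigma>: "bilin H H B \<sigma>"
    and bilin_\<sigma>inv: "bilin H H B \<sigma>inv"
    and \<sigma>_\<sigma>inv: "\<lbrakk>h \<in> carr H; h' \<in> carr H\<rbrakk> \<Longrightarrow>
      sw2 H (\<lambda>h1 h2. sw2 H (\<lambda>h1' h2'. \<sigma> h1 h1' \<cdot>\<^bsub>B\<^esub> \<sigma>inv h2 h2') h') h =
      scl B (counit H h * counit H h') \<one>\<^bsub>B\<^esub>"
    and \<sigma>inv_\<sigma>: "\<lbrakk>h \<in> carr H; h' \<in> carr H\<rbrakk> \<Longrightarrow>
      sw2 H (\<lambda>h1 h2. sw2 H (\<lambda>h1' h2'. \<sigma>inv h1 h1' \<cdot>\<^bsub>B\<^esub> \<sigma> h2 h2') h') h =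
      scl B (counit H h * counit H h') \<one>\<^bsub>B\<^esub>"
    and unt_act: "b \<in> carr B \<Longrightarrow> act \<one>\<^bsub>H\<^esub> b = b"
    and act_act: "\<lbrakk>h \<in> carr H; h' \<in> carr H; b \<in> carr B\<rbrakk> \<Longrightarrow>
      act h (act h' b) = sw3 H (\<lambda>h1 h2 h3. sw3 H (\<lambda>h1' h2' h3'.
        \<sigma> h1 h1' \<cdot>\<^bsub>B\<^esub> act (h2 \<cdot>\<^bsub>H\<^esub> h2') b \<cdot>\<^bsub>B\<^esub> \<sigma>inv h3 h3') h') h"
    and \<sigma>_unt_right: "h \<in> carr H \<Longrightarrow> \<sigma> h \<one>\<^bsub>H\<^esub> = scl B (counit H h) \<one>\<^bsub>B\<^esub>"
    and \<sigma>_unt_left: "h \<in> carr H \<Longrightarrow> \<sigma> \<one>\<^bsub>H\<^esub> h = scl B (counit H h) \<one>\<^bsub>B\<^esub>"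
    and \<sigma>_cocycle: "\<lbrakk>h \<in> carr H; h' \<in> carr H; h'' \<in> carr H\<rbrakk> \<Longrightarrow>
      sw2 H (\<lambda>h1 h2. sw2 H (\<lambda>h1' h2'. sw2 H (\<lambda>h1'' h2''.
        act h1 (\<sigma> h1' h1'') \<cdot>\<^bsub>B\<^esub> \<sigma> h2 (h2' \<cdot>\<^bsub>H\<^esub> h2'')) h'') h') h =
      sw2 H (\<lambda>h1 h2. sw2 H (\<lambda>h1' h2'.
        \<sigma> h1 h1' \<cdot>\<^bsub>B\<^esub> \<sigma> (h2 \<cdot>\<^bsub>H\<^esub> h2') h'') h') h"

locale twisted_module_fodc =
  twisted_module_algebra H B act \<sigma> \<sigma>inv + \<Omega>: fodc B \<Omega> d
  for H :: "('k::field, 'h::ab_group_add) hopf"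
    and B :: "('k, 'b::ab_group_add) alg"
    and act \<sigma> \<sigma>inv
    and \<Omega> :: "('k, 'b, 'm::ab_group_add) bimod"
    and d :: "'b \<Rightarrow> 'm" +
  fixes act\<Omega> :: "'h \<Rightarrow> 'm \<Rightarrow> 'm"
  assumes bilin_act\<Omega>: "bilin H \<Omega> \<Omega> act\<Omega>"
    and act\<Omega>_lact_d: "\<lbrakk>h \<in> carr H; b \<in> carr B; b' \<in> carr B\<rbrakk> \<Longrightarrow>
      act\<Omega> h (b \<rhd>\<^bsub>\<Omega>\<^esub> d b') = sw2 H (\<lambda>h1 h2. act h1 b \<rhd>\<^bsub>\<Omega>\<^esub> act\<Omega> h2 (d b')) h"
    and d_act: "\<lbrakk>h \<in> carr H; b \<in> carr B\<rbrakk> \<Longrightarrow> d (act h b) = act\<Omega> h (d b)"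
    and d_\<sigma>: "\<lbrakk>h \<in> carr H; h' \<in> carr H\<rbrakk> \<Longrightarrow> d (\<sigma> h h') = 0"

definition crossed_product ::
  "('k::field, 'h::ab_group_add) hopf \<Rightarrow> ('k, 'b::ab_group_add) alg \<Rightarrow>
   ('h \<Rightarrow> 'b \<Rightarrow> 'b) \<Rightarrow> ('h \<Rightarrow> 'h \<Rightarrow> 'b) \<Rightarrow> ('k, ('k, 'b, 'h) tensor) alg" where
  "crossed_product H B act \<sigma> =
     \<lparr>carr = carr (tensor_space B H), scl = scl (tensor_space B H),
      mul = (\<lambda>X Y. tlift B H (\<lambda>b h. tlift B H (\<lambda>b' h'.
        sw3 H (\<lambda>h1 h2 h3. sw2 H (\<lambda>h1' h2'.
          tens B H (b \<cdot>\<^bsub>B\<^esub> act h1 b' \<cdot>\<^bsub>B\<^esub> \<sigma> h2 h1') (h3 \<cdot>\<^bsub>H\<^esub> h2')) h') h) Y) X),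
      unt = tens B H \<one>\<^bsub>B\<^esub> \<one>\<^bsub>H\<^esub>\<rparr>"

definition crossed_coaction ::
  "('k::field, 'h::ab_group_add) hopf \<Rightarrow> ('k, 'b::ab_group_add) alg \<Rightarrow>
   ('h \<Rightarrow> 'b \<Rightarrow> 'b) \<Rightarrow> ('h \<Rightarrow> 'h \<Rightarrow> 'b) \<Rightarrow>
   ('k, 'b, 'h) tensor \<Rightarrow> ('k, ('k, 'b, 'h) tensor, 'h) tensor" where
  "crossed_coaction H B act \<sigma> X =
     tlift B H (\<lambda>b h. sw2 H (\<lambda>h1 h2. tens (crossed_product H B act \<sigma>) H (tens B H b h1) h2) h) X"

text \<open>In \<open>crossed_forms\<close> a pair \<open>(P, Q)\<close> stands for \<open>\<beta> \<otimes> h + b \<otimes> \<gamma>\<close> with \<open>P = \<beta> \<otimes> h\<close> and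
  \<open>Q = b \<otimes> \<gamma>\<close>; \<open>\<delta>\<close> is the left coaction on \<open>\<Omega>\<^sup>1(H)\<close>.  In the right action
  \<open>\<gamma>\<^sub>-\<^sub>2 \<otimes> \<gamma>\<^sub>-\<^sub>1 \<otimes> \<gamma>\<^sub>0 = (\<Delta> \<otimes> Id)(\<delta> \<gamma>)\<close>, written \<open>g2\<close>, \<open>g1\<close>, \<open>\<gamma>0\<close>.\<close>

definition crossed_forms ::
  "('k::field, 'h::ab_group_add) hopf \<Rightarrow> ('k, 'b::ab_group_add) alg \<Rightarrow>
   ('h \<Rightarrow> 'b \<Rightarrow> 'b) \<Rightarrow> ('h \<Rightarrow> 'h \<Rightarrow> 'b) \<Rightarrow>
   ('k, 'b, 'm::ab_group_add) bimod \<Rightarrow> ('h \<Rightarrow> 'm \<Rightarrow> 'm) \<Rightarrow>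
   ('k, 'h, 'n::ab_group_add) bimod \<Rightarrow> ('n \<Rightarrow> ('k, 'h, 'n) tensor) \<Rightarrow>
   ('k, ('k, 'b, 'h) tensor, ('k, 'm, 'h) tensor \<times> ('k, 'b, 'n) tensor) bimod" where
  "crossed_forms H B act \<sigma> \<Omega>B act\<Omega> \<Omega>H \<delta> =
     \<lparr>carr = carr (direct_sum (tensor_space \<Omega>B H) (tensor_space B \<Omega>H)),
      scl = scl (direct_sum (tensor_space \<Omega>B H) (tensor_space B \<Omega>H)),
      lact = (\<lambda>X (P, Q).
        (tlift B H (\<lambda>b' h'. tlift \<Omega>B H (\<lambda>\<beta> h.
           sw3 H (\<lambda>h1' h2' h3'. sw2 H (\<lambda>h1 h2.
             tens \<Omega>B H ((b' \<rhd>\<^bsub>\<Omega>B\<^esub> act\<Omega> h1' \<beta>) \<lhd>\<^bsub>\<Omega>B\<^esub> \<sigma> h2' h1) (h3' \<cdot>\<^bsub>H\<^esub> h2)) h) h') P) X,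
         tlift B H (\<lambda>b' h'. tlift B \<Omega>H (\<lambda>b \<gamma>.
           sw3 H (\<lambda>h1' h2' h3'. tlift H \<Omega>H (\<lambda>g1 \<gamma>0.
             tens B \<Omega>H (b' \<cdot>\<^bsub>B\<^esub> act h1' b \<cdot>\<^bsub>B\<^esub> \<sigma> h2' g1) (h3' \<rhd>\<^bsub>\<Omega>H\<^esub> \<gamma>0)) (\<delta> \<gamma>)) h') Q) X)),
      ract = (\<lambda>(P, Q) X.
        (tlift \<Omega>B H (\<lambda>\<beta> h. tlift B H (\<lambda>b' h'.
           sw3 H (\<lambda>h1 h2 h3. sw2 H (\<lambda>h1' h2'.
             tens \<Omega>B H (\<beta> \<lhd>\<^bsub>\<Omega>B\<^esub> act h1 b' \<lhd>\<^bsub>\<Omega>B\<^esub> \<sigma> h2 h1') (h3 \<cdot>\<^bsub>H\<^esub> h2')) h') h) X) P,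
         tlift B \<Omega>H (\<lambda>b \<gamma>. tlift B H (\<lambda>b' h'.
           tlift H \<Omega>H (\<lambda>g \<gamma>0. sw2 H (\<lambda>g2 g1. sw2 H (\<lambda>h1' h2'.
             tens B \<Omega>H (b \<cdot>\<^bsub>B\<^esub> act g2 b' \<cdot>\<^bsub>B\<^esub> \<sigma> g1 h1') (\<gamma>0 \<lhd>\<^bsub>\<Omega>H\<^esub> h2')) h') g) (\<delta> \<gamma>)) X) Q))\<rparr>"

definition crossed_forms_coaction ::
  "('k::field, 'h::ab_group_add) hopf \<Rightarrow> ('k, 'b::ab_group_add) alg \<Rightarrow>
   ('h \<Rightarrow> 'b \<Rightarrow> 'b) \<Rightarrow> ('h \<Rightarrow> 'h \<Rightarrow> 'b) \<Rightarrow>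
   ('k, 'b, 'm::ab_group_add) bimod \<Rightarrow> ('h \<Rightarrow> 'm \<Rightarrow> 'm) \<Rightarrow>
   ('k, 'h, 'n::ab_group_add) bimod \<Rightarrow> ('n \<Rightarrow> ('k, 'h, 'n) tensor) \<Rightarrow>
   ('n \<Rightarrow> ('k, 'n, 'h) tensor) \<Rightarrow>
   ('k, 'm, 'h) tensor \<times> ('k, 'b, 'n) tensor \<Rightarrow>
   ('k, ('k, 'm, 'h) tensor \<times> ('k, 'b, 'n) tensor, 'h) tensor" where
  "crossed_forms_coaction H B act \<sigma> \<Omega>B act\<Omega> \<Omega>H \<delta> \<rho>H =
     (let \<Omega> = crossed_forms H B act \<sigma> \<Omega>B act\<Omega> \<Omega>H \<delta> in
      (\<lambda>(P, Q).
        tlift \<Omega>B H (\<lambda>\<beta> h. sw2 H (\<lambda>h1 h2. tens \<Omega> H (tens \<Omega>B H \<beta> h1, 0) h2) h) P +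
        tlift B \<Omega>H (\<lambda>b \<gamma>. tlift \<Omega>H H (\<lambda>\<gamma>0 \<gamma>1. tens \<Omega> H (0, tens B \<Omega>H b \<gamma>0) \<gamma>1) (\<rho>H \<gamma>)) Q))"

definition crossed_d ::
  "('k::field, 'h::ab_group_add) hopf \<Rightarrow> ('k, 'b::ab_group_add) alg \<Rightarrow>
   ('k, 'b, 'm::ab_group_add) bimod \<Rightarrow> ('b \<Rightarrow> 'm) \<Rightarrow>
   ('k, 'h, 'n::ab_group_add) bimod \<Rightarrow> ('h \<Rightarrow> 'n) \<Rightarrow>
   ('k, 'b, 'h) tensor \<Rightarrow> ('k, 'm, 'h) tensor \<times> ('k, 'b, 'n) tensor" where
  "crossed_d H B \<Omega>B dB \<Omega>H dH X =
     (tlift B H (\<lambda>b h. tens \<Omega>B H (dB b) h) X, tlift B H (\<lambda>b h. tens B \<Omega>H b (dH h)) X)"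

end

theory Submission
  imports Defs
begin

text \<open>Every product in the statement has one shape.  Let \<open>N\<close>, \<open>N'\<close>, \<open>N''\<close> be left \<open>H\<close>-comodules
  with a colinear pairing \<open>N \<otimes> N' \<rightarrow> N''\<close>, and let \<open>c(m, m'; g, h)\<close> be a map that is linear in
  two coefficients \<open>m\<close>, \<open>m'\<close> and in \<open>g, h \<in> H\<close>.  Then
  \<open>(m \<otimes> n) \<star> (m' \<otimes> n') = c(m, m'; n\<^sub>-\<^sub>1, n'\<^sub>-\<^sub>1) \<otimes> n\<^sub>0 n'\<^sub>0\<close>
  is a \<^emph>\<open>twisted product\<close>.  With \<open>c(m, m'; g, h) = m (g\<^sub>1 \<cdot> m') \<sigma>(g\<^sub>2 \<otimes> h)\<close>, coefficients in \<open>B\<close>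
  or \<open>\<Omega>\<^sup>1(B)\<close> and comodules \<open>H\<close> or \<open>\<Omega>\<^sup>1(H)\<close>, it is the product of the crossed product and, component
  by component, its left and right action on the forms.  All module axioms are therefore cases of
  three facts on twisted products: \<open>twisted_prod_assoc\<close> and the two unit laws.

  Associativity reduces, by coassociativity and colinearity of the pairings, to an identity between
  the coefficients alone.  For coefficients in an algebra \<open>E\<close> on which \<open>H\<close> acts this is \<open>coeff_assoc\<close>;
  it holds because \<open>h \<cdot> (xy) = (h\<^sub>1 \<cdot> x)(h\<^sub>2 \<cdot> y)\<close>, because \<open>\<sigma>\<close> is a cocycle, and because
  \<open>(g\<^sub>1 \<cdot> (h\<^sub>1 \<cdot> x)) \<sigma>(g\<^sub>2 \<otimes> h\<^sub>2) = \<sigma>(g\<^sub>1 \<otimes> h\<^sub>1) (g\<^sub>2h\<^sub>2 \<cdot> x)\<close>.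
  To treat functions and forms at once, \<open>E\<close> is taken to be the square-zero extension
  \<open>B \<oplus> \<Omega>\<^sup>1(B)\<close>.  The last identity holds on \<open>B\<close> by the definition of a twisted module algebra, hence on
  exact forms by applying \<open>d\<close>, since \<open>d \<circ> \<sigma> = 0\<close>; the elements of \<open>E\<close> that satisfy it are closed under
  products (\<open>twisted_mul\<close>), so it holds on all forms (\<open>ext_twisted\<close>).

  The Leibniz rule holds separately in the two summands: in the first because \<open>d\<close> commutes with the
  action and kills \<open>\<sigma>\<close>, in the second because \<open>d\<close> is left colinear and a derivation of \<open>H\<close>.  The calculus
  is spanned by the forms \<open>X dY\<close> because \<open>\<sigma>\<close> has a convolution inverse, by which the cocycle in
  \<open>(b \<otimes> h) d(1 \<otimes> h')\<close> can be cancelled (\<open>untwist\<close>).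

  Covariance and differentiability are multiplicativity statements for maps
  \<open>m \<otimes> n \<mapsto> (m \<otimes> l) \<otimes> k\<close>, where \<open>s(n) = l \<otimes> k\<close> is a left colinear map that respects the pairings
  (\<open>split_map_twisted_prod\<close>).  For \<open>s\<close> the comultiplication or the right coaction on \<open>\<Omega>\<^sup>1(H)\<close> this gives
  the right coactions.  For \<open>s\<close> the left coaction \<open>\<delta>\<close> on \<open>\<Omega>\<^sup>1(H)\<close> it gives the second component of the map
  \<open>\<beta> \<otimes> h + b \<otimes> \<gamma> \<mapsto> ((\<beta> \<otimes> h\<^sub>1) \<otimes> h\<^sub>2 + (b \<otimes> \<gamma>\<^sub>0) \<otimes> \<gamma>\<^sub>1, (b \<otimes> \<gamma>\<^sub>-\<^sub>1) \<otimes> \<gamma>\<^sub>0)\<close>,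
  which makes the coaction of the crossed product differentiable.\<close>

section \<open>Sweedler sums and multilinear maps\<close>

text \<open>An identity in Sweedler notation is proved by evaluating tensors on multilinear expressions.  The
  rules \<open>mlin\<close> decide membership in carriers and linearity in one variable by recursion on the
  expression.\<close>

named_theorems mlin "membership and linearity of multilinear expressions"

text \<open>The sum over this list that defines \<^const>\<open>tlift\<close> is the same for every integrand.  Sweedler
  sums can therefore be interchanged and split additively without any bilinearity.\<close>

definition tensor_rep ::
  "('k::field, 'v::ab_group_add, 'y) space_scheme \<Rightarrow> ('k, 'w::ab_group_add, 'z) space_scheme \<Rightarrow>
   ('k, 'v, 'w) tensor \<Rightarrow> ('v \<times> 'w) list" where
  "tensor_rep V W X =
     (SOME xs. set xs \<subseteq> carr V \<times> carr W \<and> X = (\<Sum>(v, w)\<leftarrow>xs. tens V W v w))"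

lemma tlift_eq_sum: "tlift V W f X = (\<Sum>(v, w)\<leftarrow>tensor_rep V W X. f v w)"
  by (simp add: tlift_def tensor_rep_def)

lemma tensor_rep:
  assumes "X \<in> carr (tensor_space V W)"
  shows "set (tensor_rep V W X) \<subseteq> carr V \<times> carr W"
    and "X = (\<Sum>(v, w)\<leftarrow>tensor_rep V W X. tens V W v w)"
proof -
  from assms have "\<exists>xs. set xs \<subseteq> carr V \<times> carr W \<and> X = (\<Sum>(v, w)\<leftarrow>xs. tens V W v w)"
    by (auto simp: tensor_space_def)
  from someI_ex[OF this] show "set (tensor_rep V W X) \<subseteq> carr V \<times> carr W"
    and "X = (\<Sum>(v, w)\<leftarrow>tensor_rep V W X. tens V W v w)"
    by (auto simp: tensor_rep_def)
qed

lemma tlift_cong: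
  assumes "X = Y" "Y \<in> carr (tensor_space V W)"
    and "\<And>v w. v \<in> carr V \<Longrightarrow> w \<in> carr W \<Longrightarrow> f v w = g v w"
  shows "tlift V W f X = tlift V W g Y"
  unfolding tlift_eq_sum assms(1)
  using tensor_rep(1)[OF assms(2)] assms(3)
  by (intro arg_cong[of _ _ sum_list] map_cong) auto

lemma tlift_swap:
  "tlift V W (\<lambda>v w. tlift V' W' (\<lambda>v' w'. f v w v' w') Y) X =
   tlift V' W' (\<lambda>v' w'. tlift V W (\<lambda>v w. f v w v' w') X) Y"
proof -
  have "(\<Sum>x\<leftarrow>xs. \<Sum>y\<leftarrow>ys. h x y) = (\<Sum>y\<leftarrow>ys. \<Sum>x\<leftarrow>xs. h x y)"
    for xs :: "'x list" and ys :: "'y list" and h :: "'x \<Rightarrow> 'y \<Rightarrow> 'z::ab_group_add"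
    by (induction xs) (simp_all add: sum_list_addf)
  from this[of "\<lambda>x y. f (fst x) (snd x) (fst y) (snd y)"] show ?thesis
    by (simp add: tlift_eq_sum case_prod_unfold)
qed

lemma tlift_add: "tlift V W (\<lambda>v w. f v w + g v w) X = tlift V W f X + tlift V W g X"
  by (simp add: tlift_eq_sum case_prod_unfold sum_list_addf)

lemma tlift_zero: "tlift V W (\<lambda>v w. 0) X = 0"
  by (simp add: tlift_eq_sum case_prod_unfold)

lemma tlift_Pair: "tlift V W (\<lambda>v w. (f v w, g v w)) X = (tlift V W f X, tlift V W g X)"
proof -
  have "(\<Sum>x\<leftarrow>xs. (a x, b x)) = (\<Sum>x\<leftarrow>xs. a x, \<Sum>x\<leftarrow>xs. b x)"
    for xs :: "'x list" and a :: "'x \<Rightarrow> 'y::ab_group_add" and b :: "'x \<Rightarrow> 'z::ab_group_add"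
    by (induction xs) (simp_all add: zero_prod_def)
  from this[of "\<lambda>x. f (fst x) (snd x)" "\<lambda>x. g (fst x) (snd x)"] show ?thesis
    by (simp add: tlift_eq_sum case_prod_unfold)
qed

lemma lin_0:
  assumes "vspace V" "lin V W f" shows "f 0 = 0"
proof -
  have "f (0 + 0) = f 0 + f 0" using assms vspace_mem(1) unfolding lin_def by blast
  then show ?thesis by simp
qed

lemma lin_add_apply: "lin V W f \<Longrightarrow> x \<in> carr V \<Longrightarrow> y \<in> carr V \<Longrightarrow> f (x + y) = f x + f y"
  by (simp add: lin_def)

lemma lin_scl_apply: "lin V W f \<Longrightarrow> x \<in> carr V \<Longrightarrow> f (scl V c x) = scl W c (f x)"
  by (simp add: lin_def)

text \<open>Applied to a subspace of the target, this shows that a Sweedler sum of its members lies in it.\<close>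

lemma tlift_mem [mlin]:
  assumes "vspace U" "X \<in> carr (tensor_space V W)"
    and "\<And>v w. v \<in> carr V \<Longrightarrow> w \<in> carr W \<Longrightarrow> f v w \<in> carr U"
  shows "tlift V W f X \<in> carr U"
proof -
  have "set xs \<subseteq> carr V \<times> carr W \<Longrightarrow> (\<Sum>(v, w)\<leftarrow>xs. f v w) \<in> carr U" for xs
    using assms(3) by (induction xs) (auto simp: vspace_mem[OF assms(1)])
  with tensor_rep(1)[OF assms(2)] show ?thesis by (simp add: tlift_eq_sum)
qed

lemma lin_tlift_apply:
  assumes g: "lin U U' g" and U: "vspace U" and X: "X \<in> carr (tensor_space V W)"
    and f: "\<And>v w. v \<in> carr V \<Longrightarrow> w \<in> carr W \<Longrightarrow> f v w \<in> carr U"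
  shows "g (tlift V W f X) = tlift V W (\<lambda>v w. g (f v w)) X"
proof -
  have "(\<Sum>(v, w)\<leftarrow>xs. f v w) \<in> carr U \<and> g (\<Sum>(v, w)\<leftarrow>xs. f v w) = (\<Sum>(v, w)\<leftarrow>xs. g (f v w))"
    if "set xs \<subseteq> carr V \<times> carr W" for xs
    using that f
    by (induction xs) (auto simp: vspace_mem[OF U] lin_0[OF U g] lin_add_apply[OF g])
  with tensor_rep(1)[OF X] show ?thesis by (simp add: tlift_eq_sum)
qed

lemma vspace_scl:
  assumes "vspace U"
  shows "scl U c (x + y) = scl U c x + scl U c y" "scl U (a + b) x = scl U a x + scl U b x"
    "scl U a (scl U b x) = scl U (a * b) x" "scl U 1 x = x" "scl U c 0 = 0" "scl U 0 x = 0"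
proof -
  interpret vector_space "scl U" using assms by (simp add: vspace_def)
  show "scl U c (x + y) = scl U c x + scl U c y" "scl U (a + b) x = scl U a x + scl U b x"
    "scl U a (scl U b x) = scl U (a * b) x" "scl U 1 x = x" "scl U c 0 = 0" "scl U 0 x = 0"
    by (simp_all add: scale_right_distrib scale_left_distrib)
qed

lemma vspaceI:
  assumes "vector_space (scl V)" "0 \<in> carr V"
    and "\<And>x y. x \<in> carr V \<Longrightarrow> y \<in> carr V \<Longrightarrow> x + y \<in> carr V"
    and "\<And>c x. x \<in> carr V \<Longrightarrow> scl V c x \<in> carr V"
  shows "vspace V"
proof -
  interpret vector_space "scl V" by fact
  show ?thesis using assms by (auto simp: vspace_def subspace_def)
qed

lemma scl_tens:
  "v \<in> carr V \<Longrightarrow> w \<in> carr W \<Longrightarrow>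
   scl (tensor_space V W) c (tens V W v w) = tens V W (scl V c v) w"
  using bilin_tens[of V W] by (simp add: bilin_def lin_def)

lemma vspace_tensor [mlin]:
  assumes V: "vspace V"
  shows "vspace (tensor_space V W)"
proof (rule vspaceI)
  show "vector_space (scl (tensor_space V W))"
    by unfold_locales (auto simp: tensor_space_def fun_eq_iff algebra_simps)
  have "(\<Sum>(v, w)\<leftarrow>[]. tens V W v w) \<in> carr (tensor_space V W)"
    unfolding tensor_space_def by (auto intro!: exI[of _ "[]"])
  then show zero: "0 \<in> carr (tensor_space V W)" by simp
  show add: "x + y \<in> carr (tensor_space V W)"
    if "x \<in> carr (tensor_space V W)" "y \<in> carr (tensor_space V W)" for x y
  proof -
    from that obtain xs ys where "set xs \<subseteq> carr V \<times> carr W" "x = (\<Sum>(v, w)\<leftarrow>xs. tens V W v w)"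
      "set ys \<subseteq> carr V \<times> carr W" "y = (\<Sum>(v, w)\<leftarrow>ys. tens V W v w)"
      by (auto simp: tensor_space_def)
    then show ?thesis
      by (auto simp: tensor_space_def intro!: exI[of _ "xs @ ys"])
  qed
  have dist: "scl (tensor_space V W) c (x + y) =
      scl (tensor_space V W) c x + scl (tensor_space V W) c y" for c x y
    by (simp add: tensor_space_def fun_eq_iff algebra_simps)
  have null: "scl (tensor_space V W) c 0 = 0" for c
    by (simp add: tensor_space_def fun_eq_iff)
  have "scl (tensor_space V W) c (\<Sum>(v, w)\<leftarrow>xs. tens V W v w) \<in> carr (tensor_space V W)"
    if "set xs \<subseteq> carr V \<times> carr W" for xs c
    using that
    by (induction xs)
      (auto simp: null zero dist scl_tens vspace_mem[OF V] intro!: add tens_mem)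
  then show "scl (tensor_space V W) c x \<in> carr (tensor_space V W)"
    if "x \<in> carr (tensor_space V W)" for c x
    using tensor_rep[OF that] by metis
qed

lemma vspace_direct_sum [mlin]:
  assumes V: "vspace V" and W: "vspace W"
  shows "vspace (direct_sum V W)"
proof (rule vspaceI)
  show "vector_space (scl (direct_sum V W))"
    by unfold_locales (auto simp: direct_sum_def vspace_scl[OF V] vspace_scl[OF W])
qed (auto simp: direct_sum_def vspace_mem[OF V] vspace_mem[OF W] zero_prod_def)

lemma vspace_ground [mlin]: "vspace ground"
  by (rule vspaceI, unfold_locales) (auto simp: ground_def algebra_simps)

lemma ground_mem [mlin]: "c \<in> carr ground"
  by (simp add: ground_def)

lemma tensor_eq_tlift:
  "X \<in> carr (tensor_space V W) \<Longrightarrow> X = tlift V W (tens V W) X"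
  using tensor_rep(2) by (simp add: tlift_eq_sum)

text \<open>Pure tensors span, so identities between multilinear expressions need only be checked on them.\<close>

lemma tensor_lin_eqI:
  assumes V: "vspace V" and f: "lin (tensor_space V W) U f" and g: "lin (tensor_space V W) U g"
    and eq: "\<And>v w. v \<in> carr V \<Longrightarrow> w \<in> carr W \<Longrightarrow> f (tens V W v w) = g (tens V W v w)"
    and X: "X \<in> carr (tensor_space V W)"
  shows "f X = g X"
proof -
  have T: "h X = tlift V W (\<lambda>v w. h (tens V W v w)) X" if "lin (tensor_space V W) U h" for h
    using lin_tlift_apply[OF that vspace_tensor[OF V] X, of "tens V W"] tens_mem[of _ V _ W]
    by (simp add: tensor_eq_tlift[OF X, symmetric])
  have "f X = tlift V W (\<lambda>v w. f (tens V W v w)) X" by (rule T[OF f])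
  also have "\<dots> = tlift V W (\<lambda>v w. g (tens V W v w)) X"
    by (rule tlift_cong[OF refl X eq])
  also have "\<dots> = g X" by (rule T[OF g, symmetric])
  finally show ?thesis .
qed

lemma linI:
  "\<lbrakk>\<And>x. x \<in> carr V \<Longrightarrow> f x \<in> carr W;
    \<And>x y. x \<in> carr V \<Longrightarrow> y \<in> carr V \<Longrightarrow> f (x + y) = f x + f y;
    \<And>c x. x \<in> carr V \<Longrightarrow> f (scl V c x) = scl W c (f x)\<rbrakk> \<Longrightarrow> lin V W f"
  by (simp add: lin_def)

lemma bilinI [mlin]:
  "\<lbrakk>\<And>v. v \<in> carr V \<Longrightarrow> lin W U (\<lambda>w. f v w); \<And>w. w \<in> carr W \<Longrightarrow> lin V U (\<lambda>v. f v w)\<rbrakk>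
   \<Longrightarrow> bilin V W U f"
  by (simp add: bilin_def)

lemma lin_ident [mlin]: "lin S S (\<lambda>x. x)"
  by (simp add: lin_def)

lemma lin_zero [mlin]: "vspace U \<Longrightarrow> lin S U (\<lambda>x. 0)"
  by (simp add: lin_def vspace_mem vspace_scl)

lemma lin_plus [mlin]:
  assumes U: "vspace U" and f: "lin S U f" and g: "lin S U g"
  shows "lin S U (\<lambda>x. f x + g x)"
  using f g by (auto simp: lin_def vspace_scl[OF U] vspace_mem[OF U] algebra_simps)

lemma lin_rules:
  assumes "lin V W f"
  shows "x \<in> carr V \<Longrightarrow> f x \<in> carr W"
    and "lin S V g \<Longrightarrow> lin S W (\<lambda>x. f (g x))"
  using assms by (auto simp: lin_def)

lemma bilin_rules:
  assumes "bilin V W U f"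
  shows "v \<in> carr V \<Longrightarrow> w \<in> carr W \<Longrightarrow> f v w \<in> carr U"
    and "lin S V g \<Longrightarrow> w \<in> carr W \<Longrightarrow> lin S U (\<lambda>x. f (g x) w)"
    and "lin S W h \<Longrightarrow> v \<in> carr V \<Longrightarrow> lin S U (\<lambda>x. f v (h x))"
  using assms by (auto simp: lin_def bilin_def)

lemmas tens_rules [mlin] = bilin_rules[OF bilin_tens]

lemma scl_rules [mlin]:
  assumes "vspace U"
  shows "x \<in> carr U \<Longrightarrow> scl U c x \<in> carr U"
    and "lin S U g \<Longrightarrow> lin S U (\<lambda>x. scl U c (g x))"
    and "lin S ground h \<Longrightarrow> x \<in> carr U \<Longrightarrow> lin S U (\<lambda>y. scl U (h y) x)"
  using assms
  by (auto simp: lin_def vspace_mem vspace_scl ground_def mult.commute)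

lemma add_mem [mlin]: "vspace U \<Longrightarrow> x \<in> carr U \<Longrightarrow> y \<in> carr U \<Longrightarrow> x + y \<in> carr U"
  and zero_mem [mlin]: "vspace U \<Longrightarrow> 0 \<in> carr U"
  by (auto intro: vspace_mem)

lemma Pair_mem [mlin]: "x \<in> carr V \<Longrightarrow> y \<in> carr W \<Longrightarrow> (x, y) \<in> carr (direct_sum V W)"
  by (simp add: direct_sum_def)

lemma lin_Pair [mlin]:
  "lin S V f \<Longrightarrow> lin S W g \<Longrightarrow> lin S (direct_sum V W) (\<lambda>x. (f x, g x))"
  by (auto simp: lin_def direct_sum_def)

lemma lin_tlift_param [mlin]:
  assumes U: "vspace U" and X: "X \<in> carr (tensor_space V W)"
    and F: "\<And>v w. v \<in> carr V \<Longrightarrow> w \<in> carr W \<Longrightarrow> lin S U (\<lambda>x. F x v w)"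
  shows "lin S U (\<lambda>x. tlift V W (\<lambda>v w. F x v w) X)"
proof (rule linI)
  show "tlift V W (F x) X \<in> carr U" if "x \<in> carr S" for x
    using F that by (intro tlift_mem U X) (auto simp: lin_def)
  show "tlift V W (F (x + y)) X = tlift V W (F x) X + tlift V W (F y) X"
    if "x \<in> carr S" "y \<in> carr S" for x y
    unfolding tlift_add[symmetric]
    by (rule tlift_cong[OF refl X]) (use F that in \<open>auto simp: lin_def\<close>)
  show "tlift V W (F (scl S c x)) X = scl U c (tlift V W (F x) X)" if "x \<in> carr S" for c x
  proof -
    have "lin U U (scl U c)" using scl_rules(2)[OF U lin_ident] .
    then have "scl U c (tlift V W (F x) X) = tlift V W (\<lambda>v w. scl U c (F x v w)) X"
      by (rule lin_tlift_apply[OF _ U X]) (use F that in \<open>auto simp: lin_def\<close>)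
    also have "\<dots> = tlift V W (F (scl S c x)) X"
      by (rule tlift_cong[OF refl X]) (use F that in \<open>auto simp: lin_def\<close>)
    finally show ?thesis ..
  qed
qed

lemma lin_tlift_arg [mlin]:
  assumes "vspace V" "vspace U" "lin S (tensor_space V W) g" "bilin V W U f"
  shows "lin S U (\<lambda>x. tlift V W f (g x))"
  using lin_rules(2)[OF lin_tlift[OF assms(1,2,4)] assms(3)] .

lemma tlift_tlift:
  assumes "vspace V" "vspace U" "bilin V W U F" "X \<in> carr (tensor_space V' W')"
    and "\<And>v w. v \<in> carr V' \<Longrightarrow> w \<in> carr W' \<Longrightarrow> f v w \<in> carr (tensor_space V W)"
  shows "tlift V W F (tlift V' W' f X) = tlift V' W' (\<lambda>v w. tlift V W F (f v w)) X"
  by (rule lin_tlift_apply[OF lin_tlift[OF assms(1-3)] vspace_tensor[OF assms(1)] assms(4,5)])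

lemma tensor_bilin_eqI:
  assumes V: "vspace V1" "vspace V2"
    and f: "bilin (tensor_space V1 W1) (tensor_space V2 W2) U f"
    and g: "bilin (tensor_space V1 W1) (tensor_space V2 W2) U g"
    and eq: "\<And>v1 w1 v2 w2. \<lbrakk>v1 \<in> carr V1; w1 \<in> carr W1; v2 \<in> carr V2; w2 \<in> carr W2\<rbrakk> \<Longrightarrow>
      f (tens V1 W1 v1 w1) (tens V2 W2 v2 w2) = g (tens V1 W1 v1 w1) (tens V2 W2 v2 w2)"
    and X: "X \<in> carr (tensor_space V1 W1)" and Y: "Y \<in> carr (tensor_space V2 W2)"
  shows "f X Y = g X Y"
proof (rule tensor_lin_eqI[OF V(1) _ _ _ X])
  show "lin (tensor_space V1 W1) U (\<lambda>X. f X Y)" "lin (tensor_space V1 W1) U (\<lambda>X. g X Y)"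
    using f g Y by (simp_all add: bilin_def)
  fix v w assume v: "v \<in> carr V1" "w \<in> carr W1"
  show "f (tens V1 W1 v w) Y = g (tens V1 W1 v w) Y"
    using f g tens_mem[OF v]
    by (intro tensor_lin_eqI[where f = "f (tens V1 W1 v w)" and g = "g (tens V1 W1 v w)",
          OF V(2) _ _ eq[OF v] Y]) (auto simp: bilin_def)
qed

lemma tensor_trilin_eqI:
  assumes V: "vspace V1" "vspace V2" "vspace V3"
    and f: "\<And>X. X \<in> carr (tensor_space V1 W1) \<Longrightarrow>
      bilin (tensor_space V2 W2) (tensor_space V3 W3) U (f X)"
      "\<And>Y Z. Y \<in> carr (tensor_space V2 W2) \<Longrightarrow> Z \<in> carr (tensor_space V3 W3) \<Longrightarrow>
        lin (tensor_space V1 W1) U (\<lambda>X. f X Y Z)"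
    and g: "\<And>X. X \<in> carr (tensor_space V1 W1) \<Longrightarrow>
      bilin (tensor_space V2 W2) (tensor_space V3 W3) U (g X)"
      "\<And>Y Z. Y \<in> carr (tensor_space V2 W2) \<Longrightarrow> Z \<in> carr (tensor_space V3 W3) \<Longrightarrow>
        lin (tensor_space V1 W1) U (\<lambda>X. g X Y Z)"
    and eq: "\<And>v1 w1 v2 w2 v3 w3. \<lbrakk>v1 \<in> carr V1; w1 \<in> carr W1; v2 \<in> carr V2; w2 \<in> carr W2;
        v3 \<in> carr V3; w3 \<in> carr W3\<rbrakk> \<Longrightarrow>
      f (tens V1 W1 v1 w1) (tens V2 W2 v2 w2) (tens V3 W3 v3 w3) =
      g (tens V1 W1 v1 w1) (tens V2 W2 v2 w2) (tens V3 W3 v3 w3)"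
    and X: "X \<in> carr (tensor_space V1 W1)" and Y: "Y \<in> carr (tensor_space V2 W2)"
    and Z: "Z \<in> carr (tensor_space V3 W3)"
  shows "f X Y Z = g X Y Z"
proof (rule tensor_lin_eqI[OF V(1) f(2)[OF Y Z] g(2)[OF Y Z] _ X])
  fix v w assume v: "v \<in> carr V1" "w \<in> carr W1"
  show "f (tens V1 W1 v w) Y Z = g (tens V1 W1 v w) Y Z"
    by (rule tensor_bilin_eqI[where f = "f (tens V1 W1 v w)" and g = "g (tens V1 W1 v w)",
          OF V(2,3) f(1)[OF tens_mem[OF v]] g(1)[OF tens_mem[OF v]] eq[OF v] Y Z])
qed

lemma bilin_push:
  assumes f: "bilin V W U f"
  shows "\<lbrakk>vspace V; X \<in> carr (tensor_space V' W'); w \<in> carr W;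
      \<And>x y. x \<in> carr V' \<Longrightarrow> y \<in> carr W' \<Longrightarrow> g x y \<in> carr V\<rbrakk> \<Longrightarrow>
      f (tlift V' W' g X) w = tlift V' W' (\<lambda>x y. f (g x y) w) X"
    and "\<lbrakk>vspace W; X \<in> carr (tensor_space V' W'); v \<in> carr V;
      \<And>x y. x \<in> carr V' \<Longrightarrow> y \<in> carr W' \<Longrightarrow> h x y \<in> carr W\<rbrakk> \<Longrightarrow>
      f v (tlift V' W' h X) = tlift V' W' (\<lambda>x y. f v (h x y)) X"
proof -
  show "f (tlift V' W' g X) w = tlift V' W' (\<lambda>x y. f (g x y) w) X"
    if "vspace V" "X \<in> carr (tensor_space V' W')" "w \<in> carr W"
      "\<And>x y. x \<in> carr V' \<Longrightarrow> y \<in> carr W' \<Longrightarrow> g x y \<in> carr V"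
    using f that by (intro lin_tlift_apply[where g = "\<lambda>v. f v w" and U = V and U' = U])
      (auto simp: bilin_def)
  show "f v (tlift V' W' h X) = tlift V' W' (\<lambda>x y. f v (h x y)) X"
    if "vspace W" "X \<in> carr (tensor_space V' W')" "v \<in> carr V"
      "\<And>x y. x \<in> carr V' \<Longrightarrow> y \<in> carr W' \<Longrightarrow> h x y \<in> carr W"
    using f that by (intro lin_tlift_apply[where g = "\<lambda>w. f v w" and U = W and U' = U])
      (auto simp: bilin_def)
qed

lemmas tens_push = bilin_push[OF bilin_tens]

lemma tlift_arg_add:
  assumes "vspace V" "vspace U" "bilin V W U f" "X \<in> carr (tensor_space V W)"
    "Y \<in> carr (tensor_space V W)"
  shows "tlift V W f (X + Y) = tlift V W f X + tlift V W f Y"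
  using lin_add_apply[OF lin_tlift[OF assms(1-3)] assms(4,5)] .

lemma tlift_arg_zero:
  assumes "vspace V" "vspace U" "bilin V W U f"
  shows "tlift V W f 0 = 0"
  using lin_0[OF vspace_tensor[OF assms(1)] lin_tlift[OF assms]] .

lemma bilin_zero:
  assumes "bilin V W U f"
  shows "vspace V \<Longrightarrow> w \<in> carr W \<Longrightarrow> f 0 w = 0" "vspace W \<Longrightarrow> v \<in> carr V \<Longrightarrow> f v 0 = 0"
  using assms lin_0[of V U "\<lambda>v. f v w"] lin_0[of W U "f v"] by (auto simp: bilin_def)

lemma bilin_scl:
  assumes "bilin V W U f"
  shows "v \<in> carr V \<Longrightarrow> w \<in> carr W \<Longrightarrow> f (scl V c v) w = scl U c (f v w)"
    "v \<in> carr V \<Longrightarrow> w \<in> carr W \<Longrightarrow> f v (scl W c w) = scl U c (f v w)"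
  using assms by (auto simp: bilin_def lin_def)

lemma bilin_cong:
  assumes "bilin V W U g" "\<And>v w. v \<in> carr V \<Longrightarrow> w \<in> carr W \<Longrightarrow> f v w = g v w"
    "vspace V" "vspace W"
  shows "bilin V W U f"
  using assms by (auto simp: bilin_def lin_def vspace_mem)

lemma tens_add:
  "\<lbrakk>v \<in> carr V; v' \<in> carr V; w \<in> carr X\<rbrakk> \<Longrightarrow> tens V X (v + v') w = tens V X v w + tens V X v' w"
  "\<lbrakk>v \<in> carr V; w \<in> carr X; w' \<in> carr X\<rbrakk> \<Longrightarrow> tens V X v (w + w') = tens V X v w + tens V X v w'"
  using bilin_tens[of V X] by (simp_all add: bilin_def lin_def)

lemma tens_zero:
  "vspace V \<Longrightarrow> x \<in> carr X \<Longrightarrow> tens V X 0 x = 0"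
  "vspace X \<Longrightarrow> v \<in> carr V \<Longrightarrow> tens V X v 0 = 0"
  using bilin_zero[OF bilin_tens] by auto

lemma direct_sum_memE:
  assumes "X \<in> carr (direct_sum V W)"
  obtains P Q where "X = (P, Q)" "P \<in> carr V" "Q \<in> carr W"
  using assms by (auto simp: direct_sum_def)

lemma lin_direct_sum [mlin]:
  assumes "vspace U" "lin V U f" "lin W U g"
  shows "lin (direct_sum V W) U (\<lambda>X. case X of (P, Q) \<Rightarrow> f P + g Q)"
  using assms
  by (auto simp: lin_def direct_sum_def vspace_scl vspace_mem algebra_simps)

lemma direct_sum_components:
  "x \<in> carr (direct_sum V W) \<Longrightarrow> fst x \<in> carr V" "x \<in> carr (direct_sum V W) \<Longrightarrow> snd x \<in> carr W"
  "lin S (direct_sum V W) f \<Longrightarrow> lin S V (\<lambda>x. fst (f x))"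
  "lin S (direct_sum V W) f \<Longrightarrow> lin S W (\<lambda>x. snd (f x))"
  by (auto simp: lin_def direct_sum_def split: prod.splits)

text \<open>An algebra, a bimodule and their underlying space are different records; all linear constructions
  see only the carrier and the scalar multiplication.\<close>

lemma space_cong:
  assumes "carr V = carr V'" "scl V = scl V'"
  shows "vspace V = vspace V'" "lin V U = lin V' U" "lin U V = lin U V'"
    "bilin V W U' = bilin V' W U'" "bilin W V U' = bilin W V' U'" "bilin W U' V = bilin W U' V'"
    "tens V W = tens V' W" "tens W V = tens W V'"
    "tensor_space V W = tensor_space V' W" "tensor_space W V = tensor_space W V'"
    "tlift V W = tlift V' W" "tlift W V = tlift W V'"
    "direct_sum V W = direct_sum V' W" "direct_sum W V = direct_sum W V'"
proof -
  show "vspace V = vspace V'" by (simp add: vspace_def assms)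
qed (simp_all add: lin_def bilin_def tens_def tensor_space_def tlift_def direct_sum_def fun_eq_iff
    assms)

lemma vspace_span:
  assumes V: "vspace V" and S: "S \<subseteq> carr V"
  shows "vspace \<lparr>carr = module.span (scl V) S, scl = scl V\<rparr>" "module.span (scl V) S \<subseteq> carr V"
proof -
  interpret vector_space "scl V" using V by (simp add: vspace_def)
  show "vspace \<lparr>carr = span S, scl = scl V\<rparr>"
    using V by (simp add: vspace_def)
  show "span S \<subseteq> carr V"
    using V S by (auto simp: vspace_def intro: span_minimal[THEN subsetD])
qed

text \<open>A trilinear map factors through the threefold tensor product; this turns the coassociativity
  axioms, which are equations between sums of \<^const>\<open>tens3\<close>, into equations between sums of
  values of an arbitrary trilinear map.\<close>

lemma tens3_lift:
  assumes V: "vspace V1" "vspace V2" and U: "vspace U"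
    and F: "\<And>y z. y \<in> carr V2 \<Longrightarrow> z \<in> carr V3 \<Longrightarrow> lin V1 U (\<lambda>x. F x y z)"
      "\<And>x z. x \<in> carr V1 \<Longrightarrow> z \<in> carr V3 \<Longrightarrow> lin V2 U (\<lambda>y. F x y z)"
      "\<And>x y. x \<in> carr V1 \<Longrightarrow> y \<in> carr V2 \<Longrightarrow> lin V3 U (\<lambda>z. F x y z)"
  obtains G where "lin (tensor_space V1 (tensor_space V2 V3)) U G"
    and "\<And>x y z. x \<in> carr V1 \<Longrightarrow> y \<in> carr V2 \<Longrightarrow> z \<in> carr V3 \<Longrightarrow>
      G (tens V1 (tensor_space V2 V3) x (tens V2 V3 y z)) = F x y z"
proof
  let ?G = "tlift V1 (tensor_space V2 V3) (\<lambda>x Y. tlift V2 V3 (\<lambda>y z. F x y z) Y)"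
  have b: "bilin V1 (tensor_space V2 V3) U (\<lambda>x Y. tlift V2 V3 (\<lambda>y z. F x y z) Y)"
    by (assumption | rule mlin V F U)+
  show "lin (tensor_space V1 (tensor_space V2 V3)) U ?G"
    by (rule lin_tlift[OF V(1) U b])
  show "?G (tens V1 (tensor_space V2 V3) x (tens V2 V3 y z)) = F x y z"
    if "x \<in> carr V1" "y \<in> carr V2" "z \<in> carr V3" for x y z
    using that by (simp add: tlift_tens[OF U] mlin F U V)
qed

section \<open>Comodules over a Hopf algebra\<close>

context k_algebra
begin

lemmas alg_rules [mlin] = vspace_alg unt_mem bilin_rules[OF bilin_mul]
lemmas alg_push = bilin_push[OF bilin_mul]

end

context hopf_algebra
begin

lemma lin_comul: "lin H (tensor_space H H) (comul H)"
  using comul_hom by (simp add: alg_hom_def lin_def tensor_alg_def)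

lemmas hopf_rules [mlin] = lin_rules[OF lin_comul] lin_rules[OF lin_counit]

lemma comul_unt: "comul H \<one>\<^bsub>H\<^esub> = tens H H \<one>\<^bsub>H\<^esub> \<one>\<^bsub>H\<^esub>"
  using comul_hom by (simp add: alg_hom_def tensor_alg_def)

lemma comul_mul:
  assumes "h \<in> carr H" "h' \<in> carr H"
  shows "comul H (h \<cdot>\<^bsub>H\<^esub> h') = tlift H H (\<lambda>h1 h2. tlift H H (\<lambda>h1' h2'.
    tens H H (h1 \<cdot>\<^bsub>H\<^esub> h1') (h2 \<cdot>\<^bsub>H\<^esub> h2')) (comul H h')) (comul H h)"
  using comul_hom assms by (simp add: alg_hom_def tensor_alg_def)

sublocale left_comodule H H "comul H"
  using lin_comul coassoc counit_left
  by unfold_locales (auto simp: sw2_def mlin)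

end

locale hopf_left_comodule = hopf_algebra H + N: left_comodule H N \<delta>
  for H :: "('k::field, 'h::ab_group_add) hopf"
    and N :: "('k, 'n::ab_group_add, 'z) space_scheme"
    and \<delta> :: "'n \<Rightarrow> ('k, 'h, 'n) tensor"
begin

lemmas comod_rules [mlin] = N.vspace_comod lin_rules[OF N.lin_coaction]

text \<open>Coassociativity \<open>\<Sum> F(n\<^sub>-\<^sub>2, n\<^sub>-\<^sub>1, n\<^sub>0)\<close> as a rewrite rule: iterated coactions become
  comultiplications.\<close>

lemma coassoc_sum:
  assumes U: "vspace U"
    and F: "\<And>h' n. h' \<in> carr H \<Longrightarrow> n \<in> carr N \<Longrightarrow> lin H U (\<lambda>h. F h h' n)"
      "\<And>h n. h \<in> carr H \<Longrightarrow> n \<in> carr N \<Longrightarrow> lin H U (\<lambda>h'. F h h' n)"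
      "\<And>h h'. h \<in> carr H \<Longrightarrow> h' \<in> carr H \<Longrightarrow> lin N U (\<lambda>n. F h h' n)"
    and n: "n \<in> carr N"
  shows "tlift H N (\<lambda>h m. tlift H N (\<lambda>h' m0. F h h' m0) (\<delta> m)) (\<delta> n) =
    tlift H N (\<lambda>h m. tlift H H (\<lambda>h1 h2. F h1 h2 m) (comul H h)) (\<delta> n)"
proof -
  obtain G where G: "lin (tensor_space H (tensor_space H N)) U G"
    and e: "\<And>a b m. a \<in> carr H \<Longrightarrow> b \<in> carr H \<Longrightarrow> m \<in> carr N \<Longrightarrow>
      G (tens H (tensor_space H N) a (tens H N b m)) = F a b m"
    by (rule tens3_lift[of H H U N F]) (assumption | rule mlin F U that)+
  show ?thesis using arg_cong[OF N.coaction_coassoc[OF n], of G] n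
    by (simp add: lin_tlift_apply[OF G] sw2_def e mlin tens3_def cong: tlift_cong)
qed

lemma counit_sum:
  assumes U: "vspace U" and f: "lin N U f" and n: "n \<in> carr N"
  shows "tlift H N (\<lambda>h m. scl U (counit H h) (f m)) (\<delta> n) = f n"
proof -
  have "f (tlift H N (\<lambda>h m. scl N (counit H h) m) (\<delta> n)) =
      tlift H N (\<lambda>h m. f (scl N (counit H h) m)) (\<delta> n)"
    by (rule lin_tlift_apply[OF f]) (assumption | rule mlin n)+
  also have "\<dots> = tlift H N (\<lambda>h m. scl U (counit H h) (f m)) (\<delta> n)"
    by (rule tlift_cong) (simp_all add: mlin n lin_scl_apply[OF f])
  finally show ?thesis by (simp add: N.coaction_counit n)
qed

end

locale hopf_right_comodule = hopf_algebra H + N: right_comodule H N \<rho>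
  for H :: "('k::field, 'h::ab_group_add) hopf"
    and N :: "('k, 'n::ab_group_add, 'z) space_scheme"
    and \<rho> :: "'n \<Rightarrow> ('k, 'n, 'h) tensor"
begin

lemmas comod_rules [mlin] = N.vspace_comod lin_rules[OF N.lin_coaction]

lemma coassoc_sum:
  assumes U: "vspace U"
    and F: "\<And>h h'. h \<in> carr H \<Longrightarrow> h' \<in> carr H \<Longrightarrow> lin N U (\<lambda>n. F n h h')"
      "\<And>n h'. n \<in> carr N \<Longrightarrow> h' \<in> carr H \<Longrightarrow> lin H U (\<lambda>h. F n h h')"
      "\<And>n h. n \<in> carr N \<Longrightarrow> h \<in> carr H \<Longrightarrow> lin H U (\<lambda>h'. F n h h')"
    and n: "n \<in> carr N"
  shows "tlift N H (\<lambda>m h'. tlift N H (\<lambda>m0 h. F m0 h h') (\<rho> m)) (\<rho> n) =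
    tlift N H (\<lambda>m h. tlift H H (\<lambda>h1 h2. F m h1 h2) (comul H h)) (\<rho> n)"
proof -
  obtain G where G: "lin (tensor_space N (tensor_space H H)) U G"
    and e: "\<And>m a b. m \<in> carr N \<Longrightarrow> a \<in> carr H \<Longrightarrow> b \<in> carr H \<Longrightarrow>
      G (tens N (tensor_space H H) m (tens H H a b)) = F m a b"
    by (rule tens3_lift[of N H U H F]) (assumption | rule mlin F U that)+
  show ?thesis using arg_cong[OF N.coaction_coassoc[OF n], of G] n
    by (simp add: lin_tlift_apply[OF G] sw2_def e mlin tens3_def cong: tlift_cong)
qed

lemma counit_sum:
  assumes U: "vspace U" and f: "lin N U f" and n: "n \<in> carr N"
  shows "tlift N H (\<lambda>m h. scl U (counit H h) (f m)) (\<rho> n) = f n"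
proof -
  have "f (tlift N H (\<lambda>m h. scl N (counit H h) m) (\<rho> n)) =
      tlift N H (\<lambda>m h. f (scl N (counit H h) m)) (\<rho> n)"
    by (rule lin_tlift_apply[OF f]) (assumption | rule mlin n)+
  also have "\<dots> = tlift N H (\<lambda>m h. scl U (counit H h) (f m)) (\<rho> n)"
    by (rule tlift_cong) (simp_all add: mlin n lin_scl_apply[OF f])
  finally show ?thesis by (simp add: N.coaction_counit n)
qed

end

section \<open>Twisted products\<close>

text \<open>The coefficient part \<open>c(m, m'; g, h)\<close> of a twisted product; \<open>g\<close> and \<open>h\<close> are the coaction legs of the
  two factors.\<close>

locale coefficient_product =
  fixes H :: "('k::field, 'h::ab_group_add) hopf"
    and M1 :: "('k, 'm1::ab_group_add, 'x1) space_scheme"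
    and M2 :: "('k, 'm2::ab_group_add, 'x2) space_scheme"
    and M12 :: "('k, 'm12::ab_group_add, 'x12) space_scheme"
    and c :: "'m1 \<Rightarrow> 'm2 \<Rightarrow> 'h \<Rightarrow> 'h \<Rightarrow> 'm12"
  assumes vspace_coeff: "vspace M1" "vspace M2" "vspace M12"
    and lin_c1: "\<lbrakk>m' \<in> carr M2; g \<in> carr H; h \<in> carr H\<rbrakk> \<Longrightarrow> lin M1 M12 (\<lambda>m. c m m' g h)"
    and lin_c2: "\<lbrakk>m \<in> carr M1; g \<in> carr H; h \<in> carr H\<rbrakk> \<Longrightarrow> lin M2 M12 (\<lambda>m'. c m m' g h)"
    and lin_c3: "\<lbrakk>m \<in> carr M1; m' \<in> carr M2; h \<in> carr H\<rbrakk> \<Longrightarrow> lin H M12 (\<lambda>g. c m m' g h)"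
    and lin_c4: "\<lbrakk>m \<in> carr M1; m' \<in> carr M2; g \<in> carr H\<rbrakk> \<Longrightarrow> lin H M12 (\<lambda>h. c m m' g h)"
begin

lemma coeff_rules [mlin]:
  "\<lbrakk>m \<in> carr M1; m' \<in> carr M2; g \<in> carr H; h \<in> carr H\<rbrakk> \<Longrightarrow> c m m' g h \<in> carr M12"
  "\<lbrakk>lin S M1 f1; m' \<in> carr M2; g \<in> carr H; h \<in> carr H\<rbrakk> \<Longrightarrow> lin S M12 (\<lambda>x. c (f1 x) m' g h)"
  "\<lbrakk>lin S M2 f2; m \<in> carr M1; g \<in> carr H; h \<in> carr H\<rbrakk> \<Longrightarrow> lin S M12 (\<lambda>x. c m (f2 x) g h)"
  "\<lbrakk>lin S H f3; m \<in> carr M1; m' \<in> carr M2; h \<in> carr H\<rbrakk> \<Longrightarrow> lin S M12 (\<lambda>x. c m m' (f3 x) h)"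
  "\<lbrakk>lin S H f3; m \<in> carr M1; m' \<in> carr M2; g \<in> carr H\<rbrakk> \<Longrightarrow> lin S M12 (\<lambda>x. c m m' g (f3 x))"
  using lin_c1[of m' g h] lin_c2[of m g h] lin_c3[of m m' h] lin_c4[of m m' g]
  by (auto simp: lin_def)

lemmas coeff_vspaces [mlin] = vspace_coeff

end

locale comodule_pairing =
  C1: hopf_left_comodule H N1 \<delta>1 + C2: hopf_left_comodule H N2 \<delta>2 +
  C12: hopf_left_comodule H N12 \<delta>12
  for H :: "('k::field, 'h::ab_group_add) hopf"
    and N1 :: "('k, 'n1::ab_group_add, 'y1) space_scheme" and \<delta>1
    and N2 :: "('k, 'n2::ab_group_add, 'y2) space_scheme" and \<delta>2
    and N12 :: "('k, 'n12::ab_group_add, 'y12) space_scheme" and \<delta>12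
    and q :: "'n1 \<Rightarrow> 'n2 \<Rightarrow> 'n12" +
  assumes bilin_q: "bilin N1 N2 N12 q"
    and coaction_q: "\<lbrakk>n \<in> carr N1; n' \<in> carr N2\<rbrakk> \<Longrightarrow> \<delta>12 (q n n') =
      tlift H N1 (\<lambda>g m. tlift H N2 (\<lambda>k m'. tens H N12 (g \<cdot>\<^bsub>H\<^esub> k) (q m m')) (\<delta>2 n')) (\<delta>1 n)"
begin

lemmas q_rules [mlin] = bilin_rules[OF bilin_q]

end

text \<open>\<open>(m \<otimes> n) \<star> (m' \<otimes> n') = c(m, m'; n\<^sub>-\<^sub>1, n'\<^sub>-\<^sub>1) \<otimes> n\<^sub>0 n'\<^sub>0\<close>.\<close>

definition twisted_prod where
  "twisted_prod H M1 M2 M12 c N1 \<delta>1 N2 \<delta>2 N12 q X Y =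
     tlift M1 N1 (\<lambda>m n. tlift M2 N2 (\<lambda>m' n'.
       tlift H N1 (\<lambda>g n0. tlift H N2 (\<lambda>h n0'. tens M12 N12 (c m m' g h) (q n0 n0'))
         (\<delta>2 n')) (\<delta>1 n)) Y) X"

locale twisted_product =
  coefficient_product H M1 M2 M12 c + comodule_pairing H N1 \<delta>1 N2 \<delta>2 N12 \<delta>12 q
  for H :: "('k::field, 'h::ab_group_add) hopf"
    and M1 :: "('k, 'm1::ab_group_add, 'x1) space_scheme"
    and M2 :: "('k, 'm2::ab_group_add, 'x2) space_scheme"
    and M12 :: "('k, 'm12::ab_group_add, 'x12) space_scheme"
    and c
    and N1 :: "('k, 'n1::ab_group_add, 'y1) space_scheme" and \<delta>1
    and N2 :: "('k, 'n2::ab_group_add, 'y2) space_scheme" and \<delta>2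
    and N12 :: "('k, 'n12::ab_group_add, 'y12) space_scheme" and \<delta>12
    and q :: "'n1 \<Rightarrow> 'n2 \<Rightarrow> 'n12"
begin

abbreviation prd (infixl \<open>\<star>\<close> 70) where
  "X \<star> Y \<equiv> twisted_prod H M1 M2 M12 c N1 \<delta>1 N2 \<delta>2 N12 q X Y"

lemma bilin_prd: "bilin (tensor_space M1 N1) (tensor_space M2 N2) (tensor_space M12 N12) prd"
  unfolding twisted_prod_def by (assumption | rule mlin)+

lemmas prd_rules [mlin] = bilin_rules[OF bilin_prd]
lemmas prd_push = bilin_push[OF bilin_prd]

lemma prd_tens:
  assumes "m \<in> carr M1" "n \<in> carr N1" "m' \<in> carr M2" "n' \<in> carr N2"
  shows "tens M1 N1 m n \<star> tens M2 N2 m' n' =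
    tlift H N1 (\<lambda>g n0. tlift H N2 (\<lambda>h n0'. tens M12 N12 (c m m' g h) (q n0 n0')) (\<delta>2 n')) (\<delta>1 n)"
  using assms
  by (simp add: twisted_prod_def tlift_tens[where U = "tensor_space M12 N12"] mlin)

end

text \<open>Expanding either side on pure tensors, colinearity of the inner pairing splits its coaction leg as a
  product of two legs, and coassociativity turns the repeated coactions into comultiplications.  Both
  sides become sums over one coaction of each \<open>n\<^sub>i\<close>, whose coefficients are the two sides of the
  hypothesis on \<open>c\<close>.\<close>

lemma twisted_prod_assoc:
  assumes "twisted_product H M1 M2 M12 c12 N1 \<delta>1 N2 \<delta>2 N12 \<delta>12 q12"
    and "twisted_product H M12 M3 M c123 N12 \<delta>12 N3 \<delta>3 N \<delta> q123"
    and "twisted_product H M2 M3 M23 c23 N2 \<delta>2 N3 \<delta>3 N23 \<delta>23 q23"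
    and "twisted_product H M1 M23 M c'123 N1 \<delta>1 N23 \<delta>23 N \<delta> q'123"
    and q_assoc: "\<And>n1 n2 n3. \<lbrakk>n1 \<in> carr N1; n2 \<in> carr N2; n3 \<in> carr N3\<rbrakk> \<Longrightarrow>
      q123 (q12 n1 n2) n3 = q'123 n1 (q23 n2 n3)"
    and c_assoc: "\<And>m1 m2 m3 g h k. \<lbrakk>m1 \<in> carr M1; m2 \<in> carr M2; m3 \<in> carr M3;
        g \<in> carr H; h \<in> carr H; k \<in> carr H\<rbrakk> \<Longrightarrow>
      tlift H H (\<lambda>g1 g2. tlift H H (\<lambda>h1 h2.
        c123 (c12 m1 m2 g1 h1) m3 (g2 \<cdot>\<^bsub>H\<^esub> h2) k) (comul H h)) (comul H g) =
      tlift H H (\<lambda>h1 h2. tlift H H (\<lambda>k1 k2.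
        c'123 m1 (c23 m2 m3 h1 k1) g (h2 \<cdot>\<^bsub>H\<^esub> k2)) (comul H k)) (comul H h)"
    and XYZ: "X \<in> carr (tensor_space M1 N1)" "Y \<in> carr (tensor_space M2 N2)"
      "Z \<in> carr (tensor_space M3 N3)"
  shows "twisted_prod H M12 M3 M c123 N12 \<delta>12 N3 \<delta>3 N q123
      (twisted_prod H M1 M2 M12 c12 N1 \<delta>1 N2 \<delta>2 N12 q12 X Y) Z =
    twisted_prod H M1 M23 M c'123 N1 \<delta>1 N23 \<delta>23 N q'123 X
      (twisted_prod H M2 M3 M23 c23 N2 \<delta>2 N3 \<delta>3 N23 q23 Y Z)"
proof -
  interpret P12: twisted_product H M1 M2 M12 c12 N1 \<delta>1 N2 \<delta>2 N12 \<delta>12 q12 by fact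
  interpret P123: twisted_product H M12 M3 M c123 N12 \<delta>12 N3 \<delta>3 N \<delta> q123 by fact
  interpret P23: twisted_product H M2 M3 M23 c23 N2 \<delta>2 N3 \<delta>3 N23 \<delta>23 q23 by fact
  interpret Q: twisted_product H M1 M23 M c'123 N1 \<delta>1 N23 \<delta>23 N \<delta> q'123 by fact
  let ?T = "tensor_space M N"
  have pure: "P123.prd (P12.prd (tens M1 N1 m1 n1) (tens M2 N2 m2 n2)) (tens M3 N3 m3 n3) =
      Q.prd (tens M1 N1 m1 n1) (P23.prd (tens M2 N2 m2 n2) (tens M3 N3 m3 n3))" (is "?L = ?R")
    if m: "m1 \<in> carr M1" "m2 \<in> carr M2" "m3 \<in> carr M3"
      and n: "n1 \<in> carr N1" "n2 \<in> carr N2" "n3 \<in> carr N3" for m1 m2 m3 n1 n2 n3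
  proof -
    \<comment> \<open>sums over \<open>N1\<close>, \<open>N2\<close>, \<open>N3\<close> are ordered from the outside in, comultiplications innermost\<close>
    note swaps = tlift_swap[of H N2 H N1] tlift_swap[of H N3 H N1] tlift_swap[of H N3 H N2]
      tlift_swap[of H H H N1] tlift_swap[of H H H N2] tlift_swap[of H H H N3]
    note expand = P12.prd_tens P123.prd_tens P23.prd_tens Q.prd_tens P123.prd_push Q.prd_push
      P12.coaction_q P23.coaction_q tlift_tens[where U = ?T] tlift_tlift[where U = ?T]
    have "?L = tlift H N1 (\<lambda>g x1. tlift H N2 (\<lambda>h x2. tlift H N3 (\<lambda>k x3.
        tens M N (tlift H H (\<lambda>g1 g2. tlift H H (\<lambda>h1 h2.
            c123 (c12 m1 m2 g1 h1) m3 (g2 \<cdot>\<^bsub>H\<^esub> h2) k) (comul H h)) (comul H g))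
          (q123 (q12 x1 x2) x3)) (\<delta>3 n3)) (\<delta>2 n2)) (\<delta>1 n1)"
      using m n
      by (simp add: expand swaps mlin
          P12.C1.coassoc_sum[where U = ?T] P12.C2.coassoc_sum[where U = ?T]
          tens_push[where V = M and W = N] cong: tlift_cong)
    also have "\<dots> = tlift H N1 (\<lambda>g x1. tlift H N2 (\<lambda>h x2. tlift H N3 (\<lambda>k x3.
        tens M N (tlift H H (\<lambda>h1 h2. tlift H H (\<lambda>k1 k2.
            c'123 m1 (c23 m2 m3 h1 k1) g (h2 \<cdot>\<^bsub>H\<^esub> k2)) (comul H k)) (comul H h))
          (q'123 x1 (q23 x2 x3))) (\<delta>3 n3)) (\<delta>2 n2)) (\<delta>1 n1)"
      using m n by (simp add: c_assoc q_assoc mlin cong: tlift_cong)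
    also have "\<dots> = ?R"
      using m n
      by (simp add: expand swaps mlin
          P12.C2.coassoc_sum[where U = ?T] P123.C2.coassoc_sum[where U = ?T]
          tens_push[where V = M and W = N] cong: tlift_cong)
    finally show ?thesis .
  qed
  show ?thesis
    by (rule tensor_trilin_eqI[where f = "\<lambda>X Y Z. P123.prd (P12.prd X Y) Z"
          and g = "\<lambda>X Y Z. Q.prd X (P23.prd Y Z)" and U = ?T, OF _ _ _ _ _ _ _ pure XYZ]) (assumption | rule mlin)+
qed

text \<open>With \<open>\<delta>(e) = 1 \<otimes> e\<close> only the coaction leg of \<open>X\<close> remains, and the counit removes it.\<close>

lemma twisted_prod_unit_left:
  assumes "twisted_product H M1 M M c N1 \<delta>1 N \<delta> N \<delta> q"
    and e: "u \<in> carr M1" "e \<in> carr N1" "\<delta>1 e = tens H N1 \<one>\<^bsub>H\<^esub> e"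
    and q: "\<And>n. n \<in> carr N \<Longrightarrow> q e n = n"
    and c: "\<And>m h. m \<in> carr M \<Longrightarrow> h \<in> carr H \<Longrightarrow> c u m \<one>\<^bsub>H\<^esub> h = scl M (counit H h) m"
    and X: "X \<in> carr (tensor_space M N)"
  shows "twisted_prod H M1 M M c N1 \<delta>1 N \<delta> N q (tens M1 N1 u e) X = X"
proof -
  interpret twisted_product H M1 M M c N1 \<delta>1 N \<delta> N \<delta> q by fact
  have "prd (tens M1 N1 u e) (tens M N m n) = tens M N m n" if "m \<in> carr M" "n \<in> carr N" for m n
    using that e
    by (simp add: prd_tens tlift_tens[where U = "tensor_space M N"] mlin q c scl_tens[symmetric]
        C2.counit_sum cong: tlift_cong)
  then show ?thesis
    by (intro tensor_lin_eqI[where f = "prd (tens M1 N1 u e)" and g = "\<lambda>X. X" and U = "tensor_space M N", OF _ _ _ _ X])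
      (simp_all add: mlin e)
qed

lemma twisted_prod_unit_right:
  assumes "twisted_product H M M2 M c N \<delta> N2 \<delta>2 N \<delta> q"
    and e: "u \<in> carr M2" "e \<in> carr N2" "\<delta>2 e = tens H N2 \<one>\<^bsub>H\<^esub> e"
    and q: "\<And>n. n \<in> carr N \<Longrightarrow> q n e = n"
    and c: "\<And>m h. m \<in> carr M \<Longrightarrow> h \<in> carr H \<Longrightarrow> c m u h \<one>\<^bsub>H\<^esub> = scl M (counit H h) m"
    and X: "X \<in> carr (tensor_space M N)"
  shows "twisted_prod H M M2 M c N \<delta> N2 \<delta>2 N q X (tens M2 N2 u e) = X"
proof -
  interpret twisted_product H M M2 M c N \<delta> N2 \<delta>2 N \<delta> q by fact
  have "prd (tens M N m n) (tens M2 N2 u e) = tens M N m n" if "m \<in> carr M" "n \<in> carr N" for m n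
    using that e
    by (simp add: prd_tens tlift_tens[where U = "tensor_space M N"] mlin q c scl_tens[symmetric]
        C1.counit_sum cong: tlift_cong)
  then show ?thesis
    by (intro tensor_lin_eqI[where f = "\<lambda>X. prd X (tens M2 N2 u e)" and g = "\<lambda>X. X" and U = "tensor_space M N", OF _ _ _ _ X])
      (simp_all add: mlin e)
qed

section \<open>Splitting maps and right coactions\<close>

text \<open>Left colinearity of \<open>s : N \<rightarrow> L \<otimes> K\<close>, where \<open>H\<close> coacts on the factor \<open>L\<close>.  The equation has the
  form of the axioms for a coassociative coaction and for a pair of commuting coactions, so that both
  are instances.\<close>

locale colinear_splitting =
  C: hopf_left_comodule H N \<delta> + L: hopf_left_comodule H L \<delta>L
  for H :: "('k::field, 'h::ab_group_add) hopf"
    and N :: "('k, 'n::ab_group_add, 'y) space_scheme" and \<delta>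
    and L :: "('k, 'l::ab_group_add, 'x) space_scheme" and \<delta>L +
  fixes K :: "('k, 'v::ab_group_add, 'z) space_scheme"
    and s :: "'n \<Rightarrow> ('k, 'l, 'v) tensor"
  assumes vspace_K: "vspace K"
    and lin_s: "lin N (tensor_space L K) s"
    and s_colinear: "n \<in> carr N \<Longrightarrow>
      tlift L K (\<lambda>l v. tlift H L (\<lambda>h l0. tens3 H L K h l0 v) (\<delta>L l)) (s n) =
      tlift H N (\<lambda>h m. tlift L K (\<lambda>l v. tens3 H L K h l v) (s m)) (\<delta> n)"
begin

lemmas s_rules [mlin] = vspace_K lin_rules[OF lin_s]

lemma split_sum:
  assumes U: "vspace U"
    and F: "\<And>l v. l \<in> carr L \<Longrightarrow> v \<in> carr K \<Longrightarrow> lin H U (\<lambda>h. F h l v)"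
      "\<And>h v. h \<in> carr H \<Longrightarrow> v \<in> carr K \<Longrightarrow> lin L U (\<lambda>l. F h l v)"
      "\<And>h l. h \<in> carr H \<Longrightarrow> l \<in> carr L \<Longrightarrow> lin K U (\<lambda>v. F h l v)"
    and n: "n \<in> carr N"
  shows "tlift L K (\<lambda>l v. tlift H L (\<lambda>h l0. F h l0 v) (\<delta>L l)) (s n) =
    tlift H N (\<lambda>h m. tlift L K (\<lambda>l v. F h l v) (s m)) (\<delta> n)"
proof -
  obtain G where G: "lin (tensor_space H (tensor_space L K)) U G"
    and e: "\<And>h l v. h \<in> carr H \<Longrightarrow> l \<in> carr L \<Longrightarrow> v \<in> carr K \<Longrightarrow>
      G (tens H (tensor_space L K) h (tens L K l v)) = F h l v"
    by (rule tens3_lift[of H L U K F]) (assumption | rule mlin F U that)+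
  show ?thesis using arg_cong[OF s_colinear[OF n], of G] n
    by (simp add: lin_tlift_apply[OF G] e mlin tens3_def cong: tlift_cong)
qed

end

definition split_map where
  "split_map M N L K s X =
     tlift M N (\<lambda>m n. tlift L K (\<lambda>l v. tens (tensor_space M L) K (tens M L m l) v) (s n)) X"

lemma lin_split_map:
  assumes "vspace M" "vspace N" "vspace L" "lin N (tensor_space L K) s"
  shows "lin (tensor_space M N) (tensor_space (tensor_space M L) K) (split_map M N L K s)"
proof -
  have b: "bilin M N (tensor_space (tensor_space M L) K)
      (\<lambda>m n. tlift L K (\<lambda>l v. tens (tensor_space M L) K (tens M L m l) v) (s n))"
    by (assumption | rule mlin assms lin_rules[OF assms(4)])+
  show ?thesis unfolding split_map_def
    by (assumption | rule mlin assms lin_tlift b)+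
qed

lemma split_map_tens:
  assumes "vspace M" "vspace N" "vspace L" "lin N (tensor_space L K) s" "m \<in> carr M" "n \<in> carr N"
  shows "split_map M N L K s (tens M N m n) =
    tlift L K (\<lambda>l v. tens (tensor_space M L) K (tens M L m l) v) (s n)"
proof -
  have b: "bilin M N (tensor_space (tensor_space M L) K)
      (\<lambda>m n. tlift L K (\<lambda>l v. tens (tensor_space M L) K (tens M L m l) v) (s n))"
    by (assumption | rule mlin assms lin_rules[OF assms(4)])+
  show ?thesis unfolding split_map_def
    by (rule tlift_tens[OF _ b assms(5,6)]) (assumption | rule mlin assms)+
qed

text \<open>The coefficient \<open>c\<close> sees only the coaction legs, and by colinearity it does not matter whether these
  are split off before or after \<open>s\<close>.\<close>

lemma split_map_twisted_prod:
  assumes "twisted_product H M1 M2 M12 c N1 \<delta>1 N2 \<delta>2 N12 \<delta>12 q"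
    and "twisted_product H M1 M2 M12 c L1 \<delta>1' L2 \<delta>2' L12 \<delta>12' q'"
    and "colinear_splitting H N1 \<delta>1 L1 \<delta>1' K1 s1"
    and "colinear_splitting H N2 \<delta>2 L2 \<delta>2' K2 s2"
    and "colinear_splitting H N12 \<delta>12 L12 \<delta>12' K12 s12"
    and r: "bilin K1 K2 K12 r"
    and s: "\<And>n n'. n \<in> carr N1 \<Longrightarrow> n' \<in> carr N2 \<Longrightarrow> s12 (q n n') =
      tlift L1 K1 (\<lambda>l v. tlift L2 K2 (\<lambda>l' v'. tens L12 K12 (q' l l') (r v v')) (s2 n')) (s1 n)"
    and X: "X \<in> carr (tensor_space M1 N1)" and Y: "Y \<in> carr (tensor_space M2 N2)"
  shows "split_map M12 N12 L12 K12 s12 (twisted_prod H M1 M2 M12 c N1 \<delta>1 N2 \<delta>2 N12 q X Y) =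
    tlift (tensor_space M1 L1) K1 (\<lambda>x v. tlift (tensor_space M2 L2) K2 (\<lambda>y v'.
      tens (tensor_space M12 L12) K12
        (twisted_prod H M1 M2 M12 c L1 \<delta>1' L2 \<delta>2' L12 q' x y) (r v v'))
      (split_map M2 N2 L2 K2 s2 Y)) (split_map M1 N1 L1 K1 s1 X)"
proof -
  interpret P: twisted_product H M1 M2 M12 c N1 \<delta>1 N2 \<delta>2 N12 \<delta>12 q by fact
  interpret Q: twisted_product H M1 M2 M12 c L1 \<delta>1' L2 \<delta>2' L12 \<delta>12' q' by fact
  interpret S1: colinear_splitting H N1 \<delta>1 L1 \<delta>1' K1 s1 by fact
  interpret S2: colinear_splitting H N2 \<delta>2 L2 \<delta>2' K2 s2 by fact
  interpret S12: colinear_splitting H N12 \<delta>12 L12 \<delta>12' K12 s12 by fact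
  note r_rules = bilin_rules[OF r]
  have vs1: "vspace N1" "vspace L1" and vs2: "vspace N2" "vspace L2"
    and vs12: "vspace N12" "vspace L12"
    by (simp_all add: mlin)
  note lin_maps = lin_split_map[OF P.vspace_coeff(1) vs1 S1.lin_s]
    lin_split_map[OF P.vspace_coeff(2) vs2 S2.lin_s]
    lin_split_map[OF P.vspace_coeff(3) vs12 S12.lin_s]
  note maps = lin_maps[THEN lin_rules(1)] lin_maps[THEN lin_rules(2)]
  let ?f = "\<lambda>X Y. split_map M12 N12 L12 K12 s12 (P.prd X Y)"
  let ?g = "\<lambda>X Y. tlift (tensor_space M1 L1) K1 (\<lambda>x v. tlift (tensor_space M2 L2) K2 (\<lambda>y v'.
      tens (tensor_space M12 L12) K12 (Q.prd x y) (r v v'))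
      (split_map M2 N2 L2 K2 s2 Y)) (split_map M1 N1 L1 K1 s1 X)"
  let ?T = "tensor_space (tensor_space M12 L12) K12"
  have pure: "?f (tens M1 N1 m n) (tens M2 N2 m' n') = ?g (tens M1 N1 m n) (tens M2 N2 m' n')"
    if m: "m \<in> carr M1" "n \<in> carr N1" "m' \<in> carr M2" "n' \<in> carr N2" for m n m' n'
  proof -
    note st = split_map_tens[OF P.vspace_coeff(1) vs1 S1.lin_s]
      split_map_tens[OF P.vspace_coeff(2) vs2 S2.lin_s]
      split_map_tens[OF P.vspace_coeff(3) vs12 S12.lin_s]
    note swaps = tlift_swap[of H N2 L1 K1] tlift_swap[of H L2 L1 K1]
    let ?M = "tlift H N1 (\<lambda>g n0. tlift L1 K1 (\<lambda>l v. tlift H N2 (\<lambda>h n0'.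
       tlift L2 K2 (\<lambda>l' v'. tens (tensor_space M12 L12) K12
         (tens M12 L12 (c m m' g h) (q' l l')) (r v v')) (s2 n0')) (\<delta>2 n')) (s1 n0)) (\<delta>1 n)"
    \<comment> \<open>first the coactions, then the splittings: the order in which the left-hand side expands\<close>
    have "?f (tens M1 N1 m n) (tens M2 N2 m' n') = ?M"
      using m by (simp add: P.prd_tens lin_tlift_apply[OF lin_maps(3)] st s swaps
          tlift_tens[where U = ?T] tlift_tlift[where U = ?T] mlin r_rules cong: tlift_cong)
    also have "?M = ?g (tens M1 N1 m n) (tens M2 N2 m' n')"
      using m by (simp add: Q.prd_tens st tlift_tens[where U = ?T] tlift_tlift[where U = ?T]
          Q.prd_push tens_push[where V = "tensor_space M12 L12" and W = K12]
          S1.split_sum[where U = ?T] S2.split_sum[where U = ?T]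
          tlift_swap[of L2 K2 H L1] mlin r_rules cong: tlift_cong)
    finally show ?thesis .
  qed
  show ?thesis
    by (rule tensor_bilin_eqI[where f = ?f and g = ?g and U = ?T, OF _ _ _ _ pure X Y])
      (assumption | rule mlin maps r_rules)+
qed

context hopf_right_comodule
begin

lemma right_comodule_split_map:
  assumes M: "vspace M"
  shows "right_comodule H (tensor_space M N) (split_map M N N H \<rho>)"
proof
  let ?V = "tensor_space M N" and ?r = "split_map M N N H \<rho>"
  note l = lin_split_map[OF M N.vspace_comod N.vspace_comod N.lin_coaction]
  note rules = lin_rules[OF l] M mlin
  note st = split_map_tens[OF M N.vspace_comod N.vspace_comod N.lin_coaction]
  show "vspace ?V" by (rule mlin M)+
  show "lin ?V (tensor_space ?V H) ?r" by (rule l)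
  let ?U = "tensor_space ?V (tensor_space H H)"
  let ?f = "\<lambda>X. tlift ?V H (\<lambda>Y h2. tlift ?V H (\<lambda>Z h1. tens3 ?V H H Z h1 h2) (?r Y)) (?r X)"
  let ?g = "\<lambda>X. tlift ?V H (\<lambda>Z h. sw2 H (\<lambda>h1 h2. tens3 ?V H H Z h1 h2) h) (?r X)"
  show "?f X = ?g X" if X: "X \<in> carr ?V" for X
  proof (rule tensor_lin_eqI[where f = ?f and g = ?g and U = ?U, OF M _ _ _ X])
    show "lin ?V ?U ?f" "lin ?V ?U ?g"
      unfolding tens3_def sw2_def by (assumption | rule rules)+
    show "?f (tens M N m n) = ?g (tens M N m n)" if "m \<in> carr M" "n \<in> carr N" for m n
      using that unfolding tens3_def sw2_def
      by (simp add: st tlift_tens[where U = ?U] tlift_tlift[where U = ?U]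
          coassoc_sum[where U = ?U] rules cong: tlift_cong)
  qed
  let ?f = "\<lambda>X. tlift ?V H (\<lambda>Z h. scl ?V (counit H h) Z) (?r X)"
  show "?f X = X" if X: "X \<in> carr ?V" for X
  proof (rule tensor_lin_eqI[where f = ?f and g = "\<lambda>X. X" and U = ?V, OF M _ _ _ X])
    show "lin ?V ?V ?f" "lin ?V ?V (\<lambda>X. X)" by (assumption | rule rules)+
    show "?f (tens M N m n) = tens M N m n" if "m \<in> carr M" "n \<in> carr N" for m n
      using that
      by (simp add: st tlift_tens[where U = ?V] tlift_tlift[where U = ?V]
          counit_sum[where U = ?V] rules cong: tlift_cong)
  qed
qed

end

lemma right_comodule_cong:
  assumes "right_comodule H M \<rho>" "\<And>m. m \<in> carr M \<Longrightarrow> \<rho>' m = \<rho> m"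
    "carr M' = carr M" "scl M' = scl M"
  shows "right_comodule H M' \<rho>'"
proof -
  interpret right_comodule H M \<rho> by fact
  have r: "\<rho> m \<in> carr (tensor_space M H)" if "m \<in> carr M" for m
    using lin_coaction that by (simp add: lin_def)
  have "right_comodule H M \<rho>'"
    by unfold_locales
      (use vspace_comod lin_coaction coaction_coassoc coaction_counit in
        \<open>simp_all add: assms(2) r lin_def vspace_mem cong: tlift_cong\<close>)
  then show ?thesis
    by (simp add: right_comodule_def tens3_def space_cong[OF assms(3,4)] assms(3,4))
qed

definition sum_coaction where
  "sum_coaction H V W \<rho> \<rho>' = (\<lambda>(P, Q).
     tlift V H (\<lambda>v h. tens (direct_sum V W) H (v, 0) h) (\<rho> P) +
     tlift W H (\<lambda>w h. tens (direct_sum V W) H (0, w) h) (\<rho>' Q))"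

text \<open>Each summand is embedded linearly, so the axioms are inherited from the two summands.\<close>

lemma right_comodule_direct_sum:
  assumes "hopf_algebra H" "right_comodule H V \<rho>" "right_comodule H W \<rho>'"
  shows "right_comodule H (direct_sum V W) (sum_coaction H V W \<rho> \<rho>')"
proof
  interpret V: hopf_right_comodule H V \<rho>
    using assms by (simp add: hopf_right_comodule_def)
  interpret W: hopf_right_comodule H W \<rho>'
    using assms by (simp add: hopf_right_comodule_def)
  let ?S = "direct_sum V W" and ?r = "sum_coaction H V W \<rho> \<rho>'"
  note zero = lin_0[OF V.N.vspace_comod V.N.lin_coaction] lin_0[OF W.N.vspace_comod W.N.lin_coaction]
  show S: "vspace ?S" by (rule mlin)+
  show l: "lin ?S (tensor_space ?S H) ?r"
    unfolding sum_coaction_def by (assumption | rule mlin)+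
  note rules = mlin lin_rules[OF l]
  let ?U = "tensor_space ?S (tensor_space H H)"
  have r0: "?r (P, 0) = tlift V H (\<lambda>v h. tens ?S H (v, 0) h) (\<rho> P)" if "P \<in> carr V" for P
    unfolding sum_coaction_def
    by (simp add: zero tlift_arg_zero[where U = "tensor_space ?S H"] mlin)
  have r1: "?r (0, Q) = tlift W H (\<lambda>w h. tens ?S H (0, w) h) (\<rho>' Q)" if "Q \<in> carr W" for Q
    unfolding sum_coaction_def
    by (simp add: zero tlift_arg_zero[where U = "tensor_space ?S H"] mlin)
  fix X assume X: "X \<in> carr ?S"
  then obtain P Q where X: "X = (P, Q)" "P \<in> carr V" "Q \<in> carr W" by (rule direct_sum_memE)
  have PQ: "(P, Q) = (P, 0) + (0, Q)" by simp
  have r: "?r (P, Q) = ?r (P, 0) + ?r (0, Q)"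
    unfolding PQ by (rule lin_add_apply[OF l]) (rule mlin X)+
  show "tlift ?S H (\<lambda>Y h2. tlift ?S H (\<lambda>Z h1. tens3 ?S H H Z h1 h2) (?r Y)) (?r X) =
      tlift ?S H (\<lambda>Z h. sw2 H (\<lambda>h1 h2. tens3 ?S H H Z h1 h2) h) (?r X)"
    unfolding tens3_def sw2_def X(1) r using X(2,3)
    by (simp add: r0 r1 tlift_arg_add[where U = ?U] tlift_tens[where U = ?U]
        tlift_tlift[where U = ?U] V.coassoc_sum[where U = ?U] W.coassoc_sum[where U = ?U]
        rules cong: tlift_cong)
  show "tlift ?S H (\<lambda>Z h. scl ?S (counit H h) Z) (?r X) = X"
    unfolding X(1) r using X(2,3)
    by (simp add: r0 r1 tlift_arg_add[where U = ?S] tlift_tens[where U = ?S]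
        tlift_tlift[where U = ?S] V.counit_sum[where U = ?S] W.counit_sum[where U = ?S]
        rules cong: tlift_cong)
qed

section \<open>Associativity of the coefficients\<close>

context hopf_algebra
begin

sublocale regular: hopf_left_comodule H H "comul H"
  by unfold_locales

lemma right_comodule_comul: "right_comodule H H (comul H)"
  using lin_comul coassoc counit_right
  by unfold_locales (auto simp: sw2_def mlin)

sublocale regular_right: hopf_right_comodule H H "comul H"
  using right_comodule_comul by (simp add: hopf_right_comodule_def hopf_algebra_axioms)

end

locale convolution = hopf_algebra H + E: k_algebra E
  for H :: "('k::field, 'h::ab_group_add) hopf"
    and E :: "('k, 'e::ab_group_add, 'z) alg_scheme"
begin

text \<open>The convolution product of bilinear maps \<open>H \<otimes> H \<rightarrow> E\<close>.  It turns the identities between the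
  coefficients into identities in an associative algebra.\<close>

definition conv (infixr \<open>\<circledast>\<close> 70) where
  "(f \<circledast> f') g h = tlift H H (\<lambda>g1 g2. tlift H H (\<lambda>h1 h2. f g1 h1 \<cdot>\<^bsub>E\<^esub> f' g2 h2)
     (comul H h)) (comul H g)"

lemma bilin_conv:
  assumes "bilin H H E f" "bilin H H E f'"
  shows "bilin H H E (f \<circledast> f')"
  unfolding conv_def by (assumption | rule mlin bilin_rules[OF assms(1)] bilin_rules[OF assms(2)])+

lemma conv_cong:
  assumes "\<And>g h. g \<in> carr H \<Longrightarrow> h \<in> carr H \<Longrightarrow> a g h = a' g h"
    and "\<And>g h. g \<in> carr H \<Longrightarrow> h \<in> carr H \<Longrightarrow> b g h = b' g h"
    and "g \<in> carr H" "h \<in> carr H"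
  shows "(a \<circledast> b) g h = (a' \<circledast> b') g h"
  using assms unfolding conv_def by (simp add: mlin cong: tlift_cong)

text \<open>Coassociativity in both arguments.\<close>

lemma conv_assoc:
  assumes f: "bilin H H E f1" "bilin H H E f2" "bilin H H E f3" and gh: "g \<in> carr H" "h \<in> carr H"
  shows "((f1 \<circledast> f2) \<circledast> f3) g h = (f1 \<circledast> f2 \<circledast> f3) g h"
  using gh
  by (simp add: conv_def E.alg_push tlift_swap[where X = "comul H h"] E.mul_assoc mlin
      bilin_rules[OF f(1)] bilin_rules[OF f(2)] bilin_rules[OF f(3)]
      regular.coassoc_sum[where U = E] cong: tlift_cong)

end

locale measured_algebra = convolution H E
  for H :: "('k::field, 'h::ab_group_add) hopf"
    and E :: "('k, 'e::ab_group_add, 'z) alg_scheme" +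
  fixes \<alpha> :: "'h \<Rightarrow> 'e \<Rightarrow> 'e"
    and \<sigma> :: "'h \<Rightarrow> 'h \<Rightarrow> 'e"
  assumes bilin_\<alpha>: "bilin H E E \<alpha>"
    and bilin_\<sigma>: "bilin H H E \<sigma>"
    and \<alpha>_mul: "\<lbrakk>h \<in> carr H; a \<in> carr E; b \<in> carr E\<rbrakk> \<Longrightarrow>
      \<alpha> h (a \<cdot>\<^bsub>E\<^esub> b) = tlift H H (\<lambda>h1 h2. \<alpha> h1 a \<cdot>\<^bsub>E\<^esub> \<alpha> h2 b) (comul H h)"
begin

lemmas coeff_act_rules [mlin] = bilin_rules[OF bilin_\<alpha>] bilin_rules[OF bilin_\<sigma>]
lemmas coeff_act_push = bilin_push[OF bilin_\<alpha>] bilin_push[OF bilin_\<sigma>]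

text \<open>The twisted module condition with \<open>\<sigma>\<^sup>-\<^sup>1\<close> moved to the other side, which makes it an identity
  between convolution products.\<close>

definition twisted :: "'e \<Rightarrow> bool" where
  "twisted a \<longleftrightarrow> (\<forall>g\<in>carr H. \<forall>h\<in>carr H.
     ((\<lambda>g h. \<alpha> g (\<alpha> h a)) \<circledast> \<sigma>) g h = (\<sigma> \<circledast> (\<lambda>g h. \<alpha> (g \<cdot>\<^bsub>H\<^esub> h) a)) g h)"

lemma bilin_acts:
  assumes "a \<in> carr E"
  shows "bilin H H E (\<lambda>g h. \<alpha> g (\<alpha> h a))" "bilin H H E (\<lambda>g h. \<alpha> (g \<cdot>\<^bsub>H\<^esub> h) a)"
  using assms by (simp_all add: mlin)

text \<open>Both \<open>(g, h) \<mapsto> g \<cdot> (h \<cdot> a)\<close> and \<open>(g, h) \<mapsto> gh \<cdot> a\<close> carry products in \<open>a\<close> to convolution products,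
  and \<open>\<sigma>\<close> can be moved past the factors one at a time.\<close>

lemma twisted_mul:
  assumes a: "a \<in> carr E" "twisted a" and b: "b \<in> carr E" "twisted b"
  shows "twisted (a \<cdot>\<^bsub>E\<^esub> b)"
  unfolding twisted_def
proof (intro ballI)
  fix g h assume gh: "g \<in> carr H" "h \<in> carr H"
  note ba = bilin_acts[OF a(1)] and bb = bilin_acts[OF b(1)] and bs = bilin_\<sigma>
  let ?D = "\<lambda>a g h. \<alpha> g (\<alpha> h a)" and ?A = "\<lambda>a g h. \<alpha> (g \<cdot>\<^bsub>H\<^esub> h) a"
  have D: "?D (a \<cdot>\<^bsub>E\<^esub> b) g h = (?D a \<circledast> ?D b) g h"
    and A: "?A (a \<cdot>\<^bsub>E\<^esub> b) g h = (?A a \<circledast> ?A b) g h" if "g \<in> carr H" "h \<in> carr H" for g h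
    using that a(1) b(1)
    by (simp_all add: conv_def \<alpha>_mul coeff_act_push tlift_swap[where X = "comul H h"] comul_mul
        tlift_tlift[where U = E] tlift_tens[where U = E] mlin cong: tlift_cong)
  have "(?D (a \<cdot>\<^bsub>E\<^esub> b) \<circledast> \<sigma>) g h = ((?D a \<circledast> ?D b) \<circledast> \<sigma>) g h"
    by (rule conv_cong) (simp_all add: D gh)
  also have "\<dots> = (?D a \<circledast> ?D b \<circledast> \<sigma>) g h" by (rule conv_assoc) (rule ba bb bs gh)+
  also have "\<dots> = (?D a \<circledast> \<sigma> \<circledast> ?A b) g h"
    by (rule conv_cong) (use b(2) gh in \<open>simp_all add: twisted_def\<close>)
  also have "\<dots> = ((?D a \<circledast> \<sigma>) \<circledast> ?A b) g h"
    by (rule conv_assoc[symmetric]) (rule ba bb bs gh)+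
  also have "\<dots> = ((\<sigma> \<circledast> ?A a) \<circledast> ?A b) g h"
    by (rule conv_cong) (use a(2) gh in \<open>simp_all add: twisted_def\<close>)
  also have "\<dots> = (\<sigma> \<circledast> ?A a \<circledast> ?A b) g h" by (rule conv_assoc) (rule ba bb bs gh)+
  also have "\<dots> = (\<sigma> \<circledast> ?A (a \<cdot>\<^bsub>E\<^esub> b)) g h"
    by (rule conv_cong) (simp_all add: A gh)
  finally show "(?D (a \<cdot>\<^bsub>E\<^esub> b) \<circledast> \<sigma>) g h = (\<sigma> \<circledast> ?A (a \<cdot>\<^bsub>E\<^esub> b)) g h" .
qed

end

locale twisted_coefficients = measured_algebra H E \<alpha> \<sigma>
  for H :: "('k::field, 'h::ab_group_add) hopf"
    and E :: "('k, 'e::ab_group_add, 'z) alg_scheme" and \<alpha> \<sigma> +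
  assumes \<alpha>_\<alpha>: "a \<in> carr E \<Longrightarrow> twisted a"
    and cocycle: "\<lbrakk>g \<in> carr H; h \<in> carr H; k \<in> carr H\<rbrakk> \<Longrightarrow>
      tlift H H (\<lambda>g1 g2. tlift H H (\<lambda>h1 h2. tlift H H (\<lambda>k1 k2.
        \<alpha> g1 (\<sigma> h1 k1) \<cdot>\<^bsub>E\<^esub> \<sigma> g2 (h2 \<cdot>\<^bsub>H\<^esub> k2)) (comul H k)) (comul H h)) (comul H g) =
      (\<sigma> \<circledast> (\<lambda>g h. \<sigma> (g \<cdot>\<^bsub>H\<^esub> h) k)) g h"
begin

definition coeff where
  "coeff a b g h = tlift H H (\<lambda>g1 g2. a \<cdot>\<^bsub>E\<^esub> \<alpha> g1 b \<cdot>\<^bsub>E\<^esub> \<sigma> g2 h) (comul H g)"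

sublocale coefficient_product H E E E coeff
  unfolding coeff_def by unfold_locales (assumption | rule mlin)+

text \<open>Write \<open>A(g, h) = gh \<cdot> c\<close>, \<open>D(g, h) = g \<cdot> (h \<cdot> c)\<close> and \<open>S(g, h) = \<sigma>(gh, k)\<close>.  After splitting off
  \<open>a (g\<^sub>1 \<cdot> b)\<close> the left-hand side is \<open>\<sigma> \<circledast> A \<circledast> S\<close>, which equals \<open>D \<circledast> \<sigma> \<circledast> S\<close> because \<open>c\<close> is twisted.  By the
  cocycle identity \<open>\<sigma> \<circledast> S\<close> is \<open>\<Sum> (g\<^sub>1 \<cdot> \<sigma>(h\<^sub>1, k\<^sub>1)) \<sigma>(g\<^sub>2, h\<^sub>2k\<^sub>2)\<close>, and then the action of \<open>g\<close> can be taken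
  out of the product of \<open>h\<^sub>1 \<cdot> c\<close> and \<open>\<sigma>(h\<^sub>2, k\<^sub>1)\<close>, which gives the right-hand side.\<close>

lemma coeff_assoc:
  assumes abc: "a \<in> carr E" "b \<in> carr E" "c \<in> carr E"
    and ghk: "g \<in> carr H" "h \<in> carr H" "k \<in> carr H"
  shows "tlift H H (\<lambda>g1 g2. tlift H H (\<lambda>h1 h2.
      coeff (coeff a b g1 h1) c (g2 \<cdot>\<^bsub>H\<^esub> h2) k) (comul H h)) (comul H g) =
    tlift H H (\<lambda>h1 h2. tlift H H (\<lambda>k1 k2.
      coeff a (coeff b c h1 k1) g (h2 \<cdot>\<^bsub>H\<^esub> k2)) (comul H k)) (comul H h)"
    (is "?L = ?R")
proof -
  define A where "A = (\<lambda>g h. \<alpha> (g \<cdot>\<^bsub>H\<^esub> h) c)"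
  define S where "S = (\<lambda>g h. \<sigma> (g \<cdot>\<^bsub>H\<^esub> h) k)"
  define D where "D = (\<lambda>g h. \<alpha> g (\<alpha> h c))"
  have bA: "bilin H H E A" and bS: "bilin H H E S" and bD: "bilin H H E D"
    unfolding A_def S_def D_def using abc ghk by (simp_all add: mlin)
  note b = bA bS bD bilin_\<sigma>
  note rules = mlin b[THEN bilin_rules(1)] b[THEN bilin_rules(2)] b[THEN bilin_rules(3)]
    bilin_conv[THEN bilin_rules(1)] bilin_conv[THEN bilin_rules(2)] bilin_conv[THEN bilin_rules(3)]
  have inner: "coeff u c (g \<cdot>\<^bsub>H\<^esub> h) k = u \<cdot>\<^bsub>E\<^esub> (A \<circledast> S) g h"
    if "u \<in> carr E" "g \<in> carr H" "h \<in> carr H" for u g h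
    using that abc ghk unfolding coeff_def conv_def A_def S_def
    by (simp add: comul_mul tlift_tlift[where U = E] tlift_tens[where U = E] E.mul_assoc
        E.alg_push mlin cong: tlift_cong)
  define Z where "Z = (\<lambda>h k. tlift H H (\<lambda>h1 h2. \<alpha> h1 c \<cdot>\<^bsub>E\<^esub> \<sigma> h2 k) (comul H h))"
  have Z: "bilin H H E Z"
    unfolding Z_def using abc by (simp add: mlin)
  note rules = rules bilin_rules[OF Z]
  have coeff_Z: "coeff b c g h = b \<cdot>\<^bsub>E\<^esub> Z g h" if "g \<in> carr H" "h \<in> carr H" for g h
    using that abc by (simp add: coeff_def Z_def E.mul_assoc E.alg_push mlin cong: tlift_cong)
  \<comment> \<open>the right-hand side with \<open>a (g\<^sub>1 \<cdot> b)\<close> split off; \<open>x\<close>, \<open>y\<close> stand for \<open>g\<^sub>2\<close>, \<open>g\<^sub>3\<close>\<close>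
  define W where "W = (\<lambda>x y. tlift H H (\<lambda>h1 h2. tlift H H (\<lambda>k1 k2.
    \<alpha> x (Z h1 k1) \<cdot>\<^bsub>E\<^esub> \<sigma> y (h2 \<cdot>\<^bsub>H\<^esub> k2)) (comul H k)) (comul H h))"
  have W: "W x y = tlift H H (\<lambda>x1 x2. tlift H H (\<lambda>h' h3. tlift H H (\<lambda>h1 h2. tlift H H (\<lambda>k1 k2.
      \<alpha> x1 (\<alpha> h1 c) \<cdot>\<^bsub>E\<^esub> (\<alpha> x2 (\<sigma> h2 k1) \<cdot>\<^bsub>E\<^esub> \<sigma> y (h3 \<cdot>\<^bsub>H\<^esub> k2))) (comul H k))
      (comul H h')) (comul H h)) (comul H x)" if "x \<in> carr H" "y \<in> carr H" for x y
    using that abc ghk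
    by (simp add: W_def Z_def \<alpha>_mul E.mul_assoc E.alg_push coeff_act_push
        tlift_swap[where Y = "comul H x"] tlift_swap[where X = "comul H k"]
        rules cong: tlift_cong)
  have D_C: "(D \<circledast> (\<lambda>g h. tlift H H (\<lambda>g1 g2. tlift H H (\<lambda>h1 h2. tlift H H (\<lambda>k1 k2.
        \<alpha> g1 (\<sigma> h1 k1) \<cdot>\<^bsub>E\<^esub> \<sigma> g2 (h2 \<cdot>\<^bsub>H\<^esub> k2)) (comul H k)) (comul H h)) (comul H g))) g' h =
      tlift H H (\<lambda>x y. W x y) (comul H g')" if "g' \<in> carr H" for g'
    using that abc ghk
    by (simp add: W D_def conv_def E.alg_push tlift_swap[where X = "comul H h"]
        regular.coassoc_sum[where U = E] mlin cong: tlift_cong)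
  have "?L = tlift H H (\<lambda>g1 g2. a \<cdot>\<^bsub>E\<^esub> \<alpha> g1 b \<cdot>\<^bsub>E\<^esub> (\<sigma> \<circledast> A \<circledast> S) g2 h) (comul H g)"
    using abc ghk b
    by (simp add: inner coeff_def[of a b] conv_def[of \<sigma>] E.mul_assoc E.alg_push
        tlift_swap[where X = "comul H h"]
        regular.coassoc_sum[where U = E] rules cong: tlift_cong)
  also have "\<dots> = tlift H H (\<lambda>g1 g2. a \<cdot>\<^bsub>E\<^esub> \<alpha> g1 b \<cdot>\<^bsub>E\<^esub> (D \<circledast> \<sigma> \<circledast> S) g2 h) (comul H g)"
  proof -
    have "(\<sigma> \<circledast> A \<circledast> S) g' h = (D \<circledast> \<sigma> \<circledast> S) g' h" if g': "g' \<in> carr H" for g'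
    proof -
      have "(\<sigma> \<circledast> A \<circledast> S) g' h = ((\<sigma> \<circledast> A) \<circledast> S) g' h"
        by (rule conv_assoc[symmetric]) (rule b g' ghk)+
      also have "\<dots> = ((D \<circledast> \<sigma>) \<circledast> S) g' h"
        by (rule conv_cong) (use \<alpha>_\<alpha>[OF abc(3)] in \<open>simp_all add: A_def D_def twisted_def ghk g'\<close>)
      also have "\<dots> = (D \<circledast> \<sigma> \<circledast> S) g' h"
        by (rule conv_assoc) (rule b g' ghk)+
      finally show ?thesis .
    qed
    then show ?thesis by (intro tlift_cong) (simp_all add: mlin ghk)
  qed
  also have "\<dots> = tlift H H (\<lambda>g1 g2. a \<cdot>\<^bsub>E\<^esub> \<alpha> g1 b \<cdot>\<^bsub>E\<^esub> (D \<circledast> (\<lambda>g h.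
      tlift H H (\<lambda>g1 g2. tlift H H (\<lambda>h1 h2. tlift H H (\<lambda>k1 k2.
        \<alpha> g1 (\<sigma> h1 k1) \<cdot>\<^bsub>E\<^esub> \<sigma> g2 (h2 \<cdot>\<^bsub>H\<^esub> k2)) (comul H k)) (comul H h)) (comul H g))) g2 h) (comul H g)"
    by (intro tlift_cong arg_cong2[where f = "mul E"] conv_cong)
      (simp_all add: cocycle S_def mlin ghk)
  also have "\<dots> = tlift H H (\<lambda>g1 g2. a \<cdot>\<^bsub>E\<^esub> \<alpha> g1 b \<cdot>\<^bsub>E\<^esub>
      tlift H H (\<lambda>x y. W x y) (comul H g2)) (comul H g)"
    by (intro tlift_cong arg_cong2[where f = "mul E"] D_C) (simp_all add: mlin ghk)
  also have "\<dots> = tlift H H (\<lambda>x y. tlift H H (\<lambda>h1 h2. tlift H H (\<lambda>k1 k2.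
      a \<cdot>\<^bsub>E\<^esub> \<alpha> x (b \<cdot>\<^bsub>E\<^esub> Z h1 k1) \<cdot>\<^bsub>E\<^esub> \<sigma> y (h2 \<cdot>\<^bsub>H\<^esub> k2)) (comul H k)) (comul H h)) (comul H g)"
  proof -
    have P: "tlift H H (\<lambda>h1 h2. tlift H H (\<lambda>k1 k2.
        a \<cdot>\<^bsub>E\<^esub> \<alpha> x (b \<cdot>\<^bsub>E\<^esub> Z h1 k1) \<cdot>\<^bsub>E\<^esub> \<sigma> y (h2 \<cdot>\<^bsub>H\<^esub> k2)) (comul H k)) (comul H h) =
      tlift H H (\<lambda>x1 x2. a \<cdot>\<^bsub>E\<^esub> \<alpha> x1 b \<cdot>\<^bsub>E\<^esub> W x2 y) (comul H x)" if "x \<in> carr H" "y \<in> carr H" for x y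
      using that abc ghk
      by (simp add: W_def \<alpha>_mul E.mul_assoc E.alg_push tlift_swap[where Y = "comul H x"]
          rules cong: tlift_cong)
    have "bilin H H E W"
      unfolding W_def using ghk by (simp add: rules)
    note W_rules = bilin_rules[OF this]
    show ?thesis
      using abc ghk by (simp add: P W_rules E.alg_push regular.coassoc_sum[where U = E] rules cong: tlift_cong)
  qed
  also have "\<dots> = ?R"
    using abc ghk
    by (simp add: coeff_Z coeff_def[of a] tlift_swap[where Y = "comul H g"] rules cong: tlift_cong)
  finally show ?thesis .
qed

end

section \<open>The square-zero extension by a bimodule\<close>

context bimodule
begin

lemmas bimod_rules [mlin] = vspace_bimod bilin_rules[OF bilin_lact] bilin_rules[OF bilin_ract]
lemmas bimod_push = bilin_push[OF bilin_lact] bilin_push[OF bilin_ract]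

lemma act_zero:
  "a \<in> carr A \<Longrightarrow> a \<rhd>\<^bsub>M\<^esub> 0 = 0" "a \<in> carr A \<Longrightarrow> 0 \<lhd>\<^bsub>M\<^esub> a = 0"
  "m \<in> carr M \<Longrightarrow> 0 \<rhd>\<^bsub>M\<^esub> m = 0" "m \<in> carr M \<Longrightarrow> m \<lhd>\<^bsub>M\<^esub> 0 = 0"
  using bilin_zero[OF bilin_lact] bilin_zero[OF bilin_ract] by (simp_all add: mlin)

lemma act_add:
  "\<lbrakk>a \<in> carr A; m \<in> carr M; m' \<in> carr M\<rbrakk> \<Longrightarrow> a \<rhd>\<^bsub>M\<^esub> (m + m') = (a \<rhd>\<^bsub>M\<^esub> m) + (a \<rhd>\<^bsub>M\<^esub> m')"
  "\<lbrakk>a \<in> carr A; m \<in> carr M; m' \<in> carr M\<rbrakk> \<Longrightarrow> (m + m') \<lhd>\<^bsub>M\<^esub> a = (m \<lhd>\<^bsub>M\<^esub> a) + (m' \<lhd>\<^bsub>M\<^esub> a)"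
  using bilin_lact bilin_ract by (auto simp: bilin_def lin_def)

end

text \<open>The product of two elements of \<open>M\<close> is zero.\<close>

definition trivial_extension ::
  "('k::field, 'b::ab_group_add, 'z) alg_scheme \<Rightarrow> ('k, 'b, 'm::ab_group_add) bimod \<Rightarrow> ('k, 'b \<times> 'm) alg" where
  "trivial_extension B M =
     \<lparr>carr = carr (direct_sum B M), scl = scl (direct_sum B M),
      mul = (\<lambda>(b, m) (b', m'). (b \<cdot>\<^bsub>B\<^esub> b', (b \<rhd>\<^bsub>M\<^esub> m') + (m \<lhd>\<^bsub>M\<^esub> b'))), unt = (\<one>\<^bsub>B\<^esub>, 0)\<rparr>"

lemma trivial_extension_simps:
  "carr (trivial_extension B M) = carr (direct_sum B M)"
  "scl (trivial_extension B M) = scl (direct_sum B M)"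
  "(b, m) \<cdot>\<^bsub>trivial_extension B M\<^esub> (b', m') = (b \<cdot>\<^bsub>B\<^esub> b', (b \<rhd>\<^bsub>M\<^esub> m') + (m \<lhd>\<^bsub>M\<^esub> b'))"
  "\<one>\<^bsub>trivial_extension B M\<^esub> = (\<one>\<^bsub>B\<^esub>, 0)"
  "vspace (trivial_extension B M) = vspace (direct_sum B M)"
  "lin S (trivial_extension B M) f = lin S (direct_sum B M) f"
  "lin (trivial_extension B M) S f' = lin (direct_sum B M) S f'"
  by (simp_all add: trivial_extension_def vspace_def lin_def)

lemma trivial_mul_eq:
  "x \<cdot>\<^bsub>trivial_extension B M\<^esub> y =
    (fst x \<cdot>\<^bsub>B\<^esub> fst y, (fst x \<rhd>\<^bsub>M\<^esub> snd y) + (snd x \<lhd>\<^bsub>M\<^esub> fst y))"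
  by (simp add: trivial_extension_def case_prod_unfold)

lemma (in bimodule) k_algebra_trivial_extension: "k_algebra (trivial_extension A M)"
proof
  note [simp] = trivial_extension_simps
  show "vspace (trivial_extension A M)" by (simp add: mlin)
  show "\<one>\<^bsub>trivial_extension A M\<^esub> \<in> carr (trivial_extension A M)" by (simp add: mlin)
  show "bilin (trivial_extension A M) (trivial_extension A M) (trivial_extension A M)
      (mul (trivial_extension A M))"
    by (rule bilinI)
      (simp_all add: trivial_mul_eq
        direct_sum_components[where V = A and W = M] mlin)
  fix x y z assume "x \<in> carr (trivial_extension A M)" "y \<in> carr (trivial_extension A M)" "z \<in> carr (trivial_extension A M)"
  then show "(x \<cdot>\<^bsub>trivial_extension A M\<^esub> y) \<cdot>\<^bsub>trivial_extension A M\<^esub> z =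
      x \<cdot>\<^bsub>trivial_extension A M\<^esub> (y \<cdot>\<^bsub>trivial_extension A M\<^esub> z)"
   by (auto elim!: direct_sum_memE simp: mul_assoc lact_mul ract_mul lact_ract act_add mlin algebra_simps)
next
  fix x assume "x \<in> carr (trivial_extension A M)"
  then show "\<one>\<^bsub>trivial_extension A M\<^esub> \<cdot>\<^bsub>trivial_extension A M\<^esub> x = x"
    "x \<cdot>\<^bsub>trivial_extension A M\<^esub> \<one>\<^bsub>trivial_extension A M\<^esub> = x"
    by (auto elim!: direct_sum_memE simp: trivial_extension_simps mul_unt_left mul_unt_right act_zero lact_unt ract_unt mlin)
qed

section \<open>Differential forms on a twisted module algebra\<close>

context fodc
begin

lemmas d_rules [mlin] = lin_rules[OF lin_d]
lemmas d_push = lin_tlift_apply[OF lin_d]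

text \<open>The spanning condition as an induction principle; scalars are kept as a separate case so that it
  applies to any subspace.\<close>

lemma forms_induct [consumes 1, case_names zero add scale exact]:
  assumes x: "x \<in> carr \<Omega>"
    and zero: "P 0"
    and add: "\<And>x y. \<lbrakk>x \<in> carr \<Omega>; P x; y \<in> carr \<Omega>; P y\<rbrakk> \<Longrightarrow> P (x + y)"
    and scale: "\<And>c x. \<lbrakk>x \<in> carr \<Omega>; P x\<rbrakk> \<Longrightarrow> P (scl \<Omega> c x)"
    and exact: "\<And>a b. a \<in> carr A \<Longrightarrow> b \<in> carr A \<Longrightarrow> P (a \<rhd>\<^bsub>\<Omega>\<^esub> d b)"
  shows "P x"
proof -
  interpret vector_space "scl \<Omega>" using vspace_bimod by (simp add: vspace_def)
  have "x \<in> carr \<Omega> \<and> P x"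
  proof (rule span_induct[where x = x and P = "\<lambda>x. x \<in> carr \<Omega> \<and> P x"])
    show "x \<in> span {a \<rhd>\<^bsub>\<Omega>\<^esub> d b |a b. a \<in> carr A \<and> b \<in> carr A}" using x spanned by simp
    show "subspace {x. x \<in> carr \<Omega> \<and> P x}"
      using zero add scale by (auto simp: subspace_def vspace_mem[OF vspace_bimod])
    show "x \<in> carr \<Omega> \<and> P x"
      if "x \<in> {a \<rhd>\<^bsub>\<Omega>\<^esub> d b |a b. a \<in> carr A \<and> b \<in> carr A}" for x
      using that exact by (auto simp: mlin)
  qed
  then show ?thesis by simp
qed

lemma forms_lin_eqI:
  assumes f: "lin \<Omega> U f" and g: "lin \<Omega> U g"
    and eq: "\<And>a b. a \<in> carr A \<Longrightarrow> b \<in> carr A \<Longrightarrow> f (a \<rhd>\<^bsub>\<Omega>\<^esub> d b) = g (a \<rhd>\<^bsub>\<Omega>\<^esub> d b)"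
    and x: "x \<in> carr \<Omega>"
  shows "f x = g x"
  using x
proof (induction rule: forms_induct)
  case zero
  then show ?case using lin_0[OF vspace_bimod f] lin_0[OF vspace_bimod g] by simp
qed (use f g eq in \<open>auto simp: lin_def\<close>)

lemma forms_lin_mem:
  assumes f: "lin \<Omega> U f" and U': "vspace U'" "scl U' = scl U"
    and exact: "\<And>a b. a \<in> carr A \<Longrightarrow> b \<in> carr A \<Longrightarrow> f (a \<rhd>\<^bsub>\<Omega>\<^esub> d b) \<in> carr U'"
    and x: "x \<in> carr \<Omega>"
  shows "f x \<in> carr U'"
  using x
proof (induction rule: forms_induct)
  case zero
  then show ?case using lin_0[OF vspace_bimod f] vspace_mem(1)[OF U'(1)] by simp
next
  case (scale c x)
  then show ?case
    using lin_scl_apply[OF f] vspace_mem(3)[OF U'(1), of "f x" c] U'(2) by simp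
qed (use exact lin_add_apply[OF f] vspace_mem(2)[OF U'(1)] in auto)

lemma d_unt: "d \<one>\<^bsub>A\<^esub> = 0"
  using leibniz[of "\<one>\<^bsub>A\<^esub>" "\<one>\<^bsub>A\<^esub>"] by (simp add: mlin mul_unt_left lact_unt ract_unt)

end

context twisted_module_algebra
begin

lemmas act_rules [mlin] = bilin_rules[OF bilin_act] bilin_rules[OF bilin_\<sigma>] bilin_rules[OF bilin_\<sigma>inv]
sublocale BC: measured_algebra H B act \<sigma>
  using bilin_act bilin_\<sigma> act_mul by unfold_locales (simp_all add: sw2_def)

notation BC.conv (infixr \<open>\<circledast>\<close> 70)

text \<open>By definition \<open>g \<cdot> (h \<cdot> b)\<close> is the convolution \<open>\<sigma> \<circledast> (gh \<cdot> b) \<circledast> \<sigma>\<^sup>-\<^sup>1\<close>; multiply by \<open>\<sigma>\<close> on the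
  right.\<close>

lemma twisted_base:
  assumes b: "b \<in> carr B"
  shows "BC.twisted b"
  unfolding BC.twisted_def
proof (intro ballI)
  fix g h assume gh: "g \<in> carr H" "h \<in> carr H"
  let ?D = "\<lambda>g h. act g (act h b)" and ?A = "\<lambda>g h. act (g \<cdot>\<^bsub>H\<^esub> h) b"
  note bb = BC.bilin_acts[OF b] and bs = bilin_\<sigma> bilin_\<sigma>inv
  note bc = BC.bilin_conv[OF bb(2) bilin_\<sigma>inv]
  have D: "?D g h = (\<sigma> \<circledast> ?A \<circledast> \<sigma>inv) g h" if "g \<in> carr H" "h \<in> carr H" for g h
    using that b
    by (simp add: act_act sw3_def sw2_def BC.conv_def B.alg_push B.mul_assoc
        tlift_swap[where X = "comul H h"] mlin cong: tlift_cong)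
  have "(?D \<circledast> \<sigma>) g h = ((\<sigma> \<circledast> ?A \<circledast> \<sigma>inv) \<circledast> \<sigma>) g h"
    by (rule BC.conv_cong) (simp_all add: D gh)
  also have "\<dots> = (\<sigma> \<circledast> (?A \<circledast> \<sigma>inv) \<circledast> \<sigma>) g h" by (rule BC.conv_assoc) (rule bc bs gh)+
  also have "\<dots> = (\<sigma> \<circledast> ?A \<circledast> \<sigma>inv \<circledast> \<sigma>) g h"
    by (rule BC.conv_cong[OF refl BC.conv_assoc]) (assumption | rule bb bs gh)+
  also have "\<dots> = (\<sigma> \<circledast> ?A) g h"
  proof (rule BC.conv_cong[OF refl _ gh])
    fix g h assume gh: "g \<in> carr H" "h \<in> carr H"
    have "(?A \<circledast> \<sigma>inv \<circledast> \<sigma>) g h =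
        (?A \<circledast> (\<lambda>g h. scl B (counit H h) (scl B (counit H g) \<one>\<^bsub>B\<^esub>))) g h"
      using \<sigma>inv_\<sigma> by (intro BC.conv_cong refl gh)
        (simp add: BC.conv_def sw2_def vspace_scl(3)[OF B.vspace_alg] mult.commute)
    also have "\<dots> = ?A g h"
      using b gh
      by (simp add: BC.conv_def H.regular_right.counit_sum[where U = B]
         lin_scl_apply[OF B.bilin_mul[unfolded bilin_def, THEN conjunct1, rule_format]]
         B.mul_unt_right mlin cong: tlift_cong)
    finally show "(?A \<circledast> \<sigma>inv \<circledast> \<sigma>) g h = ?A g h" .
  qed
  finally show "(?D \<circledast> \<sigma>) g h = (\<sigma> \<circledast> ?A) g h" .
qed

end

context twisted_module_fodc
begin

lemmas act\<Omega>_rules [mlin] = bilin_rules[OF bilin_act\<Omega>]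
text \<open>On \<open>\<beta> = a dc\<close> the form \<open>b \<beta> = (ba) dc\<close> is again of the kind for which the rule is an axiom.\<close>

lemma act\<Omega>_lact:
  assumes "h \<in> carr H" "b \<in> carr B" "\<beta> \<in> carr \<Omega>"
  shows "act\<Omega> h (b \<rhd>\<^bsub>\<Omega>\<^esub> \<beta>) = tlift H H (\<lambda>h1 h2. act h1 b \<rhd>\<^bsub>\<Omega>\<^esub> act\<Omega> h2 \<beta>) (comul H h)"
proof (rule \<Omega>.forms_lin_eqI[where U = \<Omega> and f = "\<lambda>\<beta>. act\<Omega> h (b \<rhd>\<^bsub>\<Omega>\<^esub> \<beta>)"
      and g = "\<lambda>\<beta>. tlift H H (\<lambda>h1 h2. act h1 b \<rhd>\<^bsub>\<Omega>\<^esub> act\<Omega> h2 \<beta>) (comul H h)"])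
  show "lin \<Omega> \<Omega> (\<lambda>\<beta>. act\<Omega> h (b \<rhd>\<^bsub>\<Omega>\<^esub> \<beta>))"
    "lin \<Omega> \<Omega> (\<lambda>\<beta>. tlift H H (\<lambda>h1 h2. act h1 b \<rhd>\<^bsub>\<Omega>\<^esub> act\<Omega> h2 \<beta>) (comul H h))"
    using assms by (simp_all add: mlin)
  show "act\<Omega> h (b \<rhd>\<^bsub>\<Omega>\<^esub> a \<rhd>\<^bsub>\<Omega>\<^esub> d c) =
      tlift H H (\<lambda>h1 h2. act h1 b \<rhd>\<^bsub>\<Omega>\<^esub> act\<Omega> h2 (a \<rhd>\<^bsub>\<Omega>\<^esub> d c)) (comul H h)"
    if ac: "a \<in> carr B" "c \<in> carr B" for a c
  proof -
    have "act\<Omega> h (b \<rhd>\<^bsub>\<Omega>\<^esub> a \<rhd>\<^bsub>\<Omega>\<^esub> d c) = act\<Omega> h ((b \<cdot>\<^bsub>B\<^esub> a) \<rhd>\<^bsub>\<Omega>\<^esub> d c)"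
      using ac assms by (simp add: \<Omega>.lact_mul mlin)
    also have "\<dots> = tlift H H (\<lambda>h1 h2. act h1 (b \<cdot>\<^bsub>B\<^esub> a) \<rhd>\<^bsub>\<Omega>\<^esub> act\<Omega> h2 (d c)) (comul H h)"
      using ac assms by (simp add: act\<Omega>_lact_d sw2_def mlin)
    also have "\<dots> = tlift H H (\<lambda>h1 h2. act h1 b \<rhd>\<^bsub>\<Omega>\<^esub> act\<Omega> h2 (a \<rhd>\<^bsub>\<Omega>\<^esub> d c)) (comul H h)"
      using ac assms
      by (simp add: act\<Omega>_lact_d act_mul sw2_def \<Omega>.lact_mul \<Omega>.bimod_push
          H.regular.coassoc_sum[where U = \<Omega>] mlin cong: tlift_cong)
    finally show ?thesis .
  qed
qed fact

text \<open>For \<open>\<beta> = dc\<close> this is the image under \<open>d\<close> of the rule for \<open>h \<cdot> (cb)\<close>, less the left rule for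
  \<open>c db\<close>; left multiplication gives the general case.\<close>

lemma act\<Omega>_ract:
  assumes "h \<in> carr H" "b \<in> carr B" "\<beta> \<in> carr \<Omega>"
  shows "act\<Omega> h (\<beta> \<lhd>\<^bsub>\<Omega>\<^esub> b) = tlift H H (\<lambda>h1 h2. act\<Omega> h1 \<beta> \<lhd>\<^bsub>\<Omega>\<^esub> act h2 b) (comul H h)"
proof (rule \<Omega>.forms_lin_eqI[where U = \<Omega> and f = "\<lambda>\<beta>. act\<Omega> h (\<beta> \<lhd>\<^bsub>\<Omega>\<^esub> b)"
      and g = "\<lambda>\<beta>. tlift H H (\<lambda>h1 h2. act\<Omega> h1 \<beta> \<lhd>\<^bsub>\<Omega>\<^esub> act h2 b) (comul H h)"])
  show "lin \<Omega> \<Omega> (\<lambda>\<beta>. act\<Omega> h (\<beta> \<lhd>\<^bsub>\<Omega>\<^esub> b))"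
    "lin \<Omega> \<Omega> (\<lambda>\<beta>. tlift H H (\<lambda>h1 h2. act\<Omega> h1 \<beta> \<lhd>\<^bsub>\<Omega>\<^esub> act h2 b) (comul H h))"
    using assms by (simp_all add: mlin)
  have exact: "act\<Omega> h (d c \<lhd>\<^bsub>\<Omega>\<^esub> b) =
      tlift H H (\<lambda>h1 h2. act\<Omega> h1 (d c) \<lhd>\<^bsub>\<Omega>\<^esub> act h2 b) (comul H h)"
    if h: "h \<in> carr H" and c: "c \<in> carr B" for h c
  proof -
    have "act\<Omega> h (d (c \<cdot>\<^bsub>B\<^esub> b)) = act\<Omega> h (d c \<lhd>\<^bsub>\<Omega>\<^esub> b) + act\<Omega> h (c \<rhd>\<^bsub>\<Omega>\<^esub> d b)"
      using bilin_act\<Omega> c h assms by (simp add: \<Omega>.leibniz bilin_def lin_def mlin)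
    moreover have "act\<Omega> h (d (c \<cdot>\<^bsub>B\<^esub> b)) = d (act h (c \<cdot>\<^bsub>B\<^esub> b))"
      using c h assms by (simp add: d_act mlin)
    moreover have "d (act h (c \<cdot>\<^bsub>B\<^esub> b)) =
        tlift H H (\<lambda>h1 h2. act\<Omega> h1 (d c) \<lhd>\<^bsub>\<Omega>\<^esub> act h2 b) (comul H h) + act\<Omega> h (c \<rhd>\<^bsub>\<Omega>\<^esub> d b)"
      using c h assms
      by (simp add: act\<Omega>_lact act_mul sw2_def \<Omega>.d_push \<Omega>.leibniz d_act tlift_add
          mlin cong: tlift_cong)
    ultimately show ?thesis by simp
  qed
  show "act\<Omega> h ((a \<rhd>\<^bsub>\<Omega>\<^esub> d c) \<lhd>\<^bsub>\<Omega>\<^esub> b) =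
      tlift H H (\<lambda>h1 h2. act\<Omega> h1 (a \<rhd>\<^bsub>\<Omega>\<^esub> d c) \<lhd>\<^bsub>\<Omega>\<^esub> act h2 b) (comul H h)"
    if ac: "a \<in> carr B" "c \<in> carr B" for a c
    using ac assms
    by (simp add: \<Omega>.lact_ract act\<Omega>_lact exact \<Omega>.bimod_push
        H.regular.coassoc_sum[where U = \<Omega>] mlin cong: tlift_cong)
qed fact

section \<open>Coefficients in functions and forms\<close>

abbreviation "E \<equiv> trivial_extension B \<Omega>"

definition act_ext :: "'h \<Rightarrow> 'b \<times> 'm \<Rightarrow> 'b \<times> 'm" where
  "act_ext h x = (act h (fst x), act\<Omega> h (snd x))"

definition \<sigma>_ext :: "'h \<Rightarrow> 'h \<Rightarrow> 'b \<times> 'm" where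
  "\<sigma>_ext g h = (\<sigma> g h, 0)"

lemmas ext_simps = trivial_extension_simps act_ext_def \<sigma>_ext_def

lemma act\<Omega>_zero: "h \<in> carr H \<Longrightarrow> act\<Omega> h 0 = 0"
  using bilin_zero(2)[OF bilin_act\<Omega>] by (simp add: mlin)

lemma act_zero: "h \<in> carr H \<Longrightarrow> act h 0 = 0"
  using bilin_zero(2)[OF bilin_act] by (simp add: mlin)

lemma mul_zero: "b \<in> carr B \<Longrightarrow> b \<cdot>\<^bsub>B\<^esub> 0 = 0" "b \<in> carr B \<Longrightarrow> 0 \<cdot>\<^bsub>B\<^esub> b = 0"
  using bilin_zero[OF B.bilin_mul] by (simp_all add: mlin)

lemmas zero_simps = act\<Omega>_zero act_zero mul_zero \<Omega>.act_zero tlift_zero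

sublocale EC: measured_algebra H E act_ext \<sigma>_ext
proof -
  interpret k_algebra E by (rule \<Omega>.k_algebra_trivial_extension)
  show "measured_algebra H E act_ext \<sigma>_ext"
  proof
    show "bilin H E E act_ext"
      by (rule bilinI)
        (simp_all add: ext_simps direct_sum_components[where V = B and W = \<Omega>] mlin)
    show "bilin H H E \<sigma>_ext"
      by (rule bilinI) (simp_all add: ext_simps mlin)
    show "act_ext h (a \<cdot>\<^bsub>E\<^esub> b) =
        tlift H H (\<lambda>h1 h2. act_ext h1 a \<cdot>\<^bsub>E\<^esub> act_ext h2 b) (comul H h)"
      if "h \<in> carr H" "a \<in> carr E" "b \<in> carr E" for h a b
    proof -
      have "act\<Omega> h (x + y) = act\<Omega> h x + act\<Omega> h y" if "x \<in> carr \<Omega>" "y \<in> carr \<Omega>" for x y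
        using bilin_act\<Omega> that \<open>h \<in> carr H\<close> by (simp add: bilin_def lin_def)
      then show ?thesis
        using that
        by (auto elim!: direct_sum_memE simp: ext_simps tlift_Pair tlift_add act_mul sw2_def
            act\<Omega>_lact act\<Omega>_ract mlin)
    qed
  qed
qed

text \<open>The condition on an element of \<open>E\<close> splits into its components; on \<open>B\<close> it holds always.\<close>

lemma ext_twisted_iff:
  assumes "b \<in> carr B" "\<beta> \<in> carr \<Omega>"
  shows "EC.twisted (b, \<beta>) \<longleftrightarrow> (\<forall>g\<in>carr H. \<forall>h\<in>carr H.
      tlift H H (\<lambda>g1 g2. tlift H H (\<lambda>h1 h2. act\<Omega> g1 (act\<Omega> h1 \<beta>) \<lhd>\<^bsub>\<Omega>\<^esub> \<sigma> g2 h2) (comul H h)) (comul H g) =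
      tlift H H (\<lambda>g1 g2. tlift H H (\<lambda>h1 h2. \<sigma> g1 h1 \<rhd>\<^bsub>\<Omega>\<^esub> act\<Omega> (g2 \<cdot>\<^bsub>H\<^esub> h2) \<beta>) (comul H h)) (comul H g))"
  using assms twisted_base[OF assms(1)]
  by (simp add: EC.twisted_def BC.twisted_def EC.conv_def BC.conv_def ext_simps tlift_Pair
      zero_simps mlin cong: tlift_cong)

text \<open>Apply \<open>d\<close> to the identity on functions; \<open>d \<circ> \<sigma> = 0\<close> kills every term in which \<open>\<sigma>\<close> is differentiated.\<close>

lemma twisted_exact:
  assumes b: "b \<in> carr B" and gh: "g \<in> carr H" "h \<in> carr H"
  shows "tlift H H (\<lambda>g1 g2. tlift H H (\<lambda>h1 h2. act\<Omega> g1 (act\<Omega> h1 (d b)) \<lhd>\<^bsub>\<Omega>\<^esub> \<sigma> g2 h2) (comul H h)) (comul H g) =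
      tlift H H (\<lambda>g1 g2. tlift H H (\<lambda>h1 h2. \<sigma> g1 h1 \<rhd>\<^bsub>\<Omega>\<^esub> act\<Omega> (g2 \<cdot>\<^bsub>H\<^esub> h2) (d b)) (comul H h)) (comul H g)"
proof -
  have "d (((\<lambda>g h. act g (act h b)) \<circledast> \<sigma>) g h) = d ((\<sigma> \<circledast> (\<lambda>g h. act (g \<cdot>\<^bsub>H\<^esub> h) b)) g h)"
    using twisted_base[OF b] gh by (simp add: BC.twisted_def)
  then show ?thesis using b gh
    by (simp add: BC.conv_def \<Omega>.d_push \<Omega>.leibniz d_act d_\<sigma> zero_simps mlin cong: tlift_cong)
qed

lemma ext_twisted:
  assumes "x \<in> carr E"
  shows "EC.twisted x"
proof -
  obtain b \<beta> where x: "x = (b, \<beta>)" and b: "b \<in> carr B" and \<beta>: "\<beta> \<in> carr \<Omega>"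
    using assms unfolding ext_simps by (rule direct_sum_memE)
  have base: "EC.twisted (b, 0)" if "b \<in> carr B" for b
    using that by (simp add: ext_twisted_iff zero_simps mlin cong: tlift_cong)
  have exact: "EC.twisted (0, b \<rhd>\<^bsub>\<Omega>\<^esub> d c)" if "b \<in> carr B" "c \<in> carr B" for b c
  proof -
    have "EC.twisted (0, d c)"
      using that by (simp add: ext_twisted_iff twisted_exact mlin)
    \<comment> \<open>in \<open>E\<close> the form \<open>b dc\<close> is the product \<open>(b, 0) (0, dc)\<close>\<close>
    from EC.twisted_mul[OF _ base _ this, of b]
    show ?thesis using that by (simp add: ext_simps zero_simps mlin)
  qed
  show ?thesis unfolding x ext_twisted_iff[OF b \<beta>]
  proof (intro ballI)
    fix g h assume gh: "g \<in> carr H" "h \<in> carr H"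
    let ?f = "\<lambda>\<beta>. tlift H H (\<lambda>g1 g2. tlift H H (\<lambda>h1 h2. act\<Omega> g1 (act\<Omega> h1 \<beta>) \<lhd>\<^bsub>\<Omega>\<^esub> \<sigma> g2 h2) (comul H h)) (comul H g)"
    let ?g = "\<lambda>\<beta>. tlift H H (\<lambda>g1 g2. tlift H H (\<lambda>h1 h2. \<sigma> g1 h1 \<rhd>\<^bsub>\<Omega>\<^esub> act\<Omega> (g2 \<cdot>\<^bsub>H\<^esub> h2) \<beta>) (comul H h)) (comul H g)"
    show "?f \<beta> = ?g \<beta>"
    proof (rule \<Omega>.forms_lin_eqI[where f = ?f and g = ?g and U = \<Omega>])
      show "lin \<Omega> \<Omega> ?f" "lin \<Omega> \<Omega> ?g" using gh by (simp_all add: mlin)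
      show "?f (b \<rhd>\<^bsub>\<Omega>\<^esub> d c) = ?g (b \<rhd>\<^bsub>\<Omega>\<^esub> d c)" if "b \<in> carr B" "c \<in> carr B" for b c
        using exact[OF that] that gh by (simp add: ext_twisted_iff mlin)
    qed fact
  qed
qed

sublocale EC: twisted_coefficients H E act_ext \<sigma>_ext
proof
  show "EC.twisted a" if "a \<in> carr E" for a using that by (rule ext_twisted)
  show "tlift H H (\<lambda>g1 g2. tlift H H (\<lambda>h1 h2. tlift H H (\<lambda>k1 k2.
        act_ext g1 (\<sigma>_ext h1 k1) \<cdot>\<^bsub>E\<^esub> \<sigma>_ext g2 (h2 \<cdot>\<^bsub>H\<^esub> k2)) (comul H k)) (comul H h)) (comul H g) =
      EC.conv \<sigma>_ext (\<lambda>g h. \<sigma>_ext (g \<cdot>\<^bsub>H\<^esub> h) k) g h"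
    if "g \<in> carr H" "h \<in> carr H" "k \<in> carr H" for g h k
    using \<sigma>_cocycle[OF that] that
    by (simp add: EC.conv_def sw2_def ext_simps tlift_Pair zero_simps mlin cong: tlift_cong)
qed

lemma unt_act\<Omega>:
  assumes "\<beta> \<in> carr \<Omega>"
  shows "act\<Omega> \<one>\<^bsub>H\<^esub> \<beta> = \<beta>"
proof (rule \<Omega>.forms_lin_eqI[where f = "act\<Omega> \<one>\<^bsub>H\<^esub>" and g = "\<lambda>\<beta>. \<beta>" and U = \<Omega>])
  show "lin \<Omega> \<Omega> (act\<Omega> \<one>\<^bsub>H\<^esub>)" "lin \<Omega> \<Omega> (\<lambda>\<beta>. \<beta>)" by (simp_all add: mlin)
  show "act\<Omega> \<one>\<^bsub>H\<^esub> (b \<rhd>\<^bsub>\<Omega>\<^esub> d c) = b \<rhd>\<^bsub>\<Omega>\<^esub> d c" if "b \<in> carr B" "c \<in> carr B" for b c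
    using that
    by (simp add: act\<Omega>_lact_d sw2_def H.comul_unt tlift_tens[where U = \<Omega>] unt_act
        d_act[symmetric] mlin)
qed fact

text \<open>The components of the coefficient map of \<open>E\<close>: a product of two coefficients of which at most one is a
  form.\<close>

definition coeff_BB where
  "coeff_BB b b' g h = tlift H H (\<lambda>g1 g2. b \<cdot>\<^bsub>B\<^esub> act g1 b' \<cdot>\<^bsub>B\<^esub> \<sigma> g2 h) (comul H g)"

definition coeff_B\<Omega> where
  "coeff_B\<Omega> b \<beta> g h = tlift H H (\<lambda>g1 g2. (b \<rhd>\<^bsub>\<Omega>\<^esub> act\<Omega> g1 \<beta>) \<lhd>\<^bsub>\<Omega>\<^esub> \<sigma> g2 h) (comul H g)"

definition coeff_\<Omega>B where
  "coeff_\<Omega>B \<beta> b g h = tlift H H (\<lambda>g1 g2. \<beta> \<lhd>\<^bsub>\<Omega>\<^esub> act g1 b \<lhd>\<^bsub>\<Omega>\<^esub> \<sigma> g2 h) (comul H g)"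

lemma ext_coeff:
  assumes "b \<in> carr B" "b' \<in> carr B" "\<beta> \<in> carr \<Omega>" "\<beta>' \<in> carr \<Omega>" "g \<in> carr H" "h \<in> carr H"
  shows "EC.coeff (b, \<beta>) (b', \<beta>') g h =
    (coeff_BB b b' g h, coeff_B\<Omega> b \<beta>' g h + coeff_\<Omega>B \<beta> b' g h)"
  using assms
  by (simp add: EC.coeff_def coeff_BB_def coeff_B\<Omega>_def coeff_\<Omega>B_def ext_simps tlift_Pair
      tlift_add[symmetric] \<Omega>.act_add zero_simps mlin cong: tlift_cong)

sublocale BB: coefficient_product H B B B coeff_BB
  unfolding coeff_BB_def by unfold_locales (assumption | rule mlin)+

sublocale B\<Omega>: coefficient_product H B \<Omega> \<Omega> coeff_B\<Omega>
  unfolding coeff_B\<Omega>_def by unfold_locales (assumption | rule mlin)+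

sublocale \<Omega>B: coefficient_product H \<Omega> B \<Omega> coeff_\<Omega>B
  unfolding coeff_\<Omega>B_def by unfold_locales (assumption | rule mlin)+

lemma coeff_zero:
  "\<lbrakk>b \<in> carr B; g \<in> carr H; h \<in> carr H\<rbrakk> \<Longrightarrow> coeff_BB 0 b g h = 0"
  "\<lbrakk>b \<in> carr B; g \<in> carr H; h \<in> carr H\<rbrakk> \<Longrightarrow> coeff_BB b 0 g h = 0"
  "\<lbrakk>b \<in> carr B; g \<in> carr H; h \<in> carr H\<rbrakk> \<Longrightarrow> coeff_B\<Omega> b 0 g h = 0"
  "\<lbrakk>\<beta> \<in> carr \<Omega>; g \<in> carr H; h \<in> carr H\<rbrakk> \<Longrightarrow> coeff_B\<Omega> 0 \<beta> g h = 0"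
  "\<lbrakk>b \<in> carr B; g \<in> carr H; h \<in> carr H\<rbrakk> \<Longrightarrow> coeff_\<Omega>B 0 b g h = 0"
  "\<lbrakk>\<beta> \<in> carr \<Omega>; g \<in> carr H; h \<in> carr H\<rbrakk> \<Longrightarrow> coeff_\<Omega>B \<beta> 0 g h = 0"
  by (simp_all add: coeff_BB_def coeff_B\<Omega>_def coeff_\<Omega>B_def zero_simps mlin cong: tlift_cong)

text \<open>The components of \<open>coeff_assoc\<close> in \<open>E\<close> on triples with at most one form.\<close>

lemma coeff_assoc_BBB:
  assumes "a \<in> carr B" "b \<in> carr B" "c \<in> carr B" and ghk: "g \<in> carr H" "h \<in> carr H" "k \<in> carr H"
  shows "tlift H H (\<lambda>g1 g2. tlift H H (\<lambda>h1 h2.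
      coeff_BB (coeff_BB a b g1 h1) c (g2 \<cdot>\<^bsub>H\<^esub> h2) k) (comul H h)) (comul H g) =
    tlift H H (\<lambda>h1 h2. tlift H H (\<lambda>k1 k2.
      coeff_BB a (coeff_BB b c h1 k1) g (h2 \<cdot>\<^bsub>H\<^esub> k2)) (comul H k)) (comul H h)"
  using EC.coeff_assoc[OF _ _ _ ghk, of "(a, 0)" "(b, 0)" "(c, 0)"] assms
  by (simp add: ext_simps ext_coeff coeff_zero tlift_Pair zero_simps mlin cong: tlift_cong)

lemma coeff_assoc_BB\<Omega>:
  assumes "a \<in> carr B" "b \<in> carr B" "\<beta> \<in> carr \<Omega>" and ghk: "g \<in> carr H" "h \<in> carr H" "k \<in> carr H"
  shows "tlift H H (\<lambda>g1 g2. tlift H H (\<lambda>h1 h2.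
      coeff_B\<Omega> (coeff_BB a b g1 h1) \<beta> (g2 \<cdot>\<^bsub>H\<^esub> h2) k) (comul H h)) (comul H g) =
    tlift H H (\<lambda>h1 h2. tlift H H (\<lambda>k1 k2.
      coeff_B\<Omega> a (coeff_B\<Omega> b \<beta> h1 k1) g (h2 \<cdot>\<^bsub>H\<^esub> k2)) (comul H k)) (comul H h)"
  using EC.coeff_assoc[OF _ _ _ ghk, of "(a, 0)" "(b, 0)" "(0, \<beta>)"] assms
  by (simp add: ext_simps ext_coeff coeff_zero tlift_Pair zero_simps mlin cong: tlift_cong)

lemma coeff_assoc_B\<Omega>B:
  assumes "a \<in> carr B" "\<beta> \<in> carr \<Omega>" "c \<in> carr B" and ghk: "g \<in> carr H" "h \<in> carr H" "k \<in> carr H"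
  shows "tlift H H (\<lambda>g1 g2. tlift H H (\<lambda>h1 h2.
      coeff_\<Omega>B (coeff_B\<Omega> a \<beta> g1 h1) c (g2 \<cdot>\<^bsub>H\<^esub> h2) k) (comul H h)) (comul H g) =
    tlift H H (\<lambda>h1 h2. tlift H H (\<lambda>k1 k2.
      coeff_B\<Omega> a (coeff_\<Omega>B \<beta> c h1 k1) g (h2 \<cdot>\<^bsub>H\<^esub> k2)) (comul H k)) (comul H h)"
  using EC.coeff_assoc[OF _ _ _ ghk, of "(a, 0)" "(0, \<beta>)" "(c, 0)"] assms
  by (simp add: ext_simps ext_coeff coeff_zero tlift_Pair zero_simps mlin cong: tlift_cong)

lemma coeff_assoc_\<Omega>BB:
  assumes "\<beta> \<in> carr \<Omega>" "b \<in> carr B" "c \<in> carr B" and ghk: "g \<in> carr H" "h \<in> carr H" "k \<in> carr H"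
  shows "tlift H H (\<lambda>g1 g2. tlift H H (\<lambda>h1 h2.
      coeff_\<Omega>B (coeff_\<Omega>B \<beta> b g1 h1) c (g2 \<cdot>\<^bsub>H\<^esub> h2) k) (comul H h)) (comul H g) =
    tlift H H (\<lambda>h1 h2. tlift H H (\<lambda>k1 k2.
      coeff_\<Omega>B \<beta> (coeff_BB b c h1 k1) g (h2 \<cdot>\<^bsub>H\<^esub> k2)) (comul H k)) (comul H h)"
  using EC.coeff_assoc[OF _ _ _ ghk, of "(0, \<beta>)" "(b, 0)" "(c, 0)"] assms
  by (simp add: ext_simps ext_coeff coeff_zero tlift_Pair zero_simps mlin cong: tlift_cong)

lemmas coeff_assocs = coeff_assoc_BBB coeff_assoc_BB\<Omega> coeff_assoc_B\<Omega>B coeff_assoc_\<Omega>BB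

end

section \<open>The crossed product and its bimodule of forms\<close>

locale crossed_calculus =
  T: twisted_module_fodc H B act \<sigma> \<sigma>inv \<Omega>B dB act\<Omega> +
  K: bicovariant_fodc H \<Omega>H dH \<delta>H \<rho>H
  for H :: "('k::field, 'h::ab_group_add) hopf"
    and B :: "('k, 'b::ab_group_add) alg"
    and act \<sigma> \<sigma>inv
    and \<Omega>B :: "('k, 'b, 'm::ab_group_add) bimod"
    and dB act\<Omega>
    and \<Omega>H :: "('k, 'h, 'n::ab_group_add) bimod"
    and dH \<delta>H \<rho>H
begin

sublocale forms_left: hopf_left_comodule H \<Omega>H \<delta>H
  by unfold_locales

sublocale forms_right: hopf_right_comodule H \<Omega>H \<rho>H
  by unfold_locales

text \<open>Two-sided covariance at \<open>h' = 1\<close> gives covariance for each action separately, which is the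
  colinearity that the pairings \<open>H \<otimes> \<Omega>\<^sup>1(H) \<rightarrow> \<Omega>\<^sup>1(H)\<close> and \<open>\<Omega>\<^sup>1(H) \<otimes> H \<rightarrow> \<Omega>\<^sup>1(H)\<close> need.\<close>

lemma \<delta>H_lact:
  assumes "h \<in> carr H" "\<omega> \<in> carr \<Omega>H"
  shows "\<delta>H (h \<rhd>\<^bsub>\<Omega>H\<^esub> \<omega>) = tlift H H (\<lambda>g n. tlift H \<Omega>H (\<lambda>k m.
    tens H \<Omega>H (g \<cdot>\<^bsub>H\<^esub> k) (n \<rhd>\<^bsub>\<Omega>H\<^esub> m)) (\<delta>H \<omega>)) (comul H h)"
  using K.left_coaction_compatible[OF assms T.H.unt_mem] assms
  by (simp add: sw2_def T.H.comul_unt tlift_tens[where U = "tensor_space H \<Omega>H"] T.H.mul_unt_right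
      K.ract_unt mlin cong: tlift_cong)

lemma \<delta>H_ract:
  assumes "h \<in> carr H" "\<omega> \<in> carr \<Omega>H"
  shows "\<delta>H (\<omega> \<lhd>\<^bsub>\<Omega>H\<^esub> h) = tlift H \<Omega>H (\<lambda>g m. tlift H H (\<lambda>k n.
    tens H \<Omega>H (g \<cdot>\<^bsub>H\<^esub> k) (m \<lhd>\<^bsub>\<Omega>H\<^esub> n)) (comul H h)) (\<delta>H \<omega>)"
  using K.left_coaction_compatible[OF T.H.unt_mem assms(2,1)] assms
  by (simp add: sw2_def T.H.comul_unt tlift_tens[where U = "tensor_space H \<Omega>H"] T.H.mul_unt_left
      K.lact_unt mlin cong: tlift_cong)

lemma \<rho>H_lact:
  assumes "h \<in> carr H" "\<omega> \<in> carr \<Omega>H"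
  shows "\<rho>H (h \<rhd>\<^bsub>\<Omega>H\<^esub> \<omega>) = tlift H H (\<lambda>n g. tlift \<Omega>H H (\<lambda>m k.
    tens \<Omega>H H (n \<rhd>\<^bsub>\<Omega>H\<^esub> m) (g \<cdot>\<^bsub>H\<^esub> k)) (\<rho>H \<omega>)) (comul H h)"
  using K.coaction_compatible[OF assms T.H.unt_mem] assms
  by (simp add: sw2_def T.H.comul_unt tlift_tens[where U = "tensor_space \<Omega>H H"] T.H.mul_unt_right
      K.ract_unt mlin cong: tlift_cong)

lemma \<rho>H_ract:
  assumes "h \<in> carr H" "\<omega> \<in> carr \<Omega>H"
  shows "\<rho>H (\<omega> \<lhd>\<^bsub>\<Omega>H\<^esub> h) = tlift \<Omega>H H (\<lambda>m g. tlift H H (\<lambda>n k.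
    tens \<Omega>H H (m \<lhd>\<^bsub>\<Omega>H\<^esub> n) (g \<cdot>\<^bsub>H\<^esub> k)) (comul H h)) (\<rho>H \<omega>)"
  using K.coaction_compatible[OF T.H.unt_mem assms(2,1)] assms
  by (simp add: sw2_def T.H.comul_unt tlift_tens[where U = "tensor_space \<Omega>H H"] T.H.mul_unt_left
      K.lact_unt mlin cong: tlift_cong)

sublocale HHH: comodule_pairing H H "comul H" H "comul H" H "comul H" "mul H"
  using T.H.bilin_mul T.H.comul_mul by unfold_locales auto

sublocale HFF: comodule_pairing H H "comul H" \<Omega>H \<delta>H \<Omega>H \<delta>H "lact \<Omega>H"
  using K.bilin_lact \<delta>H_lact by unfold_locales auto

sublocale FHF: comodule_pairing H \<Omega>H \<delta>H H "comul H" \<Omega>H \<delta>H "ract \<Omega>H"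
  using K.bilin_ract \<delta>H_ract by unfold_locales auto

text \<open>The product of the crossed product and the two components of each of its actions on forms.\<close>

sublocale mult: twisted_product H B B B T.coeff_BB H "comul H" H "comul H" H "comul H" "mul H"
  by unfold_locales

sublocale left1: twisted_product H B \<Omega>B \<Omega>B T.coeff_B\<Omega> H "comul H" H "comul H" H "comul H" "mul H"
  by unfold_locales

sublocale left2: twisted_product H B B B T.coeff_BB H "comul H" \<Omega>H \<delta>H \<Omega>H \<delta>H "lact \<Omega>H"
  by unfold_locales

sublocale right1: twisted_product H \<Omega>B B \<Omega>B T.coeff_\<Omega>B H "comul H" H "comul H" H "comul H" "mul H"
  by unfold_locales

sublocale right2: twisted_product H B B B T.coeff_BB \<Omega>H \<delta>H H "comul H" \<Omega>H \<delta>H "ract \<Omega>H"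
  by unfold_locales

text \<open>The three splittings: those of the right coactions of \<open>H\<close> and of \<open>\<Omega>\<^sup>1(H)\<close>, and the left coaction of
  \<open>\<Omega>\<^sup>1(H)\<close> read as a map to \<open>H \<otimes> \<Omega>\<^sup>1(H)\<close>.\<close>

sublocale comul_split: colinear_splitting H H "comul H" H "comul H" H "comul H"
  using T.H.lin_comul T.H.coaction_coassoc
  by unfold_locales (auto simp: mlin sw2_def)

sublocale \<rho>_split: colinear_splitting H \<Omega>H \<delta>H \<Omega>H \<delta>H H \<rho>H
  using K.\<Omega>.lin_coaction K.\<Omega>.coactions_commute
  by unfold_locales (auto simp: mlin)

sublocale \<delta>_split: colinear_splitting H \<Omega>H \<delta>H H "comul H" \<Omega>H \<delta>H
  using K.\<Omega>.L.lin_coaction K.\<Omega>.L.coaction_coassoc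
  by unfold_locales (auto simp: mlin sw2_def)

abbreviation "A \<equiv> crossed_product H B act \<sigma>"
abbreviation "W \<equiv> crossed_forms H B act \<sigma> \<Omega>B act\<Omega> \<Omega>H \<delta>H"
abbreviation "dW \<equiv> crossed_d H B \<Omega>B dB \<Omega>H dH"
abbreviation "\<rho>A \<equiv> crossed_coaction H B act \<sigma>"
abbreviation "\<rho>W \<equiv> crossed_forms_coaction H B act \<sigma> \<Omega>B act\<Omega> \<Omega>H \<delta>H \<rho>H"

abbreviation "S0 \<equiv> tensor_space B H"
abbreviation "S1 \<equiv> tensor_space \<Omega>B H"
abbreviation "S2 \<equiv> tensor_space B \<Omega>H"

lemma crossed_space:
  "carr A = carr S0" "scl A = scl S0"
  "carr W = carr (direct_sum S1 S2)" "scl W = scl (direct_sum S1 S2)"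
  by (simp_all add: crossed_product_def crossed_forms_def)

lemmas crossed_space_simps =
  crossed_space(1,3) space_cong[OF crossed_space(1,2)] space_cong[OF crossed_space(3,4)]

text \<open>The defining formula evaluates the action and \<open>\<sigma>\<close> at \<open>h\<^sub>1\<close>, \<open>h\<^sub>2\<close> of \<open>\<Delta>\<^sup>2(h)\<close>; the twisted product
  first takes \<open>h\<^sub>1 \<otimes> h\<^sub>2\<close> and then comultiplies \<open>h\<^sub>1\<close>.\<close>

lemma crossed_mul:
  assumes X: "X \<in> carr S0" and Y: "Y \<in> carr S0"
  shows "X \<cdot>\<^bsub>A\<^esub> Y = mult.prd X Y"
proof -
  have "sw3 H (\<lambda>h1 h2 h3. sw2 H (\<lambda>h1' h2'.
          tens B H (b \<cdot>\<^bsub>B\<^esub> act h1 b' \<cdot>\<^bsub>B\<^esub> \<sigma> h2 h1') (h3 \<cdot>\<^bsub>H\<^esub> h2')) h') h =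
     tlift H H (\<lambda>g n0. tlift H H (\<lambda>k n0'. tens B H (T.coeff_BB b b' g k) (n0 \<cdot>\<^bsub>H\<^esub> n0'))
         (comul H h')) (comul H h)"
    if "b \<in> carr B" "b' \<in> carr B" "h \<in> carr H" "h' \<in> carr H" for b b' h h'
    using that
    by (simp add: T.coeff_BB_def sw3_def sw2_def tens_push tlift_swap[where X = "comul H h'"]
      T.H.regular.coassoc_sum[where U = S0] mlin cong: tlift_cong)
  then show ?thesis using X Y
    by (simp add: crossed_product_def twisted_prod_def cong: tlift_cong)
qed

lemma crossed_lact:
  assumes X: "X \<in> carr S0" and P: "P \<in> carr S1" and Q: "Q \<in> carr S2"
  shows "X \<rhd>\<^bsub>W\<^esub> (P, Q) = (left1.prd X P, left2.prd X Q)"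
proof -
  have 1: "sw3 H (\<lambda>h1' h2' h3'. sw2 H (\<lambda>h1 h2.
             tens \<Omega>B H ((b' \<rhd>\<^bsub>\<Omega>B\<^esub> act\<Omega> h1' \<beta>) \<lhd>\<^bsub>\<Omega>B\<^esub> \<sigma> h2' h1) (h3' \<cdot>\<^bsub>H\<^esub> h2)) h) h' =
     tlift H H (\<lambda>g n0. tlift H H (\<lambda>k n0'. tens \<Omega>B H (T.coeff_B\<Omega> b' \<beta> g k) (n0 \<cdot>\<^bsub>H\<^esub> n0'))
         (comul H h)) (comul H h')"
    if "b' \<in> carr B" "\<beta> \<in> carr \<Omega>B" "h \<in> carr H" "h' \<in> carr H" for b' \<beta> h h'
    using that
    by (simp add: T.coeff_B\<Omega>_def sw3_def sw2_def tens_push tlift_swap[where X = "comul H h"]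
      T.H.regular.coassoc_sum[where U = S1] mlin cong: tlift_cong)
  have 2: "sw3 H (\<lambda>h1' h2' h3'. tlift H \<Omega>H (\<lambda>g1 \<gamma>0.
             tens B \<Omega>H (b' \<cdot>\<^bsub>B\<^esub> act h1' b \<cdot>\<^bsub>B\<^esub> \<sigma> h2' g1) (h3' \<rhd>\<^bsub>\<Omega>H\<^esub> \<gamma>0)) (\<delta>H \<gamma>)) h' =
     tlift H H (\<lambda>g n0. tlift H \<Omega>H (\<lambda>k n0'. tens B \<Omega>H (T.coeff_BB b' b g k) (n0 \<rhd>\<^bsub>\<Omega>H\<^esub> n0'))
         (\<delta>H \<gamma>)) (comul H h')"
    if "b' \<in> carr B" "b \<in> carr B" "\<gamma> \<in> carr \<Omega>H" "h' \<in> carr H" for b' b \<gamma> h'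
    using that
    by (simp add: T.coeff_BB_def sw3_def sw2_def tens_push tlift_swap[where X = "\<delta>H \<gamma>"]
      T.H.regular.coassoc_sum[where U = S2] mlin cong: tlift_cong)
  show ?thesis using X P Q
    by (simp add: crossed_forms_def twisted_prod_def 1 2 cong: tlift_cong)
qed

lemma crossed_ract:
  assumes X: "X \<in> carr S0" and P: "P \<in> carr S1" and Q: "Q \<in> carr S2"
  shows "(P, Q) \<lhd>\<^bsub>W\<^esub> X = (right1.prd P X, right2.prd Q X)"
proof -
  have 1: "sw3 H (\<lambda>h1 h2 h3. sw2 H (\<lambda>h1' h2'.
             tens \<Omega>B H (\<beta> \<lhd>\<^bsub>\<Omega>B\<^esub> act h1 b' \<lhd>\<^bsub>\<Omega>B\<^esub> \<sigma> h2 h1') (h3 \<cdot>\<^bsub>H\<^esub> h2')) h') h =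
     tlift H H (\<lambda>g n0. tlift H H (\<lambda>k n0'. tens \<Omega>B H (T.coeff_\<Omega>B \<beta> b' g k) (n0 \<cdot>\<^bsub>H\<^esub> n0'))
         (comul H h')) (comul H h)"
    if "b' \<in> carr B" "\<beta> \<in> carr \<Omega>B" "h \<in> carr H" "h' \<in> carr H" for b' \<beta> h h'
    using that
    by (simp add: T.coeff_\<Omega>B_def sw3_def sw2_def tens_push tlift_swap[where X = "comul H h'"]
      T.H.regular.coassoc_sum[where U = S1] mlin cong: tlift_cong)
  have 2: "tlift H \<Omega>H (\<lambda>g \<gamma>0. sw2 H (\<lambda>g2 g1. sw2 H (\<lambda>h1' h2'.
             tens B \<Omega>H (b \<cdot>\<^bsub>B\<^esub> act g2 b' \<cdot>\<^bsub>B\<^esub> \<sigma> g1 h1') (\<gamma>0 \<lhd>\<^bsub>\<Omega>H\<^esub> h2')) h') g) (\<delta>H \<gamma>) =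
     tlift H \<Omega>H (\<lambda>g n0. tlift H H (\<lambda>k n0'. tens B \<Omega>H (T.coeff_BB b b' g k) (n0 \<lhd>\<^bsub>\<Omega>H\<^esub> n0'))
         (comul H h')) (\<delta>H \<gamma>)"
    if "b' \<in> carr B" "b \<in> carr B" "\<gamma> \<in> carr \<Omega>H" "h' \<in> carr H" for b' b \<gamma> h'
    using that
    by (simp add: T.coeff_BB_def sw2_def tens_push tlift_swap[where Y = "comul H h'"]
      mlin cong: tlift_cong)
  show ?thesis using X P Q
    by (simp add: crossed_forms_def twisted_prod_def 1 2 cong: tlift_cong)
qed

lemma coeff_units:
  assumes "k \<in> carr H"
  shows "b \<in> carr B \<Longrightarrow> T.coeff_BB \<one>\<^bsub>B\<^esub> b \<one>\<^bsub>H\<^esub> k = scl B (counit H k) b"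
    "b \<in> carr B \<Longrightarrow> T.coeff_BB b \<one>\<^bsub>B\<^esub> k \<one>\<^bsub>H\<^esub> = scl B (counit H k) b"
    "\<beta> \<in> carr \<Omega>B \<Longrightarrow> T.coeff_B\<Omega> \<one>\<^bsub>B\<^esub> \<beta> \<one>\<^bsub>H\<^esub> k = scl \<Omega>B (counit H k) \<beta>"
    "\<beta> \<in> carr \<Omega>B \<Longrightarrow> T.coeff_\<Omega>B \<beta> \<one>\<^bsub>B\<^esub> k \<one>\<^bsub>H\<^esub> = scl \<Omega>B (counit H k) \<beta>"
  using assms
  by (simp_all add: T.coeff_BB_def T.coeff_B\<Omega>_def T.coeff_\<Omega>B_def T.H.comul_unt
      tlift_tens[where U = B] tlift_tens[where U = \<Omega>B] T.unt_act T.act_unt T.\<sigma>_unt_left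
      T.\<sigma>_unt_right bilin_scl[OF T.B.bilin_mul] bilin_scl[OF T.\<Omega>.bilin_lact]
      bilin_scl[OF T.\<Omega>.bilin_ract] T.B.mul_unt_left T.B.mul_unt_right T.\<Omega>.lact_unt T.\<Omega>.ract_unt
      T.unt_act\<Omega>
      T.H.regular_right.counit_sum[where U = B] T.H.regular_right.counit_sum[where U = \<Omega>B]
      mlin cong: tlift_cong)

abbreviation "u0 \<equiv> tens B H \<one>\<^bsub>B\<^esub> \<one>\<^bsub>H\<^esub>"

lemma crossed_unt: "\<one>\<^bsub>A\<^esub> = u0"
  by (simp add: crossed_product_def)

lemma mult_unit:
  assumes "X \<in> carr S0"
  shows "mult.prd u0 X = X" "mult.prd X u0 = X"
  using assms
  by (auto intro!: twisted_prod_unit_left[OF mult.twisted_product_axioms]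
      twisted_prod_unit_right[OF mult.twisted_product_axioms]
      simp: T.H.comul_unt T.H.mul_unt_left T.H.mul_unt_right coeff_units mlin)

lemma forms_unit:
  assumes P: "P \<in> carr S1" and Q: "Q \<in> carr S2"
  shows "left1.prd u0 P = P" "left2.prd u0 Q = Q" "right1.prd P u0 = P" "right2.prd Q u0 = Q"
  using assms
  by (auto intro!: twisted_prod_unit_left[OF left1.twisted_product_axioms]
      twisted_prod_unit_left[OF left2.twisted_product_axioms]
      twisted_prod_unit_right[OF right1.twisted_product_axioms]
      twisted_prod_unit_right[OF right2.twisted_product_axioms]
      simp: T.H.comul_unt T.H.mul_unt_left T.H.mul_unt_right K.lact_unt K.ract_unt coeff_units mlin)

lemma mult_assoc:
  assumes "X \<in> carr S0" "Y \<in> carr S0" "Z \<in> carr S0"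
  shows "mult.prd (mult.prd X Y) Z = mult.prd X (mult.prd Y Z)"
  by (rule twisted_prod_assoc)
    (rule mult.twisted_product_axioms T.H.mul_assoc T.coeff_assocs assms | assumption)+

text \<open>The bimodule axioms, one component at a time.\<close>

lemma forms_assoc:
  assumes "X \<in> carr S0" "Y \<in> carr S0" "P \<in> carr S1" "Q \<in> carr S2"
  shows "left1.prd (mult.prd X Y) P = left1.prd X (left1.prd Y P)"
    "left2.prd (mult.prd X Y) Q = left2.prd X (left2.prd Y Q)"
    "right1.prd (left1.prd X P) Y = left1.prd X (right1.prd P Y)"
    "right2.prd (left2.prd X Q) Y = left2.prd X (right2.prd Q Y)"
    "right1.prd (right1.prd P X) Y = right1.prd P (mult.prd X Y)"
    "right2.prd (right2.prd Q X) Y = right2.prd Q (mult.prd X Y)"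
  by (rule twisted_prod_assoc,
      (rule mult.twisted_product_axioms left1.twisted_product_axioms left2.twisted_product_axioms
        right1.twisted_product_axioms right2.twisted_product_axioms T.H.mul_assoc K.lact_mul
        K.ract_mul K.ract_mul[symmetric] K.lact_ract T.coeff_assocs assms | assumption)+)+

sublocale A: k_algebra A
proof
  show "vspace A" by (simp add: crossed_space_simps mlin)
  show "bilin A A A (mul A)"
    unfolding crossed_space_simps
    by (rule bilin_cong[OF mult.bilin_prd crossed_mul]) (assumption | rule mlin)+
  show "\<one>\<^bsub>A\<^esub> \<in> carr A" by (simp add: crossed_space_simps crossed_unt mlin)
  show "(X \<cdot>\<^bsub>A\<^esub> Y) \<cdot>\<^bsub>A\<^esub> Z = X \<cdot>\<^bsub>A\<^esub> (Y \<cdot>\<^bsub>A\<^esub> Z)"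
    if "X \<in> carr A" "Y \<in> carr A" "Z \<in> carr A" for X Y Z
    using that by (simp add: crossed_space_simps crossed_mul mult_assoc mlin)
  show "\<one>\<^bsub>A\<^esub> \<cdot>\<^bsub>A\<^esub> X = X" "X \<cdot>\<^bsub>A\<^esub> \<one>\<^bsub>A\<^esub> = X" if "X \<in> carr A" for X
    using that by (simp_all add: crossed_space_simps crossed_mul crossed_unt mult_unit mlin)
qed

sublocale W: bimodule A W
proof
  note [simp] = crossed_space_simps
  show "vspace W" by (simp add: mlin)
  have l: "bilin S0 (direct_sum S1 S2) (direct_sum S1 S2)
      (\<lambda>X R. (left1.prd X (fst R), left2.prd X (snd R)))"
    by (rule bilinI) (simp_all add: direct_sum_components[where V = S1 and W = S2] mlin)
  show "bilin A W W (lact W)"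
    unfolding crossed_space_simps
    by (rule bilin_cong[OF l]) (auto simp: crossed_lact mlin elim!: direct_sum_memE)
  have r: "bilin (direct_sum S1 S2) S0 (direct_sum S1 S2)
      (\<lambda>R X. (right1.prd (fst R) X, right2.prd (snd R) X))"
    by (rule bilinI) (simp_all add: direct_sum_components[where V = S1 and W = S2] mlin)
  show "bilin W A W (ract W)"
    unfolding crossed_space_simps
    by (rule bilin_cong[OF r]) (auto simp: crossed_ract mlin elim!: direct_sum_memE)
  fix R assume "R \<in> carr W"
  then show "\<one>\<^bsub>A\<^esub> \<rhd>\<^bsub>W\<^esub> R = R" "R \<lhd>\<^bsub>W\<^esub> \<one>\<^bsub>A\<^esub> = R"
    by (auto simp: crossed_unt crossed_lact crossed_ract forms_unit mlin elim!: direct_sum_memE)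
  fix X Y assume "X \<in> carr A" "Y \<in> carr A"
  then show "(X \<cdot>\<^bsub>A\<^esub> Y) \<rhd>\<^bsub>W\<^esub> R = X \<rhd>\<^bsub>W\<^esub> (Y \<rhd>\<^bsub>W\<^esub> R)"
    "R \<lhd>\<^bsub>W\<^esub> (X \<cdot>\<^bsub>A\<^esub> Y) = (R \<lhd>\<^bsub>W\<^esub> X) \<lhd>\<^bsub>W\<^esub> Y"
    "(X \<rhd>\<^bsub>W\<^esub> R) \<lhd>\<^bsub>W\<^esub> Y = X \<rhd>\<^bsub>W\<^esub> (R \<lhd>\<^bsub>W\<^esub> Y)"
    using \<open>R \<in> carr W\<close>
    by (auto simp: crossed_mul crossed_lact crossed_ract forms_assoc mlin elim!: direct_sum_memE)
qed

section \<open>Right coactions on functions and forms\<close>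

abbreviation "r0 \<equiv> split_map B H H H (comul H)"
abbreviation "r1 \<equiv> split_map \<Omega>B H H H (comul H)"
abbreviation "r2 \<equiv> split_map B \<Omega>H \<Omega>H H \<rho>H"
abbreviation "s2 \<equiv> split_map B \<Omega>H H \<Omega>H \<delta>H"

lemma vspaces: "vspace H" "vspace B" "vspace \<Omega>B" "vspace \<Omega>H"
  by (simp_all add: mlin)

lemmas lin_splits =
  lin_split_map[OF vspaces(2,1,1) T.H.lin_comul]
  lin_split_map[OF vspaces(3,1,1) T.H.lin_comul]
  lin_split_map[OF vspaces(2,4,4) K.\<Omega>.lin_coaction]
  lin_split_map[OF vspaces(2,4,1) K.\<Omega>.L.lin_coaction]

lemmas split_rules [mlin] = lin_splits[THEN lin_rules(1)] lin_splits[THEN lin_rules(2)]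

lemmas split_tens =
  split_map_tens[OF vspaces(2,1,1) T.H.lin_comul]
  split_map_tens[OF vspaces(3,1,1) T.H.lin_comul]
  split_map_tens[OF vspaces(2,4,4) K.\<Omega>.lin_coaction]
  split_map_tens[OF vspaces(2,4,1) K.\<Omega>.L.lin_coaction]

text \<open>The right coactions \<open>r0\<close>, \<open>r1\<close>, \<open>r2\<close> and the map \<open>s2\<close> carry each of the five products to the product
  of the tensor product algebra or bimodule; for \<open>s2\<close> the product on the first tensor factor is that of
  the crossed product.\<close>

lemmas split_mult =
  split_map_twisted_prod[OF mult.twisted_product_axioms mult.twisted_product_axioms
    comul_split.colinear_splitting_axioms comul_split.colinear_splitting_axioms
    comul_split.colinear_splitting_axioms T.H.bilin_mul T.H.comul_mul]
  split_map_twisted_prod[OF left1.twisted_product_axioms left1.twisted_product_axioms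
    comul_split.colinear_splitting_axioms comul_split.colinear_splitting_axioms
    comul_split.colinear_splitting_axioms T.H.bilin_mul T.H.comul_mul]
  split_map_twisted_prod[OF left2.twisted_product_axioms left2.twisted_product_axioms
    comul_split.colinear_splitting_axioms \<rho>_split.colinear_splitting_axioms
    \<rho>_split.colinear_splitting_axioms T.H.bilin_mul \<rho>H_lact]
  split_map_twisted_prod[OF left2.twisted_product_axioms mult.twisted_product_axioms
    comul_split.colinear_splitting_axioms \<delta>_split.colinear_splitting_axioms
    \<delta>_split.colinear_splitting_axioms K.bilin_lact \<delta>H_lact]
  split_map_twisted_prod[OF right1.twisted_product_axioms right1.twisted_product_axioms
    comul_split.colinear_splitting_axioms comul_split.colinear_splitting_axioms
    comul_split.colinear_splitting_axioms T.H.bilin_mul T.H.comul_mul]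
  split_map_twisted_prod[OF right2.twisted_product_axioms right2.twisted_product_axioms
    \<rho>_split.colinear_splitting_axioms comul_split.colinear_splitting_axioms
    \<rho>_split.colinear_splitting_axioms T.H.bilin_mul \<rho>H_ract]
  split_map_twisted_prod[OF right2.twisted_product_axioms mult.twisted_product_axioms
    \<delta>_split.colinear_splitting_axioms comul_split.colinear_splitting_axioms
    \<delta>_split.colinear_splitting_axioms K.bilin_ract \<delta>H_ract]

lemma crossed_coaction: "\<rho>A X = r0 X"
  by (simp add: crossed_coaction_def split_map_def sw2_def crossed_space_simps)

sublocale A: right_comodule H A \<rho>A
  by (rule right_comodule_cong[OF T.H.regular_right.right_comodule_split_map[OF vspaces(2)]])
    (simp_all add: crossed_coaction crossed_space)

lemma alg_hom_\<rho>A: "alg_hom A (tensor_alg A H) \<rho>A"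
proof -
  have "lin A (tensor_alg A H) \<rho>A"
    using lin_splits(1) by (simp add: lin_def tensor_alg_def crossed_space_simps crossed_space crossed_coaction)
  moreover have "\<rho>A \<one>\<^bsub>A\<^esub> = \<one>\<^bsub>tensor_alg A H\<^esub>"
    by (simp add: tensor_alg_def crossed_coaction crossed_unt split_tens T.H.comul_unt
        tlift_tens[where U = "tensor_space S0 H"] crossed_space_simps mlin)
  moreover have "\<rho>A (X \<cdot>\<^bsub>A\<^esub> Y) = \<rho>A X \<cdot>\<^bsub>tensor_alg A H\<^esub> \<rho>A Y" if "X \<in> carr A" "Y \<in> carr A" for X Y
    using that
    by (simp add: tensor_alg_def crossed_coaction crossed_mul split_mult crossed_space_simps
        mlin cong: tlift_cong)
  ultimately show ?thesis by (simp add: alg_hom_def)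
qed

sublocale A: right_comodule_algebra H A \<rho>A
  by unfold_locales (rule alg_hom_\<rho>A)

lemma forms_coaction:
  assumes "P \<in> carr S1" "Q \<in> carr S2"
  shows "\<rho>W (P, Q) = sum_coaction H S1 S2 r1 r2 (P, Q)"
  using assms
  by (simp add: crossed_forms_coaction_def Let_def sum_coaction_def split_map_def sw2_def
      crossed_space_simps tlift_tlift[where U = "tensor_space (direct_sum S1 S2) H"]
      tlift_tens[where U = "tensor_space (direct_sum S1 S2) H"] mlin cong: tlift_cong)

sublocale W: right_comodule H W \<rho>W
proof -
  have "right_comodule H (direct_sum S1 S2) (sum_coaction H S1 S2 r1 r2)"
    by (intro right_comodule_direct_sum T.H.regular_right.right_comodule_split_map
        forms_right.right_comodule_split_map vspaces T.H.hopf_algebra_axioms)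
  then show "right_comodule H W \<rho>W"
    by (rule right_comodule_cong) (auto simp: forms_coaction crossed_space elim!: direct_sum_memE)
qed

section \<open>The differential\<close>

definition "D1 = tlift B H (\<lambda>b h. tens \<Omega>B H (dB b) h)"
definition "D2 = tlift B H (\<lambda>b h. tens B \<Omega>H b (dH h))"

lemma crossed_d: "dW X = (D1 X, D2 X)"
  by (simp add: crossed_d_def D1_def D2_def)

lemma bilin_D: "bilin B H S1 (\<lambda>b h. tens \<Omega>B H (dB b) h)" "bilin B H S2 (\<lambda>b h. tens B \<Omega>H b (dH h))"
  by (simp_all add: mlin)

lemma lin_D: "lin S0 S1 D1" "lin S0 S2 D2"
  unfolding D1_def D2_def
  by (rule lin_tlift[OF vspaces(2) _ bilin_D(1)] lin_tlift[OF vspaces(2) _ bilin_D(2)], simp add: mlin)+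

lemmas D_rules [mlin] = lin_rules[OF lin_D(1)] lin_rules[OF lin_D(2)]
lemmas D_push = lin_tlift_apply[OF lin_D(1)] lin_tlift_apply[OF lin_D(2)]

lemma D_tens:
  assumes "b \<in> carr B" "h \<in> carr H"
  shows "D1 (tens B H b h) = tens \<Omega>B H (dB b) h" "D2 (tens B H b h) = tens B \<Omega>H b (dH h)"
  unfolding D1_def D2_def
  using assms by (simp_all add: tlift_tens[OF _ bilin_D(1)] tlift_tens[OF _ bilin_D(2)] mlin)

text \<open>\<open>d\<close> commutes with the action and \<open>d \<circ> \<sigma> = 0\<close>, so only \<open>b\<close> and \<open>b'\<close> are differentiated.\<close>

lemma dB_coeff:
  assumes "b \<in> carr B" "b' \<in> carr B" "g \<in> carr H" "h \<in> carr H"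
  shows "dB (T.coeff_BB b b' g h) = T.coeff_\<Omega>B (dB b) b' g h + T.coeff_B\<Omega> b (dB b') g h"
  using assms
  by (simp add: T.coeff_BB_def T.coeff_\<Omega>B_def T.coeff_B\<Omega>_def T.\<Omega>.d_push T.\<Omega>.leibniz T.\<Omega>.act_add
      T.d_\<sigma> T.d_act T.zero_simps tlift_add mlin cong: tlift_cong)

lemma D1_mult:
  assumes X: "X \<in> carr S0" and Y: "Y \<in> carr S0"
  shows "D1 (mult.prd X Y) = right1.prd (D1 X) Y + left1.prd X (D1 Y)"
proof (rule tensor_bilin_eqI[where f = "\<lambda>X Y. D1 (mult.prd X Y)" and U = S1
      and g = "\<lambda>X Y. right1.prd (D1 X) Y + left1.prd X (D1 Y)", OF _ _ _ _ _ X Y])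
  show "bilin S0 S0 S1 (\<lambda>X Y. D1 (mult.prd X Y))"
    "bilin S0 S0 S1 (\<lambda>X Y. right1.prd (D1 X) Y + left1.prd X (D1 Y))"
    by (simp_all add: mlin)
  show "D1 (mult.prd (tens B H b h) (tens B H b' h')) =
      right1.prd (D1 (tens B H b h)) (tens B H b' h') + left1.prd (tens B H b h) (D1 (tens B H b' h'))"
    if "b \<in> carr B" "h \<in> carr H" "b' \<in> carr B" "h' \<in> carr H" for b h b' h'
    using that
    by (simp add: D_tens D_push mult.prd_tens right1.prd_tens left1.prd_tens dB_coeff
        tens_add tlift_add mlin cong: tlift_cong)
qed (simp_all add: mlin)

lemma \<delta>H_dH:
  assumes "h \<in> carr H"
  shows "\<delta>H (dH h) = tlift H H (\<lambda>h1 h2. tens H \<Omega>H h1 (dH h2)) (comul H h)"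
  using K.d_left_colinear[OF assms] by (simp add: sw2_def)

lemma \<rho>H_dH:
  assumes "h \<in> carr H"
  shows "\<rho>H (dH h) = tlift H H (\<lambda>h1 h2. tens \<Omega>H H (dH h1) h2) (comul H h)"
  using K.d_colinear[OF assms] .

text \<open>Left colinearity \<open>\<delta>(dh) = h\<^sub>1 \<otimes> dh\<^sub>2\<close> ensures that differentiating a factor does not change its
  coaction leg, hence not the coefficient.\<close>

lemma D2_mult:
  assumes X: "X \<in> carr S0" and Y: "Y \<in> carr S0"
  shows "D2 (mult.prd X Y) = right2.prd (D2 X) Y + left2.prd X (D2 Y)"
proof (rule tensor_bilin_eqI[where f = "\<lambda>X Y. D2 (mult.prd X Y)" and U = S2
      and g = "\<lambda>X Y. right2.prd (D2 X) Y + left2.prd X (D2 Y)", OF _ _ _ _ _ X Y])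
  show "bilin S0 S0 S2 (\<lambda>X Y. D2 (mult.prd X Y))"
    "bilin S0 S0 S2 (\<lambda>X Y. right2.prd (D2 X) Y + left2.prd X (D2 Y))"
    by (simp_all add: mlin)
  show "D2 (mult.prd (tens B H b h) (tens B H b' h')) =
      right2.prd (D2 (tens B H b h)) (tens B H b' h') + left2.prd (tens B H b h) (D2 (tens B H b' h'))"
    if "b \<in> carr B" "h \<in> carr H" "b' \<in> carr B" "h' \<in> carr H" for b h b' h'
    using that
    by (simp add: D_tens D_push mult.prd_tens right2.prd_tens left2.prd_tens K.leibniz \<delta>H_dH
        tlift_tlift[where U = S2] tlift_tens[where U = S2] tens_add tlift_add mlin cong: tlift_cong)
qed (simp_all add: mlin)

lemma coeff_unit_right:
  assumes "b \<in> carr B" "g \<in> carr H" "h \<in> carr H"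
  shows "T.coeff_BB b \<one>\<^bsub>B\<^esub> g h = b \<cdot>\<^bsub>B\<^esub> \<sigma> g h"
proof -
  have "T.coeff_BB b \<one>\<^bsub>B\<^esub> g h = tlift H H (\<lambda>g1 g2. scl B (counit H g1) (b \<cdot>\<^bsub>B\<^esub> \<sigma> g2 h)) (comul H g)"
    using assms
    by (simp add: T.coeff_BB_def T.act_unt bilin_scl[OF T.B.bilin_mul] T.B.mul_unt_right
       mlin cong: tlift_cong)
  also have "\<dots> = b \<cdot>\<^bsub>B\<^esub> \<sigma> g h"
    using assms by (intro T.H.regular.counit_sum) (simp_all add: mlin)
  finally show ?thesis .
qed

text \<open>The form \<open>b \<otimes> h dh'\<close> as a sum of products
  \<open>(b \<sigma>\<^sup>-\<^sup>1(h\<^sub>1, h'\<^sub>1) \<otimes> h\<^sub>2) (1 \<otimes> dh'\<^sub>2)\<close>: each of them contributes a factor \<open>\<sigma>(h\<^sub>2, h'\<^sub>2)\<close>, which cancels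
  against \<open>\<sigma>\<^sup>-\<^sup>1\<close>.\<close>

lemma untwist:
  assumes b: "b \<in> carr B" and h: "h \<in> carr H" "h' \<in> carr H"
  shows "tlift H H (\<lambda>h1 h2. tlift H H (\<lambda>h1' h2'.
      left2.prd (tens B H (b \<cdot>\<^bsub>B\<^esub> \<sigma>inv h1 h1') h2) (tens B \<Omega>H \<one>\<^bsub>B\<^esub> (dH h2'))) (comul H h')) (comul H h) =
    tens B \<Omega>H b (h \<rhd>\<^bsub>\<Omega>H\<^esub> dH h')"
proof -
  have "tlift H H (\<lambda>h1 h2. tlift H H (\<lambda>h1' h2'.
      left2.prd (tens B H (b \<cdot>\<^bsub>B\<^esub> \<sigma>inv h1 h1') h2) (tens B \<Omega>H \<one>\<^bsub>B\<^esub> (dH h2'))) (comul H h')) (comul H h) =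
    tlift H H (\<lambda>h1 h2. tlift H H (\<lambda>h1' h2'.
      tens B \<Omega>H (b \<cdot>\<^bsub>B\<^esub> tlift H H (\<lambda>g1 g2. tlift H H (\<lambda>k1 k2. \<sigma>inv g1 k1 \<cdot>\<^bsub>B\<^esub> \<sigma> g2 k2)
          (comul H h1')) (comul H h1))
        (h2 \<rhd>\<^bsub>\<Omega>H\<^esub> dH h2')) (comul H h')) (comul H h)"
    using assms
    by (simp add: left2.prd_tens \<delta>H_dH coeff_unit_right
        tlift_tlift[where U = S2] tlift_tens[where U = S2]
        T.B.alg_push T.B.mul_assoc tens_push tlift_swap[where X = "comul H h'"]
        T.H.regular.coassoc_sum[where U = S2] mlin cong: tlift_cong)
  also have "\<dots> = tlift H H (\<lambda>h1 h2. tlift H H (\<lambda>h1' h2'.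
      scl S2 (counit H h1') (scl S2 (counit H h1) (tens B \<Omega>H b (h2 \<rhd>\<^bsub>\<Omega>H\<^esub> dH h2'))))
        (comul H h')) (comul H h)"
    using assms T.\<sigma>inv_\<sigma>
    by (simp add: sw2_def bilin_scl[OF T.B.bilin_mul] T.B.mul_unt_right scl_tens
        vspace_scl(3)[OF T.B.vspace_alg] mult.commute mlin cong: tlift_cong)
  also have "\<dots> = tens B \<Omega>H b (h \<rhd>\<^bsub>\<Omega>H\<^esub> dH h')"
    using assms by (simp add: T.H.regular.counit_sum[where U = S2] mlin cong: tlift_cong)
  finally show ?thesis .
qed

lemma forms_zero:
  assumes "X \<in> carr S0"
  shows "left1.prd X 0 = 0" "left2.prd X 0 = 0" "right1.prd 0 X = 0" "right2.prd 0 X = 0"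
  using assms bilin_zero(2)[OF left1.bilin_prd] bilin_zero(2)[OF left2.bilin_prd]
    bilin_zero(1)[OF right1.bilin_prd] bilin_zero(1)[OF right2.bilin_prd]
  by (simp_all add: mlin)

lemma left_B_unit:
  assumes b: "b \<in> carr B"
  shows "\<beta> \<in> carr \<Omega>B \<Longrightarrow> h \<in> carr H \<Longrightarrow>
      left1.prd (tens B H b \<one>\<^bsub>H\<^esub>) (tens \<Omega>B H \<beta> h) = tens \<Omega>B H (b \<rhd>\<^bsub>\<Omega>B\<^esub> \<beta>) h"
    "b' \<in> carr B \<Longrightarrow> \<gamma> \<in> carr \<Omega>H \<Longrightarrow>
      left2.prd (tens B H b \<one>\<^bsub>H\<^esub>) (tens B \<Omega>H b' \<gamma>) = tens B \<Omega>H (b \<cdot>\<^bsub>B\<^esub> b') \<gamma>"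
proof -
  have c: "T.coeff_B\<Omega> b \<beta> \<one>\<^bsub>H\<^esub> k = scl \<Omega>B (counit H k) (b \<rhd>\<^bsub>\<Omega>B\<^esub> \<beta>)"
    if "\<beta> \<in> carr \<Omega>B" "k \<in> carr H" for \<beta> k
    using that b by (simp add: T.coeff_B\<Omega>_def T.H.comul_unt tlift_tens[where U = \<Omega>B] T.unt_act\<Omega>
        T.\<sigma>_unt_left bilin_scl[OF T.\<Omega>.bilin_ract] T.\<Omega>.ract_unt mlin)
  have c': "T.coeff_BB b b' \<one>\<^bsub>H\<^esub> k = scl B (counit H k) (b \<cdot>\<^bsub>B\<^esub> b')"
    if "b' \<in> carr B" "k \<in> carr H" for b' k
    using that b by (simp add: T.coeff_BB_def T.H.comul_unt tlift_tens[where U = B] T.unt_act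
        T.\<sigma>_unt_left bilin_scl[OF T.B.bilin_mul] T.B.mul_unt_right mlin)
  show "left1.prd (tens B H b \<one>\<^bsub>H\<^esub>) (tens \<Omega>B H \<beta> h) = tens \<Omega>B H (b \<rhd>\<^bsub>\<Omega>B\<^esub> \<beta>) h"
    if "\<beta> \<in> carr \<Omega>B" "h \<in> carr H"
    using that b by (simp add: left1.prd_tens T.H.comul_unt tlift_tens[where U = S1] c
        T.H.mul_unt_left scl_tens[symmetric] T.H.regular.counit_sum[where U = S1] mlin cong: tlift_cong)
  show "left2.prd (tens B H b \<one>\<^bsub>H\<^esub>) (tens B \<Omega>H b' \<gamma>) = tens B \<Omega>H (b \<cdot>\<^bsub>B\<^esub> b') \<gamma>"
    if "b' \<in> carr B" "\<gamma> \<in> carr \<Omega>H"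
    using that b by (simp add: left2.prd_tens T.H.comul_unt tlift_tens[where U = S2] c'
        K.lact_unt scl_tens[symmetric] forms_left.counit_sum[where U = S2] mlin cong: tlift_cong)
qed

abbreviation "exact_forms \<equiv> {X \<rhd>\<^bsub>W\<^esub> dW Y | X Y. X \<in> carr A \<and> Y \<in> carr A}"

text \<open>In the first summand \<open>b db' \<otimes> h = (b \<otimes> 1) d(b' \<otimes> h) - (bb' \<otimes> 1) d(1 \<otimes> h)\<close>; in the second
  \<open>untwist\<close> applies, since \<open>d(1 \<otimes> h') = 1 \<otimes> dh'\<close>.\<close>

lemma forms_spanned: "carr W = module.span (scl W) exact_forms"
proof
  interpret V: vector_space "scl W" using W.vspace_bimod by (simp add: vspace_def)
  have exact: "exact_forms \<subseteq> carr W"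
    by (auto simp: crossed_space_simps crossed_d crossed_lact mlin)
  \<comment> \<open>the span as a space of its own, so that Sweedler sums of its members stay in it\<close>
  let ?U = "\<lparr>carr = V.span exact_forms, scl = scl W\<rparr>"
  have U: "vspace ?U" and sub: "V.span exact_forms \<subseteq> carr W"
    using vspace_span[OF W.vspace_bimod exact] by auto
  show "V.span exact_forms \<subseteq> carr W" by (rule sub)
  have exactI: "(left1.prd X (D1 Y), left2.prd X (D2 Y)) \<in> carr ?U"
    if "X \<in> carr S0" "Y \<in> carr S0" for X Y
  proof -
    have "X \<rhd>\<^bsub>W\<^esub> dW Y \<in> V.span exact_forms"
      by (rule V.span_base) (use that in \<open>auto simp: crossed_space\<close>)
    then show ?thesis using that by (simp add: crossed_d crossed_lact mlin)
  qed
  have d1: "(tens \<Omega>B H (b \<rhd>\<^bsub>\<Omega>B\<^esub> dB b') h, 0) \<in> carr ?U"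
    if "b \<in> carr B" "b' \<in> carr B" "h \<in> carr H" for b b' h
  proof -
    have "(tens \<Omega>B H (b \<rhd>\<^bsub>\<Omega>B\<^esub> dB b') h, tens B \<Omega>H (b \<cdot>\<^bsub>B\<^esub> b') (dH h)) \<in> carr ?U"
      using exactI[of "tens B H b \<one>\<^bsub>H\<^esub>" "tens B H b' h"] that
      by (simp add: D_tens left_B_unit mlin)
    moreover have "(0, tens B \<Omega>H (b \<cdot>\<^bsub>B\<^esub> b') (dH h)) \<in> carr ?U"
      using exactI[of "tens B H (b \<cdot>\<^bsub>B\<^esub> b') \<one>\<^bsub>H\<^esub>" "tens B H \<one>\<^bsub>B\<^esub> h"] that
      by (simp add: D_tens left_B_unit T.\<Omega>.d_unt T.B.mul_unt_right tens_zero forms_zero mlin)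
    ultimately have "(tens \<Omega>B H (b \<rhd>\<^bsub>\<Omega>B\<^esub> dB b') h, tens B \<Omega>H (b \<cdot>\<^bsub>B\<^esub> b') (dH h)) -
        (0, tens B \<Omega>H (b \<cdot>\<^bsub>B\<^esub> b') (dH h)) \<in> carr ?U"
      by (rule vspace_mem(4)[OF U])
    then show ?thesis by simp
  qed
  have d2: "(0, tens B \<Omega>H b (h \<rhd>\<^bsub>\<Omega>H\<^esub> dH h')) \<in> carr ?U"
    if b: "b \<in> carr B" and h: "h \<in> carr H" "h' \<in> carr H" for b h h'
  proof -
    have "tlift H H (\<lambda>h1 h2. tlift H H (\<lambda>h1' h2'.
        (0, left2.prd (tens B H (b \<cdot>\<^bsub>B\<^esub> \<sigma>inv h1 h1') h2) (tens B \<Omega>H \<one>\<^bsub>B\<^esub> (dH h2')))) (comul H h'))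
          (comul H h) \<in> carr ?U"
    proof (rule tlift_mem[OF U], simp add: mlin h, rule tlift_mem[OF U], simp add: mlin h)
      fix h1 h2 h1' h2' assume a: "h1 \<in> carr H" "h2 \<in> carr H" "h1' \<in> carr H" "h2' \<in> carr H"
      show "(0, left2.prd (tens B H (b \<cdot>\<^bsub>B\<^esub> \<sigma>inv h1 h1') h2) (tens B \<Omega>H \<one>\<^bsub>B\<^esub> (dH h2'))) \<in> carr ?U"
        using exactI[of "tens B H (b \<cdot>\<^bsub>B\<^esub> \<sigma>inv h1 h1') h2" "tens B H \<one>\<^bsub>B\<^esub> h2'"] a b
        by (simp add: D_tens T.\<Omega>.d_unt tens_zero forms_zero mlin)
    qed
    then show ?thesis
      by (simp add: tlift_Pair tlift_zero untwist[OF b h])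
  qed
  have e1: "(tens \<Omega>B H \<beta> h, 0) \<in> carr ?U" if \<beta>: "\<beta> \<in> carr \<Omega>B" and h: "h \<in> carr H" for \<beta> h
    by (rule T.\<Omega>.forms_lin_mem[where f = "\<lambda>\<beta>. (tens \<Omega>B H \<beta> h, 0)" and U = W, OF _ U _ _ \<beta>])
      (use h d1 in \<open>simp_all add: crossed_space_simps mlin\<close>)
  have e2: "(0, tens B \<Omega>H b \<gamma>) \<in> carr ?U" if b: "b \<in> carr B" and \<gamma>: "\<gamma> \<in> carr \<Omega>H" for b \<gamma>
    by (rule K.forms_lin_mem[where f = "\<lambda>\<gamma>. (0, tens B \<Omega>H b \<gamma>)" and U = W, OF _ U _ _ \<gamma>])
      (use b d2 in \<open>simp_all add: crossed_space_simps mlin\<close>)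
  show "carr W \<subseteq> V.span exact_forms"
  proof
    fix R assume "R \<in> carr W"
    then obtain P Q where R: "R = (P, Q)" and P: "P \<in> carr S1" and Q: "Q \<in> carr S2"
      by (auto simp: crossed_space elim!: direct_sum_memE)
    have "(tlift \<Omega>B H (tens \<Omega>B H) P, 0) = tlift \<Omega>B H (\<lambda>\<beta> h. (tens \<Omega>B H \<beta> h, 0)) P"
      by (simp add: tlift_Pair tlift_zero)
    also have "\<dots> \<in> carr ?U" using P e1 by (intro tlift_mem[OF U])
    finally have 1: "(P, 0) \<in> carr ?U" unfolding tensor_eq_tlift[OF P, symmetric] .
    have "(0, tlift B \<Omega>H (tens B \<Omega>H) Q) = tlift B \<Omega>H (\<lambda>b \<gamma>. (0, tens B \<Omega>H b \<gamma>)) Q"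
      by (simp add: tlift_Pair tlift_zero)
    also have "\<dots> \<in> carr ?U" using Q e2 by (intro tlift_mem[OF U])
    finally have 2: "(0, Q) \<in> carr ?U" unfolding tensor_eq_tlift[OF Q, symmetric] .
    show "R \<in> V.span exact_forms"
      using vspace_mem(2)[OF U 1 2] by (simp add: R)
  qed
qed

sublocale W: fodc A W dW
proof
  show "lin A W dW"
    unfolding crossed_space_simps crossed_d by (rule mlin)+
  show "dW (X \<cdot>\<^bsub>A\<^esub> Y) = (dW X \<lhd>\<^bsub>W\<^esub> Y) + (X \<rhd>\<^bsub>W\<^esub> dW Y)"
    if "X \<in> carr A" "Y \<in> carr A" for X Y
    using that by (simp add: crossed_space_simps crossed_mul crossed_d crossed_lact crossed_ract
        D1_mult D2_mult mlin)
qed (rule forms_spanned)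

section \<open>Covariance and differentiability\<close>

abbreviation "SW \<equiv> direct_sum S1 S2"

lemma lin_\<rho>W: "lin SW (tensor_space SW H) \<rho>W"
  using W.lin_coaction by (simp add: crossed_space_simps)

lemmas \<rho>W_rules [mlin] = lin_rules[OF lin_\<rho>W]

lemma \<rho>W_split:
  assumes "P \<in> carr S1" "Q \<in> carr S2"
  shows "\<rho>W (P, Q) = tlift S1 H (\<lambda>v h. tens SW H (v, 0) h) (r1 P) +
    tlift S2 H (\<lambda>w h. tens SW H (0, w) h) (r2 Q)"
  by (simp add: forms_coaction assms sum_coaction_def)

lemma lact_rules [mlin]:
  "X \<in> carr S0 \<Longrightarrow> R \<in> carr SW \<Longrightarrow> X \<rhd>\<^bsub>W\<^esub> R \<in> carr SW"
  "lin S S0 f \<Longrightarrow> R \<in> carr SW \<Longrightarrow> lin S SW (\<lambda>x. f x \<rhd>\<^bsub>W\<^esub> R)"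
  "lin S SW g \<Longrightarrow> X \<in> carr S0 \<Longrightarrow> lin S SW (\<lambda>x. X \<rhd>\<^bsub>W\<^esub> g x)"
  "X \<in> carr S0 \<Longrightarrow> R \<in> carr SW \<Longrightarrow> R \<lhd>\<^bsub>W\<^esub> X \<in> carr SW"
  "lin S S0 f \<Longrightarrow> R \<in> carr SW \<Longrightarrow> lin S SW (\<lambda>x. R \<lhd>\<^bsub>W\<^esub> f x)"
  "lin S SW g \<Longrightarrow> X \<in> carr S0 \<Longrightarrow> lin S SW (\<lambda>x. g x \<lhd>\<^bsub>W\<^esub> X)"
  using bilin_rules[OF W.bilin_lact] bilin_rules[OF W.bilin_ract] by (simp_all add: crossed_space_simps)

text \<open>\<open>\<rho>(X \<omega>) = X\<^sub>0 \<omega>\<^sub>0 \<otimes> X\<^sub>1 \<omega>\<^sub>1\<close> follows from the two components, since the actions and the embeddings of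
  the summands are compatible.\<close>

lemma \<rho>W_lact:
  assumes X: "X \<in> carr S0" and R: "R \<in> carr SW"
  shows "\<rho>W (X \<rhd>\<^bsub>W\<^esub> R) = tlift S0 H (\<lambda>x v. tlift SW H (\<lambda>y v'.
    tens SW H (x \<rhd>\<^bsub>W\<^esub> y) (v \<cdot>\<^bsub>H\<^esub> v')) (\<rho>W R)) (r0 X)"
proof -
  obtain P Q where R: "R = (P, Q)" "P \<in> carr S1" "Q \<in> carr S2"
    using R by (rule direct_sum_memE)
  show ?thesis using X R(2,3) unfolding R(1)
    by (simp add: crossed_lact \<rho>W_split split_mult
        tlift_tlift[where U = "tensor_space SW H"] tlift_tens[where U = "tensor_space SW H"]
        tlift_arg_add[where U = "tensor_space SW H"] tlift_add forms_zero mlin cong: tlift_cong)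
qed

lemma \<rho>W_ract:
  assumes X: "X \<in> carr S0" and R: "R \<in> carr SW"
  shows "\<rho>W (R \<lhd>\<^bsub>W\<^esub> X) = tlift SW H (\<lambda>y v. tlift S0 H (\<lambda>x v'.
    tens SW H (y \<lhd>\<^bsub>W\<^esub> x) (v \<cdot>\<^bsub>H\<^esub> v')) (r0 X)) (\<rho>W R)"
proof -
  obtain P Q where R: "R = (P, Q)" "P \<in> carr S1" "Q \<in> carr S2"
    using R by (rule direct_sum_memE)
  show ?thesis using X R(2,3) unfolding R(1)
    by (simp add: crossed_ract \<rho>W_split split_mult
        tlift_tlift[where U = "tensor_space SW H"] tlift_tens[where U = "tensor_space SW H"]
        tlift_arg_add[where U = "tensor_space SW H"] tlift_add forms_zero mlin cong: tlift_cong)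
qed

lemma \<rho>W_dW:
  assumes X: "X \<in> carr S0"
  shows "\<rho>W (dW X) = tlift S0 H (\<lambda>x h. tens SW H (dW x) h) (r0 X)"
proof -
  let ?U = "tensor_space SW H"
  let ?g1 = "\<lambda>X. tlift S0 H (\<lambda>x h. tens SW H (D1 x, 0) h) (r0 X)"
  let ?g2 = "\<lambda>X. tlift S0 H (\<lambda>x h. tens SW H (0, D2 x) h) (r0 X)"
  have "tlift S1 H (\<lambda>v h. tens SW H (v, 0) h) (r1 (D1 X)) = ?g1 X"
  proof (rule tensor_lin_eqI[where U = ?U and g = ?g1 and
        f = "\<lambda>X. tlift S1 H (\<lambda>v h. tens SW H (v, 0) h) (r1 (D1 X))", OF _ _ _ _ X])
    show "tlift S1 H (\<lambda>v h. tens SW H (v, 0) h) (r1 (D1 (tens B H b h))) = ?g1 (tens B H b h)"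
      if "b \<in> carr B" "h \<in> carr H" for b h
      using that
      by (simp add: D_tens split_tens tlift_tlift[where U = ?U] tlift_tens[where U = ?U]
          mlin cong: tlift_cong)
  qed (simp_all add: mlin)
  moreover have "tlift S2 H (\<lambda>w h. tens SW H (0, w) h) (r2 (D2 X)) = ?g2 X"
  proof (rule tensor_lin_eqI[where U = ?U and g = ?g2 and
        f = "\<lambda>X. tlift S2 H (\<lambda>w h. tens SW H (0, w) h) (r2 (D2 X))", OF _ _ _ _ X])
    show "tlift S2 H (\<lambda>w h. tens SW H (0, w) h) (r2 (D2 (tens B H b h))) = ?g2 (tens B H b h)"
      if "b \<in> carr B" "h \<in> carr H" for b h
      using that
      by (simp add: D_tens split_tens \<rho>H_dH tlift_tlift[where U = ?U] tlift_tens[where U = ?U]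
          tlift_tlift[where U = "tensor_space S2 H"] tlift_tens[where U = "tensor_space S2 H"]
          mlin cong: tlift_cong)
  qed (simp_all add: mlin)
  moreover have "tlift S0 H (\<lambda>x h. tens SW H (dW x) h) (r0 X) = ?g1 X + ?g2 X"
    unfolding tlift_add[symmetric]
    using X by (intro tlift_cong) (simp_all add: crossed_d tens_add[symmetric] mlin)
  ultimately show ?thesis
    using X by (simp add: crossed_d \<rho>W_split mlin)
qed

sublocale W: right_covariant_fodc H A \<rho>A W dW \<rho>W
proof
  show "\<rho>W ((X \<rhd>\<^bsub>W\<^esub> R) \<lhd>\<^bsub>W\<^esub> Y) =
      tlift A H (\<lambda>a0 a1. tlift W H (\<lambda>\<omega>0 \<omega>1. tlift A H (\<lambda>a0' a1'.
        tens W H ((a0 \<rhd>\<^bsub>W\<^esub> \<omega>0) \<lhd>\<^bsub>W\<^esub> a0') ((a1 \<cdot>\<^bsub>H\<^esub> \<omega>1) \<cdot>\<^bsub>H\<^esub> a1'))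
        (\<rho>A Y)) (\<rho>W R)) (\<rho>A X)"
    if "X \<in> carr A" "R \<in> carr W" "Y \<in> carr A" for X R Y
    using that
    by (simp add: crossed_space_simps crossed_coaction \<rho>W_lact \<rho>W_ract
        tlift_tlift[where U = "tensor_space SW H"] tlift_tens[where U = "tensor_space SW H"]
        mlin cong: tlift_cong)
  show "\<rho>W (dW X) = tlift A H (\<lambda>a0 a1. tens W H (dW a0) a1) (\<rho>A X)" if "X \<in> carr A" for X
    using that by (simp add: crossed_space_simps crossed_coaction \<rho>W_dW)
qed

text \<open>Left colinearity of \<open>d\<close> on \<open>H\<close>.\<close>

lemma s2_D2:
  assumes "X \<in> carr S0"
  shows "s2 (D2 X) = tlift S0 H (\<lambda>x h. tens S0 \<Omega>H x (dH h)) (r0 X)"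
proof (rule tensor_lin_eqI[where f = "\<lambda>X. s2 (D2 X)" and U = "tensor_space S0 \<Omega>H"
      and g = "\<lambda>X. tlift S0 H (\<lambda>x h. tens S0 \<Omega>H x (dH h)) (r0 X)", OF _ _ _ _ assms])
  show "lin S0 (tensor_space S0 \<Omega>H) (\<lambda>X. s2 (D2 X))"
    "lin S0 (tensor_space S0 \<Omega>H) (\<lambda>X. tlift S0 H (\<lambda>x h. tens S0 \<Omega>H x (dH h)) (r0 X))"
    by (simp_all add: mlin)
  show "s2 (D2 (tens B H b h)) = tlift S0 H (\<lambda>x h. tens S0 \<Omega>H x (dH h)) (r0 (tens B H b h))"
    if "b \<in> carr B" "h \<in> carr H" for b h
    using that
    by (simp add: D_tens split_tens \<delta>H_dH tlift_tlift[where U = "tensor_space S0 \<Omega>H"]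
        tlift_tens[where U = "tensor_space S0 \<Omega>H"] mlin cong: tlift_cong)
qed (simp add: mlin)

text \<open>On \<open>\<beta> \<otimes> h + b \<otimes> \<gamma>\<close> the bimodule map is the right coaction in the component \<open>\<Omega>\<^sup>1 \<otimes> H\<close> and
  \<open>(b \<otimes> \<gamma>\<^sub>-\<^sub>1) \<otimes> \<gamma>\<^sub>0\<close> in the component with values in \<open>\<Omega>\<^sup>1(H)\<close>.  The second one is forced by
  \<open>d(h\<^sub>1 \<otimes> h\<^sub>2) = dh\<^sub>1 \<otimes> h\<^sub>2 + h\<^sub>1 \<otimes> dh\<^sub>2\<close>: it has to send \<open>b \<otimes> dh\<close> to \<open>(b \<otimes> h\<^sub>1) \<otimes> dh\<^sub>2\<close>.\<close>

lemma coaction_differentiable: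
  "differentiable A W dW (tensor_alg A H) (tensor_forms A W H \<Omega>H) (tensor_d A W dW H \<Omega>H dH) \<rho>A"
  unfolding differentiable_def
proof (intro conjI exI ballI)
  let ?F = "\<lambda>R. (\<rho>W R, s2 (snd R))"
  show "alg_hom A (tensor_alg A H) \<rho>A" by (rule alg_hom_\<rho>A)
  have "lin SW (direct_sum (tensor_space SW H) (tensor_space S0 \<Omega>H)) ?F"
    by (simp add: mlin direct_sum_components[where V = S1 and W = S2])
  then show "lin W (tensor_forms A W H \<Omega>H) ?F"
    by (simp add: lin_def tensor_forms_def crossed_space crossed_space_simps)
  fix X assume "X \<in> carr A"
  then have X: "X \<in> carr S0" by (simp add: crossed_space)
  show "?F (dW X) = tensor_d A W dW H \<Omega>H dH (\<rho>A X)"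
  proof -
    have "snd (dW X) = D2 X" by (simp add: crossed_d)
    then show ?thesis
      using X by (simp add: tensor_d_def crossed_space_simps crossed_coaction \<rho>W_dW s2_D2)
  qed
  fix R assume "R \<in> carr W"
  then have "R \<in> carr SW" by (simp add: crossed_space)
  then obtain P Q where R: "R = (P, Q)" and P: "P \<in> carr S1" and Q: "Q \<in> carr S2"
    by (rule direct_sum_memE)
  have "snd (X \<rhd>\<^bsub>W\<^esub> R) = left2.prd X Q" "snd (R \<lhd>\<^bsub>W\<^esub> X) = right2.prd Q X"
    using X P Q by (simp_all add: R crossed_lact crossed_ract)
  then show "?F (X \<rhd>\<^bsub>W\<^esub> R) = \<rho>A X \<rhd>\<^bsub>tensor_forms A W H \<Omega>H\<^esub> ?F R"
    "?F (R \<lhd>\<^bsub>W\<^esub> X) = ?F R \<lhd>\<^bsub>tensor_forms A W H \<Omega>H\<^esub> \<rho>A X"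
    using X P Q \<open>R \<in> carr SW\<close>
    by (simp_all add: R tensor_forms_def crossed_space_simps crossed_coaction \<rho>W_lact \<rho>W_ract
        crossed_mul split_mult mlin cong: tlift_cong)
qed

end

theorem theorem3p7:
  fixes H :: "('k::field, 'h::ab_group_add) hopf"
    and B :: "('k, 'b::ab_group_add) alg"
    and act :: "'h \<Rightarrow> 'b \<Rightarrow> 'b"
    and \<sigma> \<sigma>inv :: "'h \<Rightarrow> 'h \<Rightarrow> 'b"
    and \<Omega>H :: "('k, 'h, 'n::ab_group_add) bimod"
    and dH :: "'h \<Rightarrow> 'n"
    and \<delta>H :: "'n \<Rightarrow> ('k, 'h, 'n) tensor"
    and \<rho>H :: "'n \<Rightarrow> ('k, 'n, 'h) tensor"
    and \<Omega>B :: "('k, 'b, 'm::ab_group_add) bimod"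
    and dB :: "'b \<Rightarrow> 'm"
    and act\<Omega> :: "'h \<Rightarrow> 'm \<Rightarrow> 'm"
  assumes "hopf_algebra H"
    and "bij_betw (antipode H) (carr H) (carr H)"
    and "twisted_module_algebra H B act \<sigma> \<sigma>inv"
    and "bicovariant_fodc H \<Omega>H dH \<delta>H \<rho>H"
    and "twisted_module_fodc H B act \<sigma> \<sigma>inv \<Omega>B dB act\<Omega>"
  shows "right_covariant_fodc H
           (crossed_product H B act \<sigma>) (crossed_coaction H B act \<sigma>)
           (crossed_forms H B act \<sigma> \<Omega>B act\<Omega> \<Omega>H \<delta>H) (crossed_d H B \<Omega>B dB \<Omega>H dH)
           (crossed_forms_coaction H B act \<sigma> \<Omega>B act\<Omega> \<Omega>H \<delta>H \<rho>H) \<and>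
         differentiable
           (crossed_product H B act \<sigma>)
           (crossed_forms H B act \<sigma> \<Omega>B act\<Omega> \<Omega>H \<delta>H) (crossed_d H B \<Omega>B dB \<Omega>H dH)
           (tensor_alg (crossed_product H B act \<sigma>) H)
           (tensor_forms (crossed_product H B act \<sigma>)
              (crossed_forms H B act \<sigma> \<Omega>B act\<Omega> \<Omega>H \<delta>H) H \<Omega>H)
           (tensor_d (crossed_product H B act \<sigma>)
              (crossed_forms H B act \<sigma> \<Omega>B act\<Omega> \<Omega>H \<delta>H) (crossed_d H B \<Omega>B dB \<Omega>H dH) H \<Omega>H dH)
           (crossed_coaction H B act \<sigma>)"
proof -
  interpret crossed_calculus H B act \<sigma> \<sigma>inv \<Omega>B dB act\<Omega> \<Omega>H dH \<delta>H \<rho>H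
    using assms by (simp add: crossed_calculus_def)
  show ?thesis
    using W.right_covariant_fodc_axioms coaction_differentiable by blast
qed

end
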